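(* Let $M$ be a machine computing $f$ whose executions are synchronous with cycle $\Delta$ and width $q$. Call a fire querying if it reads a raw word, and let $F(x)$ be the number of rounds of $M(x)$ (the execution on input $x$) containing a querying fire. Then there is a leveled branching program computing $f$ with $M$'s success probability ($1$ for a deterministic $M$), with at most one query per level, whose nodes are encoded by pairs of strings: the machine's computed string at the start of the node's round, and the answers, i.e. the contents of the distinct raw words read by fires so far in that round, in the order of their first reading. The nodes are distinct as pairs within each level apart from one designated empty node per level, distinguished from every other node, from which no output is produced; the root, alone at its level, is encoded as the empty pair. On every input $x$ the run produces its last output within $2qF(x)$ levels (an output on an edge counts at the edge's source level) and, once $M(x)$ has halted, visits only empty nodes; its node lengths sum to at most $$2q\sum_t|\mathrm{live}_t(x)|\;\le\;2q\,\mathsf{A}/\Delta,$$ where $\mathrm{live}_t(x)$ is the live set during the $t$-th hold and $\mathsf{A}=\sum_\ell\mathsf{A}_\ell$. Hence its cumulative memory, the sum over levels of the logarithm (base $2$) of the width, is at most $$2q\sum_t\Big(\max_x|\mathrm{live}_t(x)|+\big\lceil\log_2\big(\max_x|\mathrm{live}_t(x)|+2\big)\big\rceil+1\Big).$$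
   Context: Leveled branching program: a leveled directed acyclic multigraph with one root at level $0$, edges going from a level to the next; each node queries at most one input word, out-edges being labeled by its possible contents; an edge may emit output items (position, word). The run on $x$ follows from the root the edges consistent with $x$; the program computes $f$ if it emits exactly $f(x)$. Coins of a randomized program are part of the input. The width of a level is its number of nodes; the length of a node is the total length of the two strings encoding it (empty nodes have length $0$). Substrate. Storage consists of one-bit cells, enumerated within each level in a fixed order, which groups them into fixed aligned words of $w$ consecutive cells and may leave cells outside every word (such a cell never holds an input bit; whenever live it is computed). Working levels $0,\dots,L$ have capacities $S_\ell$ (bits) and access latencies $\tau_0\le\dots\le\tau_L$. Level $L+1$ is the environment, of unbounded capacity, with a read-only input region holding the input and a write-only output region. Boundary $\ell$ lies between levels $\ell$ and $\ell+1$ (a graph of boundaries between levels is also allowed, the environment adjacent to one designated working level). A bit crosses boundary $L$ downward only from the input region and only as part of its whole input word, which lands in one word of level $L$ (input words may be re-read at random access); upward only from computed cells into the output region, the $w$ cells of one computed aligned word crossing within one round into one word of the output region, which is written once. Operations fire at stations, each at a working level; a fire reads at most two words resident at its level and writes bits at that level as a function of what it reads. Executions. A bit is live if held at a working level; the state consists of the live cells with levels and contents, the environment's contents, and the time. A step is: a hold (time advances by $d>0$; a level may carry its contents along a conveyor, a fixed permutation of its words, independent of input and state, carrying each aligned word whole with the order of its cells preserved, applied once per unit of time, holds on such a level lasting a whole number of units; nothing is read, written, created or destroyed); a move (one bit is copied across one boundary into a free cell at the far level, within capacity; the source keeps its contents); or a fire (one operation at one station; it may also free live bits). A round is a maximal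 sequence of moves and fires between two holds and takes no time. An execution is a finite sequence of states related by steps; it may end without a final hold. The action at level $\ell$ is $\mathsf{A}_\ell=\sum_{\text{holds}}\mathrm{live}_\ell\cdot d$, with $\mathrm{live}_\ell$ the number of bits live at level $\ell$. An execution is synchronous with cycle $\Delta$ and width $q$ if every hold lasts at least $\Delta$ and every round contains at most $q$ fires. Latency (assumed). A station fires at most once in any interval shorter than $\tau_0$, and a fire reading a bit written or moved into the station's level at time $s$ (bits resident from the start count as moved in at time $0$) occurs at time $\ge s+\tau_0$. Machines. A live cell is raw if it holds an input bit not yet overwritten by a fire, otherwise computed. Raw words are units: an input word enters a working level whole, and its cells are moved between working levels (into one aligned word), overwritten, and freed together, within one round; a fire overwriting a cell of a raw word overwrites all of it, and its cells are then computed; a fire that reads a raw word leaves it raw. The initial computed contents (the program) do not depend on the input. (i) The next step (which operation fires where, which words it reads, where moves go, whether the round or execution ends, the duration of the next hold, whether each conveyor runs) is a function of the assignment of contents to the computed cells; and this assignment is self-describing: two computed assignments reachable in the machine's executions, on any inputs, whose contents agree when read in the fixed order of cells (the computed string) are the same assignment. Raw cells, physical time, and counts of steps are not arguments. (ii) Throughout every hold, the set of live cells with their levels, and the assignment of input words to raw words, are a function of the computed string. On each input $x$ the machine $M$ produces one execution $M(x)$; it computes $f$ if for every $x$ the final output region holds $f(x)$. A randomized machine reads its random bits from a region of the input, once (coin words moved to a working level are raw words like any other), and computes $f$ with the probability, over those bits, that it does so.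
   Formalization: Last bound: the sum runs over querying rounds r, using the live set at the hold before the r-th querying round of M(x); the bound over holds t is shown only if that hold's index is the same for all x. Also τ_0 > 0 is assumed, and raw words keep their bit order when moved. *)

theory Defs
  imports "HOL-Probability.Probability"
begin

section \<open>Substrate\<close>

text \<open>
  A cell is a pair (level, position in the fixed enumeration of that level).  An aligned word of
  level l is named by the position of its first cell, an element of \<open>wstarts S l\<close>.
  The working levels are \<open>0..maxlev S\<close>; the environment is not given a number.  Boundaries form an
  arbitrary graph on the working levels, and the environment is adjacent to the level
  \<open>port S\<close>; the linear hierarchy is the case \<open>boundary S l m \<longleftrightarrow> m = l + 1\<close>, \<open>port S = maxlev S\<close>.
\<close>

type_synonym cell = "nat \<times> nat"

record substrate =
  wlen :: nat
  maxlev :: nat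
  capacity :: "nat \<Rightarrow> nat"
  latency :: "nat \<Rightarrow> real"
  ncells :: "nat \<Rightarrow> nat"
  wstarts :: "nat \<Rightarrow> nat set"
  conveyor :: "nat \<Rightarrow> (nat \<Rightarrow> nat) option"
  boundary :: "nat \<Rightarrow> nat \<Rightarrow> bool"
  port :: nat
  stations :: "nat set"
  station_level :: "nat \<Rightarrow> nat"

definition valid_cells :: "substrate \<Rightarrow> cell set" where
  "valid_cells S = {(l, k). l \<le> maxlev S \<and> k < ncells S l}"

definition adjacent :: "substrate \<Rightarrow> nat \<Rightarrow> nat \<Rightarrow> bool" where
  "adjacent S l m \<longleftrightarrow> boundary S l m \<or> boundary S m l"

definition substrate_ok :: "substrate \<Rightarrow> bool" where
  "substrate_ok S \<longleftrightarrow>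
     0 < wlen S \<and> port S \<le> maxlev S \<and>
     0 < latency S 0 \<and>
     (\<forall>l m. l \<le> m \<and> m \<le> maxlev S \<longrightarrow> latency S l \<le> latency S m) \<and>
     (\<forall>l\<le>maxlev S. \<forall>s\<in>wstarts S l. s + wlen S \<le> ncells S l) \<and>
     (\<forall>l\<le>maxlev S. \<forall>s\<in>wstarts S l. \<forall>s'\<in>wstarts S l.
        s = s' \<or> s + wlen S \<le> s' \<or> s' + wlen S \<le> s) \<and>
     (\<forall>l\<le>maxlev S. \<forall>p. conveyor S l = Some p \<longrightarrow> bij_betw p (wstarts S l) (wstarts S l)) \<and>
     (\<forall>l m. boundary S l m \<longrightarrow> l \<le> maxlev S \<and> m \<le> maxlev S \<and> l \<noteq> m) \<and>
     (\<forall>st\<in>stations S. station_level S st \<le> maxlev S)"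


section \<open>States and steps\<close>

text \<open>
  \<open>Raw i b\<close> is bit b of input word i, brought in and not yet overwritten by a fire: its value is
  looked up in the input, so that states carry no input data in raw cells.  The fields \<open>since\<close>
  (time at which the present content of a cell was written or moved in) and \<open>fired\<close> (time of the
  latest fire of a station) only record history for the latency conditions.
\<close>

datatype content = Raw nat nat | Comp bool

type_synonym input = "bool list list"

record state =
  held :: "cell \<Rightarrow> content option"
  since :: "cell \<Rightarrow> real"
  outcells :: "nat \<times> nat \<Rightarrow> bool option"
  now :: real
  fired :: "nat \<Rightarrow> real option"

definition live :: "state \<Rightarrow> cell set" where
  "live \<sigma> = dom (held \<sigma>)"

definition live_at :: "state \<Rightarrow> nat \<Rightarrow> nat" where
  "live_at \<sigma> l = card {k. (l, k) \<in> live \<sigma>}"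

definition computed :: "state \<Rightarrow> cell \<Rightarrow> bool option" where
  "computed \<sigma> c = (case held \<sigma> c of Some (Comp v) \<Rightarrow> Some v | _ \<Rightarrow> None)"

definition raw_source :: "state \<Rightarrow> cell \<Rightarrow> nat option" where
  "raw_source \<sigma> c = (case held \<sigma> c of Some (Raw i b) \<Rightarrow> Some i | _ \<Rightarrow> None)"

text \<open>The contents of the computed cells, level by level, each level in the order of its cells.\<close>

definition comp_string :: "substrate \<Rightarrow> state \<Rightarrow> bool list" where
  "comp_string S \<sigma> =
     concat (map (\<lambda>l. List.map_filter (\<lambda>k. computed \<sigma> (l, k)) [0..<ncells S l]) [0..<Suc (maxlev S)])"

definition raw_word :: "substrate \<Rightarrow> state \<Rightarrow> nat \<Rightarrow> nat \<Rightarrow> bool" where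
  "raw_word S \<sigma> l s \<longleftrightarrow> (\<exists>i. \<forall>b<wlen S. held \<sigma> (l, s + b) = Some (Raw i b))"

definition comp_word :: "substrate \<Rightarrow> state \<Rightarrow> nat \<Rightarrow> nat \<Rightarrow> bool" where
  "comp_word S \<sigma> l s \<longleftrightarrow> (\<forall>b<wlen S. \<exists>v. held \<sigma> (l, s + b) = Some (Comp v))"

definition cell_value :: "input \<Rightarrow> state \<Rightarrow> cell \<Rightarrow> bool" where
  "cell_value x \<sigma> c = (case the (held \<sigma> c) of Raw i b \<Rightarrow> x ! i ! b | Comp v \<Rightarrow> v)"

definition word_value :: "substrate \<Rightarrow> input \<Rightarrow> state \<Rightarrow> nat \<Rightarrow> nat \<Rightarrow> bool list" where
  "word_value S x \<sigma> l s = map (\<lambda>b. cell_value x \<sigma> (l, s + b)) [0..<wlen S]"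

text \<open>
  Each constructor moves a single bit.  \<open>Load i b s\<close> brings bit b of input word i into the word s
  of the port level; \<open>Store s b p\<close> sends bit b of the computed word s of the port level
  to bit b of output word p; \<open>Move_raw l s b m t\<close> copies bit b of the raw word s of level l
  to bit b of the word t of level m; \<open>Move_comp\<close> copies a computed cell.
\<close>

datatype move =
    Load nat nat nat
  | Store nat nat nat
  | Move_raw nat nat nat nat nat
  | Move_comp cell cell

text \<open>
  An operation reads the words listed in \<open>reads\<close> at the level of its station; the cells of that
  level that it writes, the values written, and the cells that it frees depend on what it reads.
\<close>

record fire =
  station :: nat
  reads :: "nat list"
  writes :: "bool list list \<Rightarrow> nat \<Rightarrow> bool option"
  frees :: "bool list list \<Rightarrow> cell set"

datatype step = Move move | Fire fire | Hold real "nat set"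

fun exec_move :: "substrate \<Rightarrow> move \<Rightarrow> state \<Rightarrow> state" where
  "exec_move S (Load i b s) \<sigma> =
     \<sigma>\<lparr>held := (held \<sigma>)((port S, s + b) \<mapsto> Raw i b),
       since := (since \<sigma>)((port S, s + b) := now \<sigma>)\<rparr>"
| "exec_move S (Store s b p) \<sigma> =
     \<sigma>\<lparr>outcells := (outcells \<sigma>)((p, b) := computed \<sigma> (port S, s + b))\<rparr>"
| "exec_move S (Move_raw l s b m t) \<sigma> =
     \<sigma>\<lparr>held := (held \<sigma>)((m, t + b) := held \<sigma> (l, s + b)),
       since := (since \<sigma>)((m, t + b) := now \<sigma>)\<rparr>"
| "exec_move S (Move_comp c d) \<sigma> =
     \<sigma>\<lparr>held := (held \<sigma>)(d := held \<sigma> c), since := (since \<sigma>)(d := now \<sigma>)\<rparr>"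

definition free_for_move :: "substrate \<Rightarrow> state \<Rightarrow> cell \<Rightarrow> bool" where
  "free_for_move S \<sigma> c \<longleftrightarrow>
     c \<in> valid_cells S \<and> c \<notin> live \<sigma> \<and> live_at \<sigma> (fst c) < capacity S (fst c)"

fun move_ok :: "substrate \<Rightarrow> nat \<Rightarrow> move \<Rightarrow> state \<Rightarrow> bool" where
  "move_ok S n (Load i b s) \<sigma> \<longleftrightarrow>
     i < n \<and> b < wlen S \<and> s \<in> wstarts S (port S) \<and> free_for_move S \<sigma> (port S, s + b)"
| "move_ok S n (Store s b p) \<sigma> \<longleftrightarrow>
     b < wlen S \<and> s \<in> wstarts S (port S) \<and> comp_word S \<sigma> (port S) s \<and> outcells \<sigma> (p, b) = None"
| "move_ok S n (Move_raw l s b m t) \<sigma> \<longleftrightarrow>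
     adjacent S l m \<and> b < wlen S \<and> s \<in> wstarts S l \<and> t \<in> wstarts S m \<and>
     (\<exists>i. held \<sigma> (l, s + b) = Some (Raw i b)) \<and> free_for_move S \<sigma> (m, t + b)"
| "move_ok S n (Move_comp c d) \<sigma> \<longleftrightarrow>
     adjacent S (fst c) (fst d) \<and> computed \<sigma> c \<noteq> None \<and> free_for_move S \<sigma> d"

definition fire_level :: "substrate \<Rightarrow> fire \<Rightarrow> nat" where
  "fire_level S g = station_level S (station g)"

definition fire_arg :: "substrate \<Rightarrow> input \<Rightarrow> fire \<Rightarrow> state \<Rightarrow> bool list list" where
  "fire_arg S x g \<sigma> = map (word_value S x \<sigma> (fire_level S g)) (reads g)"

definition fire_writes :: "substrate \<Rightarrow> input \<Rightarrow> fire \<Rightarrow> state \<Rightarrow> cell \<Rightarrow> bool option" where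
  "fire_writes S x g \<sigma> c =
     (if fst c = fire_level S g then writes g (fire_arg S x g \<sigma>) (snd c) else None)"

definition fire_frees :: "substrate \<Rightarrow> input \<Rightarrow> fire \<Rightarrow> state \<Rightarrow> cell set" where
  "fire_frees S x g \<sigma> = frees g (fire_arg S x g \<sigma>)"

definition exec_fire :: "substrate \<Rightarrow> input \<Rightarrow> fire \<Rightarrow> state \<Rightarrow> state" where
  "exec_fire S x g \<sigma> =
     \<sigma>\<lparr>held := (\<lambda>c. case fire_writes S x g \<sigma> c of
                      Some v \<Rightarrow> Some (Comp v)
                    | None \<Rightarrow> if c \<in> fire_frees S x g \<sigma> then None else held \<sigma> c),
       since := (\<lambda>c. if fire_writes S x g \<sigma> c \<noteq> None then now \<sigma> else since \<sigma> c),
       fired := (fired \<sigma>)(station g \<mapsto> now \<sigma>)\<rparr>"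

definition fire_ok :: "substrate \<Rightarrow> input \<Rightarrow> fire \<Rightarrow> state \<Rightarrow> bool" where
  "fire_ok S x g \<sigma> \<longleftrightarrow>
     station g \<in> stations S \<and>
     (\<forall>u. fired \<sigma> (station g) = Some u \<longrightarrow> u + latency S 0 \<le> now \<sigma>) \<and>
     length (reads g) \<le> 2 \<and>
     (\<forall>s\<in>set (reads g). s \<in> wstarts S (fire_level S g) \<and>
        (\<forall>b<wlen S. (fire_level S g, s + b) \<in> live \<sigma> \<and>
                    since \<sigma> (fire_level S g, s + b) + latency S 0 \<le> now \<sigma>)) \<and>
     dom (fire_writes S x g \<sigma>) \<subseteq> valid_cells S \<and>
     fire_frees S x g \<sigma> \<subseteq> live \<sigma> - dom (fire_writes S x g \<sigma>) \<and>
     (\<forall>l s b. s \<in> wstarts S l \<and> b < wlen S \<and> raw_source \<sigma> (l, s + b) \<noteq> None \<and>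
        (l, s + b) \<in> dom (fire_writes S x g \<sigma>) \<longrightarrow>
        (\<forall>b'<wlen S. (l, s + b') \<in> dom (fire_writes S x g \<sigma>))) \<and>
     (\<forall>l\<le>maxlev S. live_at (exec_fire S x g \<sigma>) l \<le> capacity S l)"

text \<open>
  The permutation p of a conveyor is given by sources: after one unit of time the word s holds
  what the word p s held before.  Cells outside every word stay where they are.
\<close>

definition carried_from :: "substrate \<Rightarrow> nat \<Rightarrow> nat \<Rightarrow> nat" where
  "carried_from S l k = (case conveyor S l of None \<Rightarrow> k | Some p \<Rightarrow>
     (if \<exists>s\<in>wstarts S l. s \<le> k \<and> k < s + wlen S
      then (let s = (THE s. s \<in> wstarts S l \<and> s \<le> k \<and> k < s + wlen S) in p s + (k - s))
      else k))"

definition convey :: "substrate \<Rightarrow> nat set \<Rightarrow> state \<Rightarrow> state" where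
  "convey S R \<sigma> =
     (let g = (\<lambda>(l, k). if l \<in> R then (l, carried_from S l k) else (l, k))
      in \<sigma>\<lparr>held := held \<sigma> \<circ> g, since := since \<sigma> \<circ> g\<rparr>)"

text \<open>\<open>Hold d R\<close>: time advances by d while exactly the conveyors of the levels in R run.\<close>

definition exec_hold :: "substrate \<Rightarrow> real \<Rightarrow> nat set \<Rightarrow> state \<Rightarrow> state" where
  "exec_hold S d R \<sigma> = ((convey S R ^^ nat \<lfloor>d\<rfloor>) \<sigma>)\<lparr>now := now \<sigma> + d\<rparr>"

definition during_hold :: "substrate \<Rightarrow> real \<Rightarrow> nat set \<Rightarrow> state \<Rightarrow> state set" where
  "during_hold S d R \<sigma> = {(convey S R ^^ u) \<sigma> | u. u \<le> nat \<lfloor>d\<rfloor>}"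

definition hold_ok :: "substrate \<Rightarrow> real \<Rightarrow> nat set \<Rightarrow> bool" where
  "hold_ok S d R \<longleftrightarrow>
     0 < d \<and> (\<forall>l\<in>R. l \<le> maxlev S \<and> conveyor S l \<noteq> None) \<and> (R \<noteq> {} \<longrightarrow> d \<in> \<nat>)"

fun exec :: "substrate \<Rightarrow> input \<Rightarrow> step \<Rightarrow> state \<Rightarrow> state" where
  "exec S x (Move a) \<sigma> = exec_move S a \<sigma>"
| "exec S x (Fire g) \<sigma> = exec_fire S x g \<sigma>"
| "exec S x (Hold d R) \<sigma> = exec_hold S d R \<sigma>"

fun step_ok :: "substrate \<Rightarrow> nat \<Rightarrow> input \<Rightarrow> state \<times> step \<Rightarrow> bool" where
  "step_ok S n x (\<sigma>, Move a) \<longleftrightarrow> move_ok S n a \<sigma>"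
| "step_ok S n x (\<sigma>, Fire g) \<longleftrightarrow> fire_ok S x g \<sigma>"
| "step_ok S n x (\<sigma>, Hold d R) \<longleftrightarrow> hold_ok S d R"


section \<open>Executions as lists of steps, each paired with the state before it\<close>

type_synonym events = "(state \<times> step) list"

fun run_steps :: "substrate \<Rightarrow> input \<Rightarrow> state \<Rightarrow> step list \<Rightarrow> events" where
  "run_steps S x \<sigma> [] = []"
| "run_steps S x \<sigma> (a # as) = (\<sigma>, a) # run_steps S x (exec S x a \<sigma>) as"

fun is_hold :: "step \<Rightarrow> bool" where
  "is_hold (Hold d R) = True"
| "is_hold _ = False"

fun is_fire :: "step \<Rightarrow> bool" where
  "is_fire (Fire g) = True"
| "is_fire _ = False"

text \<open>Round 0 precedes the first hold, and hold t (from 0) is directly followed by round t + 1.\<close>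

fun rounds :: "events \<Rightarrow> events list" where
  "rounds [] = [[]]"
| "rounds (e # es) =
     (if is_hold (snd e) then [] # rounds es else (e # hd (rounds es)) # tl (rounds es))"

fun hold_of :: "state \<times> step \<Rightarrow> (state \<times> real \<times> nat set) option" where
  "hold_of (\<sigma>, Hold d R) = Some (\<sigma>, d, R)"
| "hold_of _ = None"

definition holds :: "events \<Rightarrow> (state \<times> real \<times> nat set) list" where
  "holds es = List.map_filter hold_of es"

definition whole_raw_words :: "substrate \<Rightarrow> state \<Rightarrow> bool" where
  "whole_raw_words S \<sigma> \<longleftrightarrow>
     (\<forall>l k. raw_source \<sigma> (l, k) \<noteq> None \<longrightarrow>
        (\<exists>s\<in>wstarts S l. s \<le> k \<and> k < s + wlen S \<and> raw_word S \<sigma> l s))"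

text \<open>The bits of a word crossing the port boundary, or of a raw word moved, all do so in one round.\<close>

definition whole_moves :: "substrate \<Rightarrow> events \<Rightarrow> bool" where
  "whole_moves S es \<longleftrightarrow> (let A = snd ` set es in
     (\<forall>i b s. Move (Load i b s) \<in> A \<longrightarrow> (\<forall>b'<wlen S. Move (Load i b' s) \<in> A)) \<and>
     (\<forall>s b p. Move (Store s b p) \<in> A \<longrightarrow> (\<forall>b'<wlen S. Move (Store s b' p) \<in> A)) \<and>
     (\<forall>l s b m t. Move (Move_raw l s b m t) \<in> A \<longrightarrow>
        (\<forall>b'<wlen S. Move (Move_raw l s b' m t) \<in> A)))"


section \<open>Machines\<close>

text \<open>
  The control is a function of the assignment of contents to the computed cells and of nothing
  else.  Bringing in or moving raw bits and holding leave this assignment unchanged, so a control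
  consulted once per single bit move or hold would repeat itself forever.  One
  consultation therefore determines a batch: some bit moves, at most one fire, and what comes
  next (the round goes on, it ends with a hold of given duration and running conveyors, or
  the execution ends).
\<close>

datatype ending = Go_on | Rest real "nat set" | Halt

record decision =
  moves :: "move list"
  firing :: "fire option"
  ending :: ending

record machine =
  sub :: substrate
  nwords :: nat
  coins :: "nat set"
  program :: "cell \<Rightarrow> bool option"
  control :: "(cell \<Rightarrow> bool option) \<Rightarrow> decision"

definition inputs :: "machine \<Rightarrow> input set" where
  "inputs M = {x. length x = nwords M \<and> (\<forall>v\<in>set x. length v = wlen (sub M))}"

definition initial :: "machine \<Rightarrow> state" where
  "initial M = \<lparr>held = map_option Comp \<circ> program M, since = (\<lambda>_. 0), outcells = Map.empty,
                now = 0, fired = Map.empty\<rparr>"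

definition decide :: "machine \<Rightarrow> state \<Rightarrow> decision" where
  "decide M \<sigma> = control M (computed \<sigma>)"

definition decision_steps :: "decision \<Rightarrow> step list" where
  "decision_steps c =
     map Move (moves c) @
     (case firing c of None \<Rightarrow> [] | Some g \<Rightarrow> [Fire g]) @
     (case ending c of Rest d R \<Rightarrow> [Hold d R] | _ \<Rightarrow> [])"

primrec config :: "machine \<Rightarrow> input \<Rightarrow> nat \<Rightarrow> state" where
  "config M x 0 = initial M"
| "config M x (Suc n) =
     fold (exec (sub M) x) (decision_steps (decide M (config M x n))) (config M x n)"

definition halts :: "machine \<Rightarrow> input \<Rightarrow> bool" where
  "halts M x \<longleftrightarrow> (\<exists>n. ending (decide M (config M x n)) = Halt)"

definition halt_time :: "machine \<Rightarrow> input \<Rightarrow> nat" where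
  "halt_time M x = (LEAST n. ending (decide M (config M x n)) = Halt)"

definition final :: "machine \<Rightarrow> input \<Rightarrow> state" where
  "final M x = config M x (Suc (halt_time M x))"

definition trace :: "machine \<Rightarrow> input \<Rightarrow> events" where
  "trace M x = concat (map (\<lambda>n. run_steps (sub M) x (config M x n)
                                   (decision_steps (decide M (config M x n))))
                           [0..<Suc (halt_time M x)])"

definition mround :: "machine \<Rightarrow> input \<Rightarrow> nat \<Rightarrow> events" where
  "mround M x t = rounds (trace M x) ! t"

definition mholds :: "machine \<Rightarrow> input \<Rightarrow> (state \<times> real \<times> nat set) list" where
  "mholds M x = holds (trace M x)"

definition hold_states :: "machine \<Rightarrow> input \<Rightarrow> state set" where
  "hold_states M x = (\<Union>(\<sigma>, d, R)\<in>set (mholds M x). during_hold (sub M) d R \<sigma>)"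

definition reached :: "machine \<Rightarrow> input \<Rightarrow> state set" where
  "reached M x = fst ` set (trace M x) \<union> hold_states M x \<union> {final M x}"

definition machine_output :: "machine \<Rightarrow> input \<Rightarrow> nat \<Rightarrow> bool list option" where
  "machine_output M x p =
     (if \<forall>b<wlen (sub M). outcells (final M x) (p, b) \<noteq> None
      then Some (map (\<lambda>b. the (outcells (final M x) (p, b))) [0..<wlen (sub M)]) else None)"

definition execution_ok :: "machine \<Rightarrow> input \<Rightarrow> bool" where
  "execution_ok M x \<longleftrightarrow>
     halts M x \<and>
     (\<forall>e\<in>set (trace M x). step_ok (sub M) (nwords M) x e) \<and>
     (\<forall>es\<in>set (rounds (trace M x)). whole_moves (sub M) es) \<and>
     (\<forall>(\<sigma>, d, R)\<in>set (mholds M x). whole_raw_words (sub M) \<sigma>) \<and>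
     whole_raw_words (sub M) (final M x) \<and>
     (\<forall>i\<in>coins M. \<forall>b. length (filter (\<lambda>e. \<exists>s. snd e = Move (Load i b s)) (trace M x)) \<le> 1)"

definition self_describing :: "machine \<Rightarrow> bool" where
  "self_describing M \<longleftrightarrow>
     (\<forall>x\<in>inputs M. \<forall>y\<in>inputs M. \<forall>\<sigma>\<in>reached M x. \<forall>\<rho>\<in>reached M y.
        comp_string (sub M) \<sigma> = comp_string (sub M) \<rho> \<longrightarrow> computed \<sigma> = computed \<rho>)"

definition layout_determined :: "machine \<Rightarrow> bool" where
  "layout_determined M \<longleftrightarrow>
     (\<exists>layout. \<forall>x\<in>inputs M. \<forall>\<sigma>\<in>hold_states M x.
        (live \<sigma>, raw_source \<sigma>) = layout (comp_string (sub M) \<sigma>))"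

definition machine_ok :: "machine \<Rightarrow> bool" where
  "machine_ok M \<longleftrightarrow>
     substrate_ok (sub M) \<and> coins M \<subseteq> {..<nwords M} \<and>
     dom (program M) \<subseteq> valid_cells (sub M) \<and>
     (\<forall>l\<le>maxlev (sub M). live_at (initial M) l \<le> capacity (sub M) l) \<and>
     (\<forall>x\<in>inputs M. execution_ok M x) \<and>
     self_describing M \<and> layout_determined M"

definition synchronous :: "machine \<Rightarrow> real \<Rightarrow> nat \<Rightarrow> bool" where
  "synchronous M \<Delta> q \<longleftrightarrow>
     (\<forall>x\<in>inputs M.
        (\<forall>(\<sigma>, d, R)\<in>set (mholds M x). \<Delta> \<le> d) \<and>
        (\<forall>es\<in>set (rounds (trace M x)). length (filter (is_fire \<circ> snd) es) \<le> q))"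

text \<open>The proper input is what is left of an input after removing the coin words.\<close>

definition proper :: "machine \<Rightarrow> input \<Rightarrow> input" where
  "proper M x = nths x (- coins M)"

definition coin_space :: "machine \<Rightarrow> input \<Rightarrow> input pmf" where
  "coin_space M z = pmf_of_set {x \<in> inputs M. proper M x = z}"

definition machine_success ::
    "machine \<Rightarrow> (input \<Rightarrow> nat \<Rightarrow> bool list option) \<Rightarrow> input \<Rightarrow> real" where
  "machine_success M f z = measure_pmf.prob (coin_space M z) {x. machine_output M x = f z}"

definition machine_computes :: "machine \<Rightarrow> (input \<Rightarrow> nat \<Rightarrow> bool list option) \<Rightarrow> bool" where
  "machine_computes M f \<longleftrightarrow> (\<forall>x\<in>inputs M. machine_output M x = f x)"


section \<open>Action, live sets, querying rounds\<close>

definition live_count :: "machine \<Rightarrow> nat \<Rightarrow> input \<Rightarrow> nat" where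
  "live_count M t x =
     (if t < length (mholds M x) then card (live (fst (mholds M x ! t))) else 0)"

definition action_at :: "machine \<Rightarrow> input \<Rightarrow> nat \<Rightarrow> real" where
  "action_at M x l = (\<Sum>(\<sigma>, d, R)\<leftarrow>mholds M x. real (live_at \<sigma> l) * d)"

definition action :: "machine \<Rightarrow> input \<Rightarrow> real" where
  "action M x = (\<Sum>l\<le>maxlev (sub M). action_at M x l)"

text \<open>The raw words read by a step, as pairs of their place and their contents.\<close>

fun raw_reads :: "substrate \<Rightarrow> input \<Rightarrow> state \<times> step \<Rightarrow> ((nat \<times> nat) \<times> bool list) list" where
  "raw_reads S x (\<sigma>, Fire g) =
     (let l = fire_level S g in
      map (\<lambda>s. ((l, s), word_value S x \<sigma> l s)) (filter (raw_word S \<sigma> l) (reads g)))"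
| "raw_reads S x _ = []"

definition querying :: "substrate \<Rightarrow> input \<Rightarrow> events \<Rightarrow> bool" where
  "querying S x es \<longleftrightarrow> (\<exists>e\<in>set es. raw_reads S x e \<noteq> [])"

definition query_rounds :: "machine \<Rightarrow> input \<Rightarrow> nat list" where
  "query_rounds M x =
     filter (\<lambda>t. querying (sub M) x (mround M x t)) [0..<length (rounds (trace M x))]"

definition query_count :: "machine \<Rightarrow> input \<Rightarrow> nat" where
  "query_count M x = length (query_rounds M x)"

definition keep_first :: "'a list \<Rightarrow> 'a list" where
  "keep_first xs = rev (remdups (rev xs))"

definition answers :: "substrate \<Rightarrow> input \<Rightarrow> events \<Rightarrow> bool list list" where
  "answers S x es = map snd (keep_first (concat (map (raw_reads S x) es)))"

text \<open>The index of the hold before the querying round number r (from 0).\<close>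

definition query_hold :: "machine \<Rightarrow> nat \<Rightarrow> input \<Rightarrow> nat" where
  "query_hold M r x = query_rounds M x ! r - 1"

definition query_live :: "machine \<Rightarrow> nat \<Rightarrow> input \<Rightarrow> nat" where
  "query_live M r x = (if r < query_count M x then live_count M (query_hold M r x) x else 0)"


section \<open>Leveled branching programs\<close>

text \<open>
  Levels are \<open>0..depth P\<close>.  A node that queries word i has one out-edge for each content c of the
  word, labeled \<open>Some c\<close>; a node that queries nothing has one out-edge, labeled \<open>None\<close>.
  Edges may be parallel.
\<close>

record 'v bp =
  depth :: nat
  nodes :: "nat \<Rightarrow> 'v set"
  source :: 'v
  query :: "nat \<Rightarrow> 'v \<Rightarrow> nat option"
  target :: "nat \<Rightarrow> 'v \<Rightarrow> bool list option \<Rightarrow> 'v"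
  emit :: "nat \<Rightarrow> 'v \<Rightarrow> bool list option \<Rightarrow> (nat \<times> bool list) list"

definition labels :: "nat \<Rightarrow> 'v bp \<Rightarrow> nat \<Rightarrow> 'v \<Rightarrow> bool list option set" where
  "labels w P i v = (if query P i v = None then {None} else Some ` {c. length c = w})"

definition leveled_bp :: "nat \<Rightarrow> nat \<Rightarrow> 'v bp \<Rightarrow> bool" where
  "leveled_bp n w P \<longleftrightarrow>
     nodes P 0 = {source P} \<and>
     (\<forall>i\<le>depth P. finite (nodes P i) \<and> nodes P i \<noteq> {}) \<and>
     (\<forall>i<depth P. \<forall>v\<in>nodes P i.
        (\<forall>j. query P i v = Some j \<longrightarrow> j < n) \<and>
        (\<forall>c\<in>labels w P i v. target P i v c \<in> nodes P (Suc i)))"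

definition label :: "'v bp \<Rightarrow> input \<Rightarrow> nat \<Rightarrow> 'v \<Rightarrow> bool list option" where
  "label P x i v = map_option (\<lambda>j. x ! j) (query P i v)"

primrec visit :: "'v bp \<Rightarrow> input \<Rightarrow> nat \<Rightarrow> 'v" where
  "visit P x 0 = source P"
| "visit P x (Suc i) = target P i (visit P x i) (label P x i (visit P x i))"

definition emitted_at :: "'v bp \<Rightarrow> input \<Rightarrow> nat \<Rightarrow> (nat \<times> bool list) list" where
  "emitted_at P x i = emit P i (visit P x i) (label P x i (visit P x i))"

definition emitted :: "'v bp \<Rightarrow> input \<Rightarrow> (nat \<times> bool list) list" where
  "emitted P x = concat (map (emitted_at P x) [0..<depth P])"

definition emits_exactly :: "'v bp \<Rightarrow> input \<Rightarrow> (nat \<Rightarrow> bool list option) \<Rightarrow> bool" where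
  "emits_exactly P x y \<longleftrightarrow> distinct (emitted P x) \<and> set (emitted P x) = Map.graph y"

definition bp_computes :: "machine \<Rightarrow> 'v bp \<Rightarrow> (input \<Rightarrow> nat \<Rightarrow> bool list option) \<Rightarrow> bool" where
  "bp_computes M P f \<longleftrightarrow> (\<forall>x\<in>inputs M. emits_exactly P x (f x))"

definition bp_success ::
    "machine \<Rightarrow> 'v bp \<Rightarrow> (input \<Rightarrow> nat \<Rightarrow> bool list option) \<Rightarrow> input \<Rightarrow> real" where
  "bp_success M P f z = measure_pmf.prob (coin_space M z) {x. emits_exactly P x (f z)}"

definition cumulative_memory :: "'v bp \<Rightarrow> real" where
  "cumulative_memory P = (\<Sum>i\<le>depth P. log 2 (real (card (nodes P i))))"


section \<open>Nodes encoded by pairs of strings\<close>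

text \<open>
  Nodes are identified with their codes, so distinct nodes have distinct codes; \<open>None\<close> is the
  designated empty node, which is thereby distinguished from the pair of empty strings.  A sequence
  of answers is encoded by its concatenation, all answers having the same length.
\<close>

type_synonym code = "(bool list \<times> bool list) option"

fun code_length :: "code \<Rightarrow> nat" where
  "code_length None = 0"
| "code_length (Some (s, a)) = length s + length a"

text \<open>The code in the querying round number r (from 0), after the first j answers.\<close>

definition round_code :: "machine \<Rightarrow> input \<Rightarrow> nat \<Rightarrow> nat \<Rightarrow> code" where
  "round_code M x r j =
     (let es = mround M x (query_rounds M x ! r)
      in Some (comp_string (sub M) (fst (hd es)), concat (take j (answers (sub M) x es))))"

text \<open>
  Level 0 carries the root alone; levels \<open>2 * q * r + 1\<close> to \<open>2 * q * (r + 1)\<close> carry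
  the r-th querying rounds of the executions, the node j levels into such a block having seen the
  first j answers of its round (or all of them, if there are fewer).
\<close>

definition encodes :: "machine \<Rightarrow> nat \<Rightarrow> code bp \<Rightarrow> bool" where
  "encodes M q P \<longleftrightarrow>
     source P = Some ([], []) \<and>
     (\<forall>i\<in>{1..depth P}. None \<in> nodes P i) \<and>
     (\<forall>i<depth P. \<forall>c. None \<in> nodes P i \<longrightarrow> emit P i None c = []) \<and>
     (\<forall>i\<in>{1..depth P}. \<forall>v\<in>nodes P i. v \<noteq> None \<longrightarrow> (\<exists>x\<in>inputs M. visit P x i = v)) \<and>
     (\<forall>x\<in>inputs M. 2 * q * query_count M x \<le> depth P) \<and>
     (\<forall>x\<in>inputs M. \<forall>i\<in>{1..2 * q * query_count M x}.
        visit P x i = round_code M x ((i - 1) div (2 * q)) ((i - 1) mod (2 * q)))"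

text \<open>
  There are at most \<open>(m + 2) * 2 ^ (m + 1)\<close> codes of length at most m; \<open>live_cost m\<close> bounds the
  logarithm of this number.
\<close>

definition live_cost :: "nat \<Rightarrow> real" where
  "live_cost m = real m + real_of_int \<lceil>log 2 (real m + 2)\<rceil> + 1"

end

theory Submission
  imports Defs
begin

text \<open>
  Between two holds no time passes, so by the latency condition a fire only reads words that were
  already in place, unchanged, when its round started. Hence from the computed string at the start
  of a round, which determines the computed cells and the places of the input words, everything
  that happens is a function of the contents of the raw words read; the next word read is a
  function of the contents of those read before. A round without such reads is a function
  of the computed string alone, and can be skipped.

  Nothing has to be simulated: for every level one chooses the code that each input is to have
  there, and it suffices that two inputs with the same code ask the same question and, given the
  same answer, have the same code one level further. All that is output from the start of one
  querying round until the next is emitted on the last edge of the block of the former, where all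
  answers are known.
\<close>

section \<open>Adaptive readings\<close>

text \<open>Codes carry no round number: two inputs may reach the same node after different numbers
  of rounds and at different times. All comparisons are therefore between a round t of x and a round
  t' of y, and they concern only computed cells and the places of raw words. These places are not
  followed through the moves of a round; after the next hold they are read off the computed string
  again. This works only after a hold, which is enough: the initial state has no raw word, so round
  0 never queries. The constant 2q counts words: each of at most q fires reads at most two. Rounds
  that ask fewer words are padded by nodes without query, so the r-th querying rounds of all inputs
  share the same levels. A code fits into the live set because the computed string takes one bit per
  computed cell and the distinct words asked lie in disjoint sets of live raw cells. The r-th
  querying round may follow different holds on different inputs, so memory is first bounded by a sum
  over r; the sum over holds presupposes that these holds coincide.\<close>

lemma concat_eq_if_lengths:
  assumes "concat xs = concat ys" "0 < w" "\<forall>v\<in>set xs. length v = w" "\<forall>v\<in>set ys. length v = w"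
  shows "xs = ys"
  using assms
proof (induction xs arbitrary: ys)
  case Nil
  then show ?case by (cases ys) auto
next
  case (Cons v xs)
  then obtain u us where "ys = u # us" by (cases ys) auto
  with Cons show ?case by auto
qed

lemma remdups_append_filter:
  "remdups (xs @ ys) = filter (\<lambda>x. x \<notin> set ys) (remdups xs) @ remdups ys"
  by (induction xs) auto

text \<open>A prefix of a reading contributes a prefix of the first occurrences, so processes with a
  common beginning also share the beginning of their lists of distinct places.\<close>

lemma keep_first_append:
  "keep_first (xs @ ys) = keep_first xs @ filter (\<lambda>x. x \<notin> set xs) (keep_first ys)"
  by (simp add: keep_first_def remdups_append_filter rev_filter)

lemma set_keep_first [simp]: "set (keep_first xs) = set xs"
  by (simp add: keep_first_def)

lemma distinct_keep_first [simp]: "distinct (keep_first xs)"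
  by (simp add: keep_first_def)

lemma length_keep_first_le: "length (keep_first xs) \<le> length xs"
  by (simp add: keep_first_def) (metis length_remdups_leq length_rev)

text \<open>\<open>answers\<close> removes repetitions among pairs of place and contents. Within a
  round the contents are a function of the place, and pairing is injective, so the repetitions
  removed are those of the places.\<close>

lemma keep_first_map_inj:
  assumes "inj f"
  shows "keep_first (map f xs) = map f (keep_first xs)"
proof -
  have "remdups (map f ys) = map f (remdups ys)" for ys
    using assms by (induction ys) (auto dest: injD)
  then show ?thesis by (simp add: keep_first_def rev_map)
qed

text \<open>
  Two adaptive processes with the same rule: the next element is a function of the previous one
  and of the values of the places which that one reads.
\<close>

locale lockstep =
  fixes ex ey :: "'e list" and rd :: "'e \<Rightarrow> 'p list" and vx vy :: "'p \<Rightarrow> 'v"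
  assumes start: "ex \<noteq> []" "ey \<noteq> []" "ex ! 0 = ey ! 0"
    and step: "\<And>m. \<lbrakk>m < length ex; m < length ey; ex ! m = ey ! m; \<forall>p\<in>set (rd (ex ! m)). vx p = vy p\<rbrakk>
       \<Longrightarrow> (Suc m < length ex \<longleftrightarrow> Suc m < length ey) \<and> (Suc m < length ex \<longrightarrow> ex ! Suc m = ey ! Suc m)"
begin

lemma same_until:
  assumes "m < length ex" "\<forall>i<m. \<forall>p\<in>set (rd (ex ! i)). vx p = vy p"
  shows "m < length ey \<and> ex ! m = ey ! m"
  using assms
proof (induction m)
  case 0
  then show ?case using start by auto
next
  case (Suc m)
  then have "m < length ey \<and> ex ! m = ey ! m" using less_SucI Suc_lessD by blast
  with Suc.prems step[of m] show ?case by auto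
qed

lemma all_same:
  assumes "\<forall>p\<in>set (concat (map rd ex)). vx p = vy p"
  shows "ex = ey"
proof -
  have same: "m < length ey \<and> ex ! m = ey ! m" if "m < length ex" for m
    using that assms by (intro same_until) auto
  have "length ex \<le> length ey" using same leI by blast
  \<comment> \<open>A proper prefix is impossible: the last element of \<open>ex\<close> reads only
    agreed values, so by \<open>step\<close> it has a successor in \<open>ex\<close> as soon as it
    has one in \<open>ey\<close>.\<close>
  moreover have "\<not> length ex < length ey"
  proof
    assume that: "length ex < length ey"
    let ?m = "length ex - 1"
    have m: "?m < length ex" using start by simp
    moreover have "ex ! ?m \<in> set ex" using m by simp
    then have "\<forall>p\<in>set (rd (ex ! ?m)). vx p = vy p" using assms by auto
    ultimately have "Suc ?m < length ex" using step[of ?m] same[of ?m] that by auto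
    then show False by simp
  qed
  ultimately have "length ex = length ey" by linarith
  then show ?thesis using same by (auto intro: nth_equalityI)
qed

text \<open>What an element reads affects only later elements. Up to and including the first element
  that reads a disagreement the lists therefore coincide, and this common prefix \<open>C\<close>
  already contains the disagreement.\<close>

lemma common_prefix:
  assumes "p \<in> set (concat (map rd ex))" "vx p \<noteq> vy p"
  obtains C xs ys p' where "ex = C @ xs" "ey = C @ ys" "p' \<in> set (concat (map rd C))" "vx p' \<noteq> vy p'"
proof -
  have "\<exists>m<length ex. \<exists>p\<in>set (rd (ex ! m)). vx p \<noteq> vy p"
  proof -
    obtain e where "e \<in> set ex" "p \<in> set (rd e)" using assms by auto
    then show ?thesis using assms(2) by (metis in_set_conv_nth)
  qed
  then obtain m where m: "m < length ex \<and> (\<exists>p\<in>set (rd (ex ! m)). vx p \<noteq> vy p)"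
    and least: "\<forall>i<m. \<not> (i < length ex \<and> (\<exists>p\<in>set (rd (ex ! i)). vx p \<noteq> vy p))"
    using exists_least_iff[of "\<lambda>m. m < length ex \<and> (\<exists>p\<in>set (rd (ex ! m)). vx p \<noteq> vy p)"] by blast
  have agree: "\<forall>p\<in>set (rd (ex ! i)). vx p = vy p" if "i < m" for i
    using least m that less_trans by blast
  have "i < length ey \<and> ex ! i = ey ! i" if "i \<le> m" for i
    using that m by (intro same_until allI impI agree) auto
  then have eq: "take (Suc m) ex = take (Suc m) ey"
    using m by (intro nth_equalityI) (auto simp: Suc_leI less_Suc_eq_le)
  obtain p' where "p' \<in> set (rd (ex ! m))" "vx p' \<noteq> vy p'" using m by blast
  moreover have "ex ! m \<in> set (take (Suc m) ex)" using m by (auto simp: take_Suc_conv_app_nth)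
  ultimately have "p' \<in> set (concat (map rd (take (Suc m) ex)))" "vx p' \<noteq> vy p'" by auto
  then show thesis
  proof (rule that[rotated 2])
    show "ex = take (Suc m) ex @ drop (Suc m) ex" by simp
    show "ey = take (Suc m) ex @ drop (Suc m) ey" unfolding eq by simp
  qed
qed

abbreviation "readx \<equiv> keep_first (concat (map rd ex))"
abbreviation "ready \<equiv> keep_first (concat (map rd ey))"

text \<open>The place of disagreement occurs in the common prefix, whose first occurrences begin
  both lists of distinct places. It thus has the same index k in both, after the same
  places.\<close>

lemma disagreement:
  assumes "ex \<noteq> ey \<or> readx \<noteq> ready"
  obtains k where "k < length readx" "k < length ready" "vx (readx ! k) \<noteq> vy (ready ! k)"
    "take (Suc k) readx = take (Suc k) ready"
proof -
  obtain p where "p \<in> set (concat (map rd ex))" "vx p \<noteq> vy p"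
    using all_same assms by metis
  then obtain C xs ys p' where C: "ex = C @ xs" "ey = C @ ys" "p' \<in> set (concat (map rd C))" "vx p' \<noteq> vy p'"
    using common_prefix by metis
  let ?K = "keep_first (concat (map rd C))"
  obtain k where k: "k < length ?K" "?K ! k = p'" using C(3) by (metis in_set_conv_nth set_keep_first)
  have px: "readx = ?K @ filter (\<lambda>x. x \<notin> set (concat (map rd C))) (keep_first (concat (map rd xs)))"
    and py: "ready = ?K @ filter (\<lambda>x. x \<notin> set (concat (map rd C))) (keep_first (concat (map rd ys)))"
    unfolding C(1,2) by (simp_all add: keep_first_append)
  show thesis
    using that[of k] k C(4) unfolding px py by (simp add: nth_append)
qed

text \<open>If the lists of distinct places differ, they agree up to and including a position k
  where the values differ. Equal values at the first j positions force j \<le> k, so position j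
  still belongs to the common part.\<close>

lemma next_read_same:
  assumes "map vx (take j readx) = map vy (take j ready)"
  shows "take (Suc j) readx = take (Suc j) ready"
proof (cases "readx = ready")
  case False
  then obtain k where k: "k < length readx" "k < length ready" "vx (readx ! k) \<noteq> vy (ready ! k)"
    "take (Suc k) readx = take (Suc k) ready"
    using disagreement by metis
  have "\<not> k < j"
  proof
    assume "k < j"
    then have "map vx (take j readx) ! k \<noteq> map vy (take j ready) ! k" using k by simp
    with assms show False by metis
  qed
  then have "take (Suc j) (take (Suc k) readx) = take (Suc j) readx"
    "take (Suc j) (take (Suc k) ready) = take (Suc j) ready" by (simp_all add: min_def)
  with k(4) show ?thesis by metis
qed simp

lemma all_reads_same:
  assumes "map vx readx = map vy ready"
  shows "ex = ey \<and> (\<forall>p\<in>set (concat (map rd ex)). vx p = vy p)"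
proof -
  have "ex = ey \<and> readx = ready"
  proof (rule ccontr)
    assume "\<not> (ex = ey \<and> readx = ready)"
    then obtain k where "k < length readx" "k < length ready" "vx (readx ! k) \<noteq> vy (ready ! k)"
      using disagreement by metis
    then have "map vx readx ! k \<noteq> map vy ready ! k" by simp
    with assms show False by metis
  qed
  with assms have "map vx readx = map vy readx" "ex = ey" by simp_all
  then show ?thesis by (metis map_eq_conv set_keep_first)
qed

end

section \<open>A branching program from prescribed runs\<close>

text \<open>A node or edge acts as it does for an arbitrarily chosen input that passes through it;
  \<open>query\<close> and \<open>edge\<close> make the choice irrelevant. Edges that no input
  follows still need a target, which is why \<open>None\<close> is added to every level but that of
  the root.\<close>

lemma branching_program_of_runs:
  fixes I :: "input set" and V :: "input \<Rightarrow> nat \<Rightarrow> 'v option"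
    and Q :: "input \<Rightarrow> nat \<Rightarrow> nat option" and E :: "input \<Rightarrow> nat \<Rightarrow> (nat \<times> bool list) list"
  assumes I: "finite I" "I \<noteq> {}"
    and root: "\<And>x. x \<in> I \<Longrightarrow> V x 0 = Some s"
    and query: "\<And>x y i. \<lbrakk>x \<in> I; y \<in> I; i < d; V x i = V y i\<rbrakk> \<Longrightarrow> Q x i = Q y i"
    and edge: "\<And>x y i. \<lbrakk>x \<in> I; y \<in> I; i < d; V x i = V y i;
        map_option ((!) x) (Q x i) = map_option ((!) y) (Q y i)\<rbrakk>
        \<Longrightarrow> V x (Suc i) = V y (Suc i) \<and> E x i = E y i"
    and range: "\<And>x i j. \<lbrakk>x \<in> I; i < d; Q x i = Some j\<rbrakk> \<Longrightarrow> j < n"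
    and silent: "\<And>x i. \<lbrakk>x \<in> I; i < d; V x i = None\<rbrakk> \<Longrightarrow> E x i = []"
  obtains P :: "'v option bp" where "leveled_bp n w P" "depth P = d" "source P = Some s"
    "\<And>i. nodes P i = (\<lambda>x. V x i) ` I \<union> (if i = 0 then {} else {None})"
    "\<And>x i. \<lbrakk>x \<in> I; i \<le> d\<rbrakk> \<Longrightarrow> visit P x i = V x i"
    "\<And>x i. \<lbrakk>x \<in> I; i < d\<rbrakk> \<Longrightarrow> emitted_at P x i = E x i"
    "\<And>i c. i < d \<Longrightarrow> emit P i None c = []"
proof -
  define lab where "lab x i = map_option ((!) x) (Q x i)" for x :: input and i
  define here where "here i v x \<longleftrightarrow> x \<in> I \<and> V x i = v" for i v x
  define via where "via i v c x \<longleftrightarrow> here i v x \<and> lab x i = c" for i v c x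
  define P :: "'v option bp" where "P = \<lparr>depth = d,
     nodes = (\<lambda>i. (\<lambda>x. V x i) ` I \<union> (if i = 0 then {} else {None})),
     source = Some s,
     query = (\<lambda>i v. if \<exists>x. here i v x then Q (SOME x. here i v x) i else None),
     target = (\<lambda>i v c. if \<exists>x. via i v c x then V (SOME x. via i v c x) (Suc i) else None),
     emit = (\<lambda>i v c. if \<exists>x. via i v c x then E (SOME x. via i v c x) i else [])\<rparr>"
  have q: "bp.query P i v = Q x i" if "here i v x" "i < d" for i v x
  proof -
    define y where "y = (SOME y. here i v y)"
    have "here i v y" using that(1) unfolding y_def by (rule someI)
    moreover have "bp.query P i v = Q y i" using that by (auto simp: P_def y_def)
    ultimately show ?thesis using query[of y x i] that by (simp add: here_def)
  qed
  have te: "target P i v c = V x (Suc i) \<and> emit P i v c = E x i" if "via i v c x" "i < d" for i v c x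
  proof -
    define y where "y = (SOME y. via i v c y)"
    have "via i v c y" using that(1) unfolding y_def by (rule someI)
    moreover have "target P i v c = V y (Suc i)" "emit P i v c = E y i"
      using that by (auto simp: P_def y_def)
    ultimately show ?thesis using edge[of y x i] that by (simp add: here_def via_def lab_def)
  qed
  have label: "label P x i (V x i) = lab x i" if "x \<in> I" "i < d" for x i
    using that q[of i "V x i" x] by (simp add: label_def here_def lab_def)
  have visit: "visit P x i = V x i" if "x \<in> I" "i \<le> d" for x i
    using that(2)
  proof (induction i)
    case 0
    then show ?case using root that by (simp add: P_def)
  next
    case (Suc i)
    then have "visit P x i = V x i" "i < d" by simp_all
    moreover have "via i (V x i) (lab x i) x" using that(1) by (simp add: via_def here_def)
    ultimately show ?case using te[of i _ _ x] label[OF that(1)] by simp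
  qed
  have emitted: "emitted_at P x i = E x i" if "x \<in> I" "i < d" for x i
  proof -
    have "via i (V x i) (lab x i) x" using that by (simp add: via_def here_def)
    moreover have "visit P x i = V x i" using visit that by simp
    ultimately show ?thesis using te[of i _ _ x] that(2) by (metis emitted_at_def label[OF that])
  qed
  \<comment> \<open>\<open>silent\<close> speaks of inputs that are at \<open>None\<close>; for a
    label that none of them meets there, the default [] of \<open>emit\<close> applies.\<close>
  have sil: "emit P i None c = []" if "i < d" for i c
  proof (cases "\<exists>x. via i None c x")
    case True
    then obtain x where "via i None c x" by blast
    then show ?thesis using te[of i None c x] that silent[of x i] by (auto simp: via_def here_def)
  next
    case False
    then show ?thesis by (auto simp: P_def)
  qed
  have tn: "target P i v c \<in> nodes P (Suc i)" for i v c
  proof (cases "\<exists>x. via i v c x")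
    case True
    define y where "y = (SOME y. via i v c y)"
    have "y \<in> I" using someI_ex[OF True] by (simp add: y_def via_def here_def)
    moreover have "target P i v c = V y (Suc i)" using True by (auto simp: P_def y_def)
    ultimately show ?thesis by (simp add: P_def)
  qed (auto simp: P_def)
  have qr: "j < n" if "bp.query P i v = Some j" "i < d" for i v j
  proof -
    have "\<exists>x. here i v x" using that(1) by (auto simp: P_def split: if_splits)
    then obtain x where x: "here i v x" by blast
    then have "Q x i = Some j" "x \<in> I" using q[OF x that(2)] that(1) by (simp_all add: here_def)
    then show ?thesis using range that(2) by blast
  qed
  have d: "depth P = d" by (simp add: P_def)
  have nodes: "nodes P i = (\<lambda>x. V x i) ` I \<union> (if i = 0 then {} else {None})" for i
    by (simp add: P_def)
  have source: "source P = Some s" by (simp add: P_def)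
  have "(\<lambda>x. V x 0) ` I = {Some s}" using I(2) root by force
  then have "leveled_bp n w P"
    unfolding leveled_bp_def d source
  proof (intro conjI allI impI ballI)
    show "nodes P i \<noteq> {}" for i using I(2) by (simp add: nodes)
    show "finite (nodes P i)" for i using I(1) by (simp add: nodes)
    show "nodes P 0 = {Some s}" using \<open>_ ` I = _\<close> by (simp add: nodes)
    show "j < n" if "bp.query P i v = Some j" "i < d" for i v j using qr that .
    show "target P i v c \<in> nodes P (Suc i)" for i v c by (rule tn)
  qed
  then show thesis
    using d source nodes visit emitted sil by (rule that)
qed

section \<open>Steps and holds\<close>

text \<open>The part of an event on which control and output depend. Raw contents and time stamps
  are dropped, as they may differ between the executions compared.\<close>

fun projected :: "state \<times> step \<Rightarrow> (cell \<Rightarrow> bool option) \<times> step" where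
  "projected (\<sigma>, a) = (computed \<sigma>, a)"

lemma run_steps_append:
  "run_steps S x \<sigma> (as @ bs) = run_steps S x \<sigma> as @ run_steps S x (fold (exec S x) as \<sigma>) bs"
  by (induction as arbitrary: \<sigma>) auto

lemma computed_held_cong: "held \<sigma> = held \<rho> \<Longrightarrow> computed \<sigma> = computed \<rho>"
  by (simp add: computed_def fun_eq_iff)

lemma raw_source_held_cong: "held \<sigma> = held \<rho> \<Longrightarrow> raw_source \<sigma> = raw_source \<rho>"
  by (simp add: raw_source_def fun_eq_iff)

lemma live_held_cong: "held \<sigma> = held \<rho> \<Longrightarrow> live \<sigma> = live \<rho>"
  by (simp add: live_def)

lemma raw_word_held_cong: "held \<sigma> = held \<rho> \<Longrightarrow> raw_word S \<sigma> = raw_word S \<rho>"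
  by (simp add: raw_word_def fun_eq_iff)

lemma comp_string_computed_cong: "computed \<sigma> = computed \<rho> \<Longrightarrow> comp_string S \<sigma> = comp_string S \<rho>"
  by (simp add: comp_string_def)

text \<open>Independent of the input: a copied cell is computed exactly if its source is, and a
  loaded cell is not computed.\<close>

lemma computed_exec_move:
  assumes "computed \<sigma> = computed \<rho>"
  shows "computed (exec_move S a \<sigma>) = computed (exec_move S a \<rho>)"
proof -
  have upd: "computed (\<sigma>\<lparr>held := (held \<sigma>)(c := v), since := u\<rparr>)
     = (computed \<sigma>)(c := (case v of Some (Comp b) \<Rightarrow> Some b | _ \<Rightarrow> None))" for \<sigma> c v u
    by (auto simp: computed_def fun_eq_iff)
  have same: "computed (\<sigma>\<lparr>outcells := u\<rparr>) = computed \<sigma>" for \<sigma> u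
    by (auto simp: computed_def fun_eq_iff)
  have "(case held \<sigma> c of Some (Comp b) \<Rightarrow> Some b | _ \<Rightarrow> None)
      = (case held \<rho> c of Some (Comp b) \<Rightarrow> Some b | _ \<Rightarrow> None)" for c
    using fun_cong[OF assms, of c] by (simp add: computed_def)
  with assms show ?thesis by (cases a) (simp_all add: upd same)
qed

lemma computed_exec_fire:
  assumes "computed \<sigma> = computed \<rho>" "fire_arg S x g \<sigma> = fire_arg S y g \<rho>"
  shows "computed (exec_fire S x g \<sigma>) = computed (exec_fire S y g \<rho>)"
proof -
  have "computed (exec_fire S x g \<sigma>) = (\<lambda>c. case fire_writes S x g \<sigma> c of
          Some v \<Rightarrow> Some v | None \<Rightarrow> if c \<in> fire_frees S x g \<sigma> then None else computed \<sigma> c)" for x \<sigma>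
    by (auto simp: computed_def exec_fire_def fun_eq_iff split: option.splits)
  moreover have "fire_writes S x g \<sigma> = fire_writes S y g \<rho>" "fire_frees S x g \<sigma> = fire_frees S y g \<rho>"
    using assms(2) by (simp_all add: fire_writes_def fire_frees_def fun_eq_iff)
  ultimately show ?thesis by (simp only: assms(1))
qed

lemma held_convey: "held (convey S R \<sigma>) (l, k) = held \<sigma> (l, if l \<in> R then carried_from S l k else k)"
  by (simp add: convey_def Let_def)

lemma computed_exec_hold:
  assumes "computed \<sigma> = computed \<rho>"
  shows "computed (exec_hold S d R \<sigma>) = computed (exec_hold S d R \<rho>)"
proof -
  have val: "computed (convey S R \<tau>) (l, k) = computed \<tau> (l, if l \<in> R then carried_from S l k else k)" for \<tau> l k
    by (simp add: computed_def held_convey)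
  have c: "computed (convey S R \<sigma>) = computed (convey S R \<rho>)" if "computed \<sigma> = computed \<rho>" for \<sigma> \<rho>
    using that by (auto simp: fun_eq_iff val)
  have "computed ((convey S R ^^ u) \<sigma>) = computed ((convey S R ^^ u) \<rho>)" for u
  proof (induction u)
    case (Suc u)
    show ?case unfolding funpow.simps(2) comp_apply using Suc by (rule c)
  qed (use assms in simp)
  then have "computed ((convey S R ^^ nat \<lfloor>d\<rfloor>) \<sigma>) = computed ((convey S R ^^ nat \<lfloor>d\<rfloor>) \<rho>)" .
  then show ?thesis by (simp add: exec_hold_def computed_def fun_eq_iff)
qed

lemma projected_moves:
  assumes "computed \<sigma> = computed \<rho>"
  shows "map projected (run_steps S x \<sigma> (map Move ms)) = map projected (run_steps S y \<rho> (map Move ms))"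
    "computed (fold (exec S x) (map Move ms) \<sigma>) = computed (fold (exec S y) (map Move ms) \<rho>)"
proof -
  have "map projected (run_steps S x \<sigma> (map Move ms)) = map projected (run_steps S y \<rho> (map Move ms)) \<and>
    computed (fold (exec S x) (map Move ms) \<sigma>) = computed (fold (exec S y) (map Move ms) \<rho>)"
    using assms
  proof (induction ms arbitrary: \<sigma> \<rho>)
    case (Cons a ms)
    then show ?case using Cons.IH[OF computed_exec_move[OF Cons.prems, of S a]] by simp
  qed simp
  then show "map projected (run_steps S x \<sigma> (map Move ms)) = map projected (run_steps S y \<rho> (map Move ms))"
    "computed (fold (exec S x) (map Move ms) \<sigma>) = computed (fold (exec S y) (map Move ms) \<rho>)" by blast+
qed

text \<open>
  By the latency condition a fire reads no cell changed in the current round: what it reads is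
  what was there when the round started.
\<close>

definition kept :: "state \<Rightarrow> state \<Rightarrow> bool" where
  "kept \<sigma>0 \<sigma> \<longleftrightarrow> now \<sigma> = now \<sigma>0 \<and>
     (\<forall>c. held \<sigma> c = held \<sigma>0 c \<or> held \<sigma> c = None \<or> since \<sigma> c = now \<sigma>)"

lemma kept_refl [simp]: "kept \<sigma> \<sigma>"
  by (simp add: kept_def)

lemma kept_exec:
  assumes "kept \<sigma>0 \<sigma>" "\<not> is_hold a"
  shows "kept \<sigma>0 (exec S x a \<sigma>)"
proof -
  let ?\<tau> = "exec S x a \<sigma>"
  \<comment> \<open>\<open>since\<close> is included because a cell already stamped with the current
    time has to keep that stamp as long as it is left alone.\<close>
  have "now ?\<tau> = now \<sigma> \<and> (\<forall>c. held ?\<tau> c = held \<sigma> c \<and> since ?\<tau> c = since \<sigma> c \<or>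
      held ?\<tau> c = None \<or> since ?\<tau> c = now \<sigma>)"
  proof (cases a)
    case (Move b)
    then show ?thesis by (cases b) auto
  next
    case (Fire g)
    then show ?thesis by (auto simp: exec_fire_def split: option.splits)
  qed (use assms in simp)
  then show ?thesis using assms(1) unfolding kept_def by metis
qed

lemma kept_fold:
  assumes "kept \<sigma>0 \<sigma>" "\<forall>a\<in>set as. \<not> is_hold a"
  shows "kept \<sigma>0 (fold (exec S x) as \<sigma>)"
  using assms by (induction as arbitrary: \<sigma>) (auto simp: kept_exec)

section \<open>Cutting lists of events at holds\<close>

lemma rounds_no_hold: "\<forall>e\<in>set es. \<not> is_hold (snd e) \<Longrightarrow> rounds es = [es]"
  by (induction es) auto

lemma rounds_append_hold:
  "\<lbrakk>\<forall>e\<in>set es. \<not> is_hold (snd e); is_hold (snd e)\<rbrakk> \<Longrightarrow> rounds (es @ e # fs) = es # rounds fs"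
  by (induction es) auto

lemma rounds_not_Nil [simp]: "rounds es \<noteq> []"
  by (cases es) auto

lemma set_rounds: "es \<in> set (rounds fs) \<Longrightarrow> set es \<subseteq> set fs"
proof (induction fs arbitrary: es)
  case (Cons f fs)
  obtain r rs where r: "rounds fs = r # rs" using rounds_not_Nil by (meson neq_Nil_conv)
  have IH: "set r \<subseteq> set fs" "\<And>es. es \<in> set rs \<Longrightarrow> set es \<subseteq> set fs" using Cons.IH r by simp_all
  have "es \<in> set rs \<or> es = r \<or> es = f # r \<or> es = []"
    using Cons.prems r by (auto split: if_splits)
  then show ?case using IH by auto
qed auto

lemma hold_of_None: "hold_of e = None \<longleftrightarrow> \<not> is_hold (snd e)"
  by (cases e, cases "snd e") auto

lemma holds_append: "holds (es @ fs) = holds es @ holds fs"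
  by (simp add: holds_def List.map_filter_def)

lemma holds_no_hold: "\<forall>e\<in>set es. \<not> is_hold (snd e) \<Longrightarrow> holds es = []"
  by (simp add: holds_def List.map_filter_def filter_empty_conv hold_of_None)

lemma holds_Cons_hold: "holds ((\<sigma>, Hold d R) # fs) = (\<sigma>, d, R) # holds fs"
  by (simp add: holds_def List.map_filter_def)

lemma snd_run_steps: "map snd (run_steps S x \<sigma> as) = as"
  by (induction as arbitrary: \<sigma>) auto

definition body_steps :: "decision \<Rightarrow> step list" where
  "body_steps c = map Move (moves c) @ (case firing c of None \<Rightarrow> [] | Some g \<Rightarrow> [Fire g])"

lemma body_steps_no_hold: "a \<in> set (body_steps c) \<Longrightarrow> \<not> is_hold a"
  by (auto simp: body_steps_def split: option.splits)

lemma decision_steps_body: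
  "decision_steps c = body_steps c @ (case ending c of Rest d R \<Rightarrow> [Hold d R] | _ \<Rightarrow> [])"
  by (simp add: decision_steps_def body_steps_def)

section \<open>Conveyors and invariants of states\<close>

lemma words_disjoint:
  assumes "substrate_ok S" "l \<le> maxlev S" "s \<in> wstarts S l" "s' \<in> wstarts S l"
  shows "s = s' \<or> s + wlen S \<le> s' \<or> s' + wlen S \<le> s"
  using assms unfolding substrate_ok_def by blast

lemma carried_from_word:
  assumes "substrate_ok S" "l \<le> maxlev S" "conveyor S l = Some p"
    and s: "s \<in> wstarts S l" "s \<le> k" "k < s + wlen S"
  shows "carried_from S l k = p s + (k - s)"
proof -
  have "(THE s. s \<in> wstarts S l \<and> s \<le> k \<and> k < s + wlen S) = s"
  proof (intro the_equality)
    show "s' = s" if "s' \<in> wstarts S l \<and> s' \<le> k \<and> k < s' + wlen S" for s'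
      using that s words_disjoint[OF assms(1,2), of s' s] by linarith
  qed (use s in blast)
  moreover have "\<exists>s\<in>wstarts S l. s \<le> k \<and> k < s + wlen S" using s by blast
  ultimately show ?thesis by (simp add: carried_from_def assms(3) Let_def)
qed

text \<open>A conveyor carries words whole, and a cell outside every word stays put and cannot be
  raw. The raw word from which a raw cell came therefore arrives whole as the word around that
  cell.\<close>

lemma whole_raw_words_convey:
  assumes S: "substrate_ok S" and R: "\<forall>l\<in>R. l \<le> maxlev S" and \<sigma>: "whole_raw_words S \<sigma>"
  shows "whole_raw_words S (convey S R \<sigma>)"
  unfolding whole_raw_words_def
proof (intro allI impI)
  fix l k
  let ?\<tau> = "convey S R \<sigma>"
  assume raw: "raw_source ?\<tau> (l, k) \<noteq> None"
  have held: "held ?\<tau> (l, k) = held \<sigma> (l, if l \<in> R then carried_from S l k else k)" for k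
    by (rule held_convey)
  show "\<exists>s\<in>wstarts S l. s \<le> k \<and> k < s + wlen S \<and> raw_word S ?\<tau> l s"
  proof (cases "l \<in> R \<and> conveyor S l \<noteq> None")
    case False
    then have "held ?\<tau> (l, k) = held \<sigma> (l, k)" for k
      by (auto simp: held carried_from_def)
    then show ?thesis using raw \<sigma> by (simp add: whole_raw_words_def raw_source_def raw_word_def)
  next
    case True
    then obtain p where p: "conveyor S l = Some p" and l: "l \<in> R" "l \<le> maxlev S" using R by auto
    have bij: "bij_betw p (wstarts S l) (wstarts S l)" using S l p by (auto simp: substrate_ok_def)
    note cf = carried_from_word[OF S l(2) p]
    show ?thesis
    proof (cases "\<exists>s\<in>wstarts S l. s \<le> k \<and> k < s + wlen S")
      case False
      then have "carried_from S l k = k" using p by (auto simp: carried_from_def)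
      then have "raw_source \<sigma> (l, k) \<noteq> None" using raw l by (simp add: raw_source_def held)
      then show ?thesis using \<sigma> False by (auto simp: whole_raw_words_def)
    next
      case True
      then obtain s where s: "s \<in> wstarts S l" "s \<le> k" "k < s + wlen S" by blast
      then have ps: "p s \<in> wstarts S l" using bij by (auto simp: bij_betw_def)
      have "raw_source \<sigma> (l, p s + (k - s)) \<noteq> None"
        using raw l cf[OF s] by (simp add: raw_source_def held)
      then obtain s2 where s2: "s2 \<in> wstarts S l" "s2 \<le> p s + (k - s)" "p s + (k - s) < s2 + wlen S"
        "raw_word S \<sigma> l s2" using \<sigma> by (auto simp: whole_raw_words_def)
      then have "s2 = p s" using words_disjoint[OF S l(2) s2(1) ps] s by linarith
      with s2 obtain i where i: "\<forall>b<wlen S. held \<sigma> (l, p s + b) = Some (Raw i b)"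
        by (auto simp: raw_word_def)
      have "held ?\<tau> (l, s + b) = Some (Raw i b)" if "b < wlen S" for b
        using i that l cf[OF s(1), of "s + b"] by (simp add: held)
      then show ?thesis using s by (auto simp: raw_word_def)
    qed
  qed
qed

text \<open>The invariant behind finite live sets and behind queries to existing input words
  only.\<close>

definition valid_state :: "substrate \<Rightarrow> nat \<Rightarrow> state \<Rightarrow> bool" where
  "valid_state S n \<sigma> \<longleftrightarrow> live \<sigma> \<subseteq> valid_cells S \<and> (\<forall>c i b. held \<sigma> c = Some (Raw i b) \<longrightarrow> i < n)"

lemma finite_valid_cells: "finite (valid_cells S)"
proof -
  have "valid_cells S \<subseteq> (SIGMA l:{..maxlev S}. {..<ncells S l})" by (auto simp: valid_cells_def)
  then show ?thesis by (rule finite_subset) auto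
qed

lemma carried_from_less:
  assumes "substrate_ok S" "l \<le> maxlev S" "carried_from S l k < ncells S l"
  shows "k < ncells S l"
proof (cases "\<exists>s\<in>wstarts S l. s \<le> k \<and> k < s + wlen S")
  case True
  then obtain s where "s \<in> wstarts S l" "k < s + wlen S" by blast
  moreover have "s + wlen S \<le> ncells S l" using assms calculation(1) by (auto simp: substrate_ok_def)
  ultimately show ?thesis by simp
next
  case False
  then have "carried_from S l k = k" by (auto simp: carried_from_def split: option.splits)
  then show ?thesis using assms by simp
qed

lemma valid_state_convey:
  assumes "substrate_ok S" "valid_state S n \<sigma>"
  shows "valid_state S n (convey S R \<sigma>)"
proof -
  have held: "held (convey S R \<sigma>) (l, k) = held \<sigma> (l, if l \<in> R then carried_from S l k else k)" for l k
    by (rule held_convey)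
  have "(l, k) \<in> valid_cells S" if "held (convey S R \<sigma>) (l, k) \<noteq> None" for l k
  proof -
    have "(l, if l \<in> R then carried_from S l k else k) \<in> valid_cells S"
      using that assms by (auto simp: held valid_state_def live_def)
    then show ?thesis using assms carried_from_less[of S l k]
      by (auto simp: valid_cells_def split: if_splits)
  qed
  then show ?thesis using assms(2) by (force simp: valid_state_def live_def held)
qed

lemma valid_state_exec:
  assumes "substrate_ok S" "valid_state S n \<sigma>" "step_ok S n x (\<sigma>, a)"
  shows "valid_state S n (exec S x a \<sigma>)"
proof (cases a)
  case (Move b)
  then show ?thesis
  proof (cases b)
    case (Move_raw l s bb m t)
    then show ?thesis using assms Move
      by (auto simp: valid_state_def live_def free_for_move_def split: if_splits)
  next
    case (Move_comp c d)
    then have "\<exists>v. held \<sigma> c = Some (Comp v)" "d \<in> valid_cells S" using assms(3) Move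
      by (auto simp: computed_def free_for_move_def split: option.splits content.splits)
    then show ?thesis using assms(2) Move Move_comp by (auto simp: valid_state_def live_def)
  qed (use assms Move in \<open>auto simp: valid_state_def live_def free_for_move_def split: if_splits\<close>)
next
  case (Fire g)
  have w: "dom (fire_writes S x g \<sigma>) \<subseteq> valid_cells S" using assms(3) Fire by (simp add: fire_ok_def)
  have h: "fire_writes S x g \<sigma> c \<noteq> None \<and> (\<exists>v. held (exec_fire S x g \<sigma>) c = Some (Comp v)) \<or>
      held (exec_fire S x g \<sigma>) c = None \<or> held (exec_fire S x g \<sigma>) c = held \<sigma> c" for c
    by (simp add: exec_fire_def split: option.splits)
  have "c \<in> valid_cells S" if "held (exec_fire S x g \<sigma>) c \<noteq> None" for c
    using that h[of c] w assms(2) unfolding valid_state_def live_def by auto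
  moreover have "i < n" if "held (exec_fire S x g \<sigma>) c = Some (Raw i b)" for c i b
    using that h[of c] assms(2) unfolding valid_state_def
    by (metis content.distinct(1) option.inject option.distinct(1))
  ultimately show ?thesis unfolding valid_state_def live_def Fire by auto
next
  case (Hold d R)
  have "valid_state S n ((convey S R ^^ u) \<sigma>)" for u
    using assms by (induction u) (auto intro: valid_state_convey)
  then show ?thesis using Hold by (simp add: valid_state_def live_def exec_hold_def)
qed

text \<open>Cells outside words stay put and cells of words come from cells of words. Two cells of
  words with the same source lie in the same source word, hence in the same word, since
  \<open>p\<close> is injective on words.\<close>

lemma inj_carried:
  assumes S: "substrate_ok S" and R: "\<forall>l\<in>R. l \<le> maxlev S"
  shows "inj (\<lambda>(l, k). if l \<in> R then (l, carried_from S l k) else (l, k))"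
proof -
  have "k = k'" if l: "l \<in> R" and eq: "carried_from S l k = carried_from S l k'" for l k k'
  proof (cases "conveyor S l")
    case None
    then show ?thesis using eq by (simp add: carried_from_def)
  next
    case (Some p)
    have l': "l \<le> maxlev S" using R l by auto
    note carry = carried_from_word[OF S l' Some]
    have bij: "bij_betw p (wstarts S l) (wstarts S l)" using S l' Some by (auto simp: substrate_ok_def)
    have out: "carried_from S l k = k" if "\<not> (\<exists>s\<in>wstarts S l. s \<le> k \<and> k < s + wlen S)" for k
      using that Some by (auto simp: carried_from_def)
    let ?in = "\<lambda>k. \<exists>s\<in>wstarts S l. s \<le> k \<and> k < s + wlen S"
    have stay: "?in (carried_from S l k)" if in_k: "?in k" for k
    proof -
      obtain s where s: "s \<in> wstarts S l" "s \<le> k" "k < s + wlen S" using in_k by blast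
      then show ?thesis using carry[OF s] bij by (intro bexI[of _ "p s"]) (auto simp: bij_betw_def)
    qed
    show ?thesis
    proof (cases "?in k \<and> ?in k'")
      case True
      then obtain s s' where s: "s \<in> wstarts S l" "s \<le> k" "k < s + wlen S"
        and s': "s' \<in> wstarts S l" "s' \<le> k'" "k' < s' + wlen S" by blast
      have ps: "p s \<in> wstarts S l" "p s' \<in> wstarts S l" using bij s s' by (auto simp: bij_betw_def)
      have e: "p s + (k - s) = p s' + (k' - s')" using eq carry[OF s] carry[OF s'] by simp
      then have "p s = p s'" using words_disjoint[OF S l' ps] s s' by linarith
      then have "s = s'" using bij s s' by (auto simp: bij_betw_def inj_on_def)
      with e s s' show ?thesis by simp
    next
      case False
      then show ?thesis using eq stay out by metis
    qed
  qed
  note inj = this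
  show ?thesis by (rule injI) (auto split: if_splits prod.splits dest: inj)
qed

text \<open>The live set after one unit is a preimage of the one before under an injective map. This
  carries bounds from the start of a hold, where \<open>live_count\<close> is taken, to its end,
  where the code of a round is formed.\<close>

lemma card_live_convey:
  assumes "substrate_ok S" "\<forall>l\<in>R. l \<le> maxlev S" "finite (live \<sigma>)"
  shows "finite (live (convey S R \<sigma>)) \<and> card (live (convey S R \<sigma>)) \<le> card (live \<sigma>)"
proof -
  define g where "g = (\<lambda>(l, k). if l \<in> R then (l, carried_from S l k) else (l, k))"
  have g: "inj g" unfolding g_def using inj_carried assms by blast
  have "live (convey S R \<sigma>) = g -` live \<sigma>"
    by (auto simp: live_def convey_def g_def Let_def)
  moreover have "finite (g -` live \<sigma>)" using assms(3) g finite_vimageI by blast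
  moreover have "card (g -` live \<sigma>) \<le> card (live \<sigma>)"
    using g assms(3) by (intro card_inj_on_le[of g]) (auto intro: inj_on_subset)
  ultimately show ?thesis by simp
qed

lemma exec_hold_props:
  assumes "substrate_ok S" "hold_ok S d R"
  shows "whole_raw_words S \<sigma> \<Longrightarrow> whole_raw_words S (exec_hold S d R \<sigma>)"
    "finite (live \<sigma>) \<Longrightarrow> card (live (exec_hold S d R \<sigma>)) \<le> card (live \<sigma>)"
proof -
  have R: "\<forall>l\<in>R. l \<le> maxlev S" using assms by (auto simp: hold_ok_def)
  have h: "held (exec_hold S d R \<sigma>) = held ((convey S R ^^ nat \<lfloor>d\<rfloor>) \<sigma>)" by (simp add: exec_hold_def)
  show "whole_raw_words S (exec_hold S d R \<sigma>)" if w: "whole_raw_words S \<sigma>"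
  proof -
    have "whole_raw_words S ((convey S R ^^ u) \<sigma>)" for u
    proof (induction u)
      case (Suc u)
      then show ?case using whole_raw_words_convey[OF assms(1) R] by simp
    qed (use w in simp)
    then show ?thesis
      by (simp add: whole_raw_words_def raw_source_held_cong[OF h] raw_word_held_cong[OF h])
  qed
  show "card (live (exec_hold S d R \<sigma>)) \<le> card (live \<sigma>)" if f: "finite (live \<sigma>)"
  proof -
    have "finite (live ((convey S R ^^ u) \<sigma>)) \<and> card (live ((convey S R ^^ u) \<sigma>)) \<le> card (live \<sigma>)" for u
    proof (induction u)
      case (Suc u)
      then show ?case using card_live_convey[OF assms(1) R, of "(convey S R ^^ u) \<sigma>"] by auto
    qed (use f in simp)
    then show ?thesis using live_held_cong[OF h] by simp
  qed
qed

section \<open>Rounds of an execution\<close>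

lemma length_rounds: "length (rounds es) = Suc (length (holds es))"
proof (induction es)
  case Nil
  then show ?case by (simp add: holds_def List.map_filter_def)
next
  case (Cons e es)
  obtain r rs where r: "rounds es = r # rs" using rounds_not_Nil by (meson neq_Nil_conv)
  have "holds (e # es) = holds [e] @ holds es" using holds_append[of "[e]" es] by simp
  moreover have "length (holds [e]) = (if is_hold (snd e) then 1 else 0)"
    using hold_of_None[of e] by (auto simp: holds_def List.map_filter_def)
  ultimately show ?case using Cons r by simp
qed

lemma valid_state_run:
  assumes "substrate_ok S" "valid_state S n \<sigma>" "\<forall>e\<in>set (run_steps S x \<sigma> as). step_ok S n x e"
  shows "valid_state S n (fold (exec S x) as \<sigma>) \<and> (\<forall>e\<in>set (run_steps S x \<sigma> as). valid_state S n (fst e))"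
  using assms(2,3)
proof (induction as arbitrary: \<sigma>)
  case (Cons a as)
  then have "valid_state S n (exec S x a \<sigma>)" using valid_state_exec[OF assms(1)] by simp
  then show ?case using Cons by simp
qed simp

lemma run_steps_moves_no_read: "concat (map (raw_reads S x) (run_steps S x \<sigma> (map Move ms))) = []"
  by (induction ms arbitrary: \<sigma>) auto

lemma whole_raw_wordsD:
  assumes S: "substrate_ok S" "whole_raw_words S \<sigma>" and l: "l \<le> maxlev S"
    and s: "s \<in> wstarts S l" "b < wlen S" "raw_source \<sigma> (l, s + b) \<noteq> None"
  shows "raw_word S \<sigma> l s"
proof -
  obtain s2 where "s2 \<in> wstarts S l" "s2 \<le> s + b" "s + b < s2 + wlen S" "raw_word S \<sigma> l s2"
    using S(2) s(3) unfolding whole_raw_words_def by blast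
  then show ?thesis using words_disjoint[OF S(1) l, of s2 s] s by (metis add_leD1 add_le_cancel_left leD le_add1 le_trans)
qed

text \<open>The raw words read by the batch decided at control state \<open>e\<close>, judged by the
  layout \<open>\<rho>\<close> at the start of the round and not by the current one:
  \<open>lockstep\<close> wants a fixed function of the element. Latency makes the two
  agree.\<close>

definition places :: "machine \<Rightarrow> (cell \<Rightarrow> nat option) \<Rightarrow> (cell \<Rightarrow> bool option) \<Rightarrow> cell list" where
  "places M \<rho> e = (case firing (control M e) of None \<Rightarrow> []
     | Some g \<Rightarrow> map (Pair (fire_level (sub M) g))
         (filter (\<lambda>s. \<rho> (fire_level (sub M) g, s) \<noteq> None) (reads g)))"

section \<open>Rounds as intervals of consultations of the control\<close>

locale running =
  fixes M :: machine
  assumes ok: "machine_ok M"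
begin

abbreviation "S \<equiv> sub M"
abbreviation "cf \<equiv> config M"
abbreviation "dec x n \<equiv> decide M (config M x n)"
abbreviation "H \<equiv> halt_time M"

lemma S_ok: "substrate_ok S"
  using ok by (simp add: machine_ok_def)

lemma wlen_pos: "0 < wlen S"
  using S_ok by (simp add: substrate_ok_def)

lemma execution: "x \<in> inputs M \<Longrightarrow> execution_ok M x"
  using ok by (simp add: machine_ok_def)

definition body_at :: "input \<Rightarrow> nat \<Rightarrow> events" where
  "body_at x k = run_steps S x (cf x k) (body_steps (dec x k))"

definition rest_state :: "input \<Rightarrow> nat \<Rightarrow> state" where
  "rest_state x k = fold (exec S x) (body_steps (dec x k)) (cf x k)"

definition batch :: "input \<Rightarrow> nat \<Rightarrow> events" where
  "batch x k = run_steps S x (cf x k) (decision_steps (dec x k))"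

definition events_from :: "input \<Rightarrow> nat \<Rightarrow> events" where
  "events_from x n = concat (map (batch x) [n..<Suc (H x)])"

definition stop :: "input \<Rightarrow> nat \<Rightarrow> nat" where
  "stop x n = (LEAST k. n \<le> k \<and> ending (dec x k) \<noteq> Go_on)"

definition body :: "input \<Rightarrow> nat \<Rightarrow> events" where
  "body x n = concat (map (body_at x) [n..<Suc (stop x n)])"

lemma trace_eq: "trace M x = events_from x 0"
  by (simp add: trace_def events_from_def batch_def[abs_def])

lemma batch_body:
  "batch x k = body_at x k @ (case ending (dec x k) of Rest d R \<Rightarrow> [(rest_state x k, Hold d R)] | _ \<Rightarrow> [])"
  by (simp add: batch_def body_at_def rest_state_def decision_steps_body run_steps_append split: ending.split)

lemma config_Suc:
  "cf x (Suc k) = (case ending (dec x k) of Rest d R \<Rightarrow> exec_hold S d R (rest_state x k) | _ \<Rightarrow> rest_state x k)"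
  by (simp add: rest_state_def decision_steps_body split: ending.split)

lemma halt_time:
  assumes "x \<in> inputs M"
  shows "ending (dec x (H x)) = Halt" "k < H x \<Longrightarrow> ending (dec x k) \<noteq> Halt"
proof -
  have "\<exists>n. ending (dec x n) = Halt" using execution[OF assms] by (simp add: execution_ok_def halts_def)
  then show "ending (dec x (H x)) = Halt" unfolding halt_time_def by (rule LeastI_ex)
  show "k < H x \<Longrightarrow> ending (dec x k) \<noteq> Halt" unfolding halt_time_def by (rule not_less_Least)
qed

lemma batch_trace: "k \<le> H x \<Longrightarrow> set (batch x k) \<subseteq> set (trace M x)"
proof -
  assume "k \<le> H x"
  then have "k \<in> set [0..<Suc (H x)]" by (simp del: upt_Suc)
  then show ?thesis unfolding trace_eq events_from_def set_concat set_map by blast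
qed

lemma stop:
  assumes "x \<in> inputs M" "n \<le> H x"
  shows "n \<le> stop x n" "stop x n \<le> H x" "ending (dec x (stop x n)) \<noteq> Go_on"
    "\<lbrakk>n \<le> k; k < stop x n\<rbrakk> \<Longrightarrow> ending (dec x k) = Go_on"
proof -
  let ?P = "\<lambda>k. n \<le> k \<and> ending (dec x k) \<noteq> Go_on"
  have P: "?P (H x)" using halt_time[OF assms(1)] assms(2) by simp
  have "?P (stop x n)" unfolding stop_def by (rule LeastI[of ?P, OF P])
  then show "n \<le> stop x n" "ending (dec x (stop x n)) \<noteq> Go_on" by simp_all
  show "stop x n \<le> H x" unfolding stop_def by (rule Least_le[of ?P, OF P])
  show "ending (dec x k) = Go_on" if "n \<le> k" "k < stop x n"
    using not_less_Least[of k ?P] that unfolding stop_def by blast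
qed

lemma stop_rest:
  assumes "x \<in> inputs M" "n \<le> H x" "stop x n < H x"
  obtains d R where "ending (dec x (stop x n)) = Rest d R"
  using stop(3)[OF assms(1,2)] halt_time(2)[OF assms(1,3)] by (cases "ending (dec x (stop x n))") auto

lemma body_no_hold: "e \<in> set (body x n) \<Longrightarrow> \<not> is_hold (snd e)"
proof -
  assume "e \<in> set (body x n)"
  then obtain k where "e \<in> set (body_at x k)" unfolding body_def by auto
  then have "snd e \<in> set (map snd (body_at x k))" by simp
  then show "\<not> is_hold (snd e)" unfolding body_at_def snd_run_steps by (rule body_steps_no_hold)
qed

lemma events_split:
  assumes "x \<in> inputs M" "n \<le> H x"
  shows "events_from x n = body x n @
    (case ending (dec x (stop x n)) of
       Rest d R \<Rightarrow> (rest_state x (stop x n), Hold d R) # events_from x (Suc (stop x n)) | _ \<Rightarrow> [])"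
proof -
  note st = stop[OF assms]
  have "[n..<Suc (H x)] = [n..<stop x n] @ stop x n # [Suc (stop x n)..<Suc (H x)]"
  proof -
    have "[n..<stop x n + (Suc (H x) - stop x n)] = [n..<stop x n] @ [stop x n..<stop x n + (Suc (H x) - stop x n)]"
      using st(1) by (rule upt_add_eq_append)
    moreover have "stop x n + (Suc (H x) - stop x n) = Suc (H x)" using st(2) by simp
    ultimately have "[n..<Suc (H x)] = [n..<stop x n] @ [stop x n..<Suc (H x)]" by (simp del: upt_Suc)
    moreover have "[stop x n..<Suc (H x)] = stop x n # [Suc (stop x n)..<Suc (H x)]"
      using st(2) by (intro upt_conv_Cons) simp
    ultimately show ?thesis by (simp del: upt_Suc)
  qed
  moreover have "concat (map (batch x) [n..<stop x n]) = concat (map (body_at x) [n..<stop x n])"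
    using st(4) by (intro arg_cong[of _ _ concat] map_cong refl) (simp add: batch_body)
  ultimately have "events_from x n = concat (map (body_at x) [n..<stop x n]) @ batch x (stop x n)
      @ events_from x (Suc (stop x n))"
    unfolding events_from_def by (simp del: upt_Suc)
  also have "\<dots> = body x n @ (case ending (dec x (stop x n)) of Rest d R \<Rightarrow>
      [(rest_state x (stop x n), Hold d R)] | _ \<Rightarrow> []) @ events_from x (Suc (stop x n))"
    using st(1) by (simp add: body_def batch_body)
  finally have e: "events_from x n = body x n @ (case ending (dec x (stop x n)) of Rest d R \<Rightarrow>
      [(rest_state x (stop x n), Hold d R)] | _ \<Rightarrow> []) @ events_from x (Suc (stop x n))" .
  show ?thesis
  proof (cases "stop x n < H x")
    case True
    then obtain d R where "ending (dec x (stop x n)) = Rest d R" using stop_rest[OF assms] by blast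
    then show ?thesis using e by simp
  next
    case False
    then have "stop x n = H x" using st by simp
    then show ?thesis using e halt_time[OF assms(1)] by (simp add: events_from_def)
  qed
qed

lemma rounds_split:
  assumes "x \<in> inputs M" "n \<le> H x"
  shows "rounds (events_from x n) = body x n #
      (if stop x n < H x then rounds (events_from x (Suc (stop x n))) else [])"
    "holds (events_from x n) = (case ending (dec x (stop x n)) of
       Rest d R \<Rightarrow> (rest_state x (stop x n), d, R) # holds (events_from x (Suc (stop x n))) | _ \<Rightarrow> [])"
proof -
  have nh: "\<forall>e\<in>set (body x n). \<not> is_hold (snd e)" using body_no_hold by blast
  show "rounds (events_from x n) = body x n #
      (if stop x n < H x then rounds (events_from x (Suc (stop x n))) else [])"
  proof (cases "stop x n < H x")
    case True
    then obtain d R where "ending (dec x (stop x n)) = Rest d R" using stop_rest[OF assms] by blast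
    then show ?thesis
      using rounds_append_hold[OF nh, of "(rest_state x (stop x n), Hold d R)"] True
      by (simp add: events_split[OF assms])
  next
    case False
    then have "stop x n = H x" using stop(2)[OF assms] by simp
    then show ?thesis using halt_time(1)[OF assms(1)] rounds_no_hold[OF nh]
      by (simp add: events_split[OF assms])
  qed
  show "holds (events_from x n) = (case ending (dec x (stop x n)) of
       Rest d R \<Rightarrow> (rest_state x (stop x n), d, R) # holds (events_from x (Suc (stop x n))) | _ \<Rightarrow> [])"
    unfolding events_split[OF assms]
    by (simp add: holds_append holds_no_hold[OF nh] holds_Cons_hold holds_no_hold[of "[]"] split: ending.split)
qed

definition nrounds :: "input \<Rightarrow> nat" where
  "nrounds x = length (rounds (trace M x))"

text \<open>Number of the batch that opens round t. Past the last round the iteration leaves the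
  execution and its values mean nothing, hence the guards \<open>t < nrounds x\<close>.\<close>

definition start :: "input \<Rightarrow> nat \<Rightarrow> nat" where
  "start x t = ((\<lambda>n. Suc (stop x n)) ^^ t) 0"

definition round_state :: "input \<Rightarrow> nat \<Rightarrow> state" where
  "round_state x t = cf x (start x t)"

lemma start_0 [simp]: "start x 0 = 0"
  and start_Suc: "start x (Suc t) = Suc (stop x (start x t))"
  by (simp_all add: start_def)

lemma nrounds_pos: "0 < nrounds x"
  by (simp add: nrounds_def)

lemma length_mholds: "nrounds x = Suc (length (mholds M x))"
  by (simp add: nrounds_def mholds_def length_rounds)

text \<open>Rounds and holds are removed from the front together, so one index t counts the rounds,
  the holds and the batches that open rounds.\<close>

lemma start:
  assumes "x \<in> inputs M" "t < nrounds x"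
  shows "start x t \<le> H x \<and> drop t (rounds (trace M x)) = rounds (events_from x (start x t)) \<and>
    drop t (mholds M x) = holds (events_from x (start x t))"
  using assms(2)
proof (induction t)
  case 0
  then show ?case by (simp add: trace_eq mholds_def)
next
  case (Suc t)
  let ?n = "start x t"
  have IH: "?n \<le> H x" "drop t (rounds (trace M x)) = rounds (events_from x ?n)"
    "drop t (mholds M x) = holds (events_from x ?n)" using Suc by auto
  have dS: "drop (Suc t) xs = tl (drop t xs)" for xs :: "'b list" by (simp add: drop_Suc tl_drop)
  note sp = rounds_split[OF assms(1) IH(1)]
  have "drop (Suc t) (rounds (trace M x)) \<noteq> []" using Suc.prems by (simp add: nrounds_def)
  then have lt: "stop x ?n < H x" using sp(1) IH(2) dS[of "rounds (trace M x)"] by (auto split: if_splits)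
  then obtain d R where "ending (dec x (stop x ?n)) = Rest d R" using stop_rest[OF assms(1) IH(1)] by blast
  then show ?case using lt sp IH dS[of "rounds (trace M x)"] dS[of "mholds M x"] by (simp add: start_Suc)
qed

lemma start_le: "\<lbrakk>x \<in> inputs M; t < nrounds x\<rbrakk> \<Longrightarrow> start x t \<le> H x"
  using start by blast

lemma mround_body:
  assumes "x \<in> inputs M" "t < nrounds x"
  shows "mround M x t = body x (start x t)"
proof -
  have "mround M x t = hd (drop t (rounds (trace M x)))"
    using assms(2) by (simp add: mround_def nrounds_def hd_drop_conv_nth)
  then show ?thesis using start[OF assms] rounds_split(1)[OF assms(1) start_le[OF assms]] by simp
qed

lemma mround_in: "t < nrounds x \<Longrightarrow> mround M x t \<in> set (rounds (trace M x))"
  by (simp add: mround_def nrounds_def)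

lemma Suc_less_nrounds:
  assumes "x \<in> inputs M" "t < nrounds x"
  shows "Suc t < nrounds x \<longleftrightarrow> stop x (start x t) < H x"
proof -
  have "Suc t < nrounds x \<longleftrightarrow> tl (drop t (rounds (trace M x))) \<noteq> []"
    by (auto simp: nrounds_def tl_drop simp flip: drop_Suc)
  also have "\<dots> \<longleftrightarrow> stop x (start x t) < H x"
    using start[OF assms] rounds_split(1)[OF assms(1) start_le[OF assms]] by simp
  finally show ?thesis .
qed

lemma hold_after:
  assumes "x \<in> inputs M" "Suc t < nrounds x"
  obtains d R where "mholds M x ! t = (rest_state x (stop x (start x t)), d, R)"
    "ending (dec x (stop x (start x t))) = Rest d R"
    "round_state x (Suc t) = exec_hold S d R (rest_state x (stop x (start x t)))"
    "(rest_state x (stop x (start x t)), Hold d R) \<in> set (trace M x)"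
proof -
  let ?n = "start x t"
  have t: "t < nrounds x" using assms by simp
  note n = start_le[OF assms(1) t]
  have lt: "stop x ?n < H x" using Suc_less_nrounds[OF assms(1) t] assms by simp
  then obtain d R where e: "ending (dec x (stop x ?n)) = Rest d R" using stop_rest[OF assms(1) n] by blast
  have "mholds M x ! t = hd (drop t (mholds M x))"
    using assms(2) by (simp add: length_mholds hd_drop_conv_nth)
  then have 1: "mholds M x ! t = (rest_state x (stop x ?n), d, R)"
    using start[OF assms(1) t] rounds_split(2)[OF assms(1) n] e by simp
  have 2: "round_state x (Suc t) = exec_hold S d R (rest_state x (stop x ?n))"
    by (simp add: round_state_def start_Suc config_Suc e del: config.simps)
  have "(rest_state x (stop x ?n), Hold d R) \<in> set (batch x (stop x ?n))" by (simp add: batch_body e)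
  moreover have "set (batch x (stop x ?n)) \<subseteq> set (trace M x)"
    using lt batch_trace by simp
  ultimately show thesis using that 1 2 e by blast
qed

lemma body_at_trace: "k \<le> H x \<Longrightarrow> set (body_at x k) \<subseteq> set (trace M x)"
  using batch_trace by (fastforce simp: batch_body)

lemma trace_step_ok: "\<lbrakk>x \<in> inputs M; e \<in> set (trace M x)\<rbrakk> \<Longrightarrow> step_ok S (nwords M) x e"
  using execution by (simp add: execution_ok_def)

lemma valid_initial: "valid_state S (nwords M) (initial M)"
  using ok by (auto simp: valid_state_def initial_def live_def machine_ok_def)

lemma valid_config:
  assumes "x \<in> inputs M" "k \<le> Suc (H x)"
  shows "valid_state S (nwords M) (cf x k)"
  using assms(2)
proof (induction k)
  case (Suc k)
  then have "set (batch x k) \<subseteq> set (trace M x)" using batch_trace by simp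
  then have "\<forall>e\<in>set (batch x k). step_ok S (nwords M) x e" using trace_step_ok[OF assms(1)] by blast
  then show ?case using valid_state_run[OF S_ok] Suc by (simp add: batch_def)
qed (simp add: valid_initial)

lemma valid_trace:
  assumes "x \<in> inputs M" "e \<in> set (trace M x)"
  shows "valid_state S (nwords M) (fst e)"
proof -
  obtain k where k: "k \<le> H x" "e \<in> set (batch x k)"
    using assms(2) unfolding trace_eq events_from_def set_concat set_map set_upt by (auto simp: less_Suc_eq_le)
  then have "set (batch x k) \<subseteq> set (trace M x)" using batch_trace by simp
  then have "\<forall>e\<in>set (batch x k). step_ok S (nwords M) x e" using trace_step_ok[OF assms(1)] by blast
  then show ?thesis using valid_state_run[OF S_ok valid_config[OF assms(1)], of k] k by (simp add: batch_def)
qed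

text \<open>All batches of a round but the last go on, so its configurations are joined by steps
  without hold.\<close>

lemma body_run:
  assumes "x \<in> inputs M" "n \<le> H x" "n \<le> k" "k \<le> stop x n"
  shows "concat (map (body_at x) [n..<k]) = run_steps S x (cf x n) (concat (map (\<lambda>k. body_steps (dec x k)) [n..<k]))
    \<and> cf x k = fold (exec S x) (concat (map (\<lambda>k. body_steps (dec x k)) [n..<k])) (cf x n)"
  using assms(3,4)
proof (induction rule: dec_induct)
  case (step k)
  have "k < stop x n" using step.prems by simp
  then have "ending (dec x k) = Go_on" using stop(4)[OF assms(1,2)] step.hyps by blast
  then have "cf x (Suc k) = rest_state x k" by (simp add: config_Suc del: config.simps)
  then show ?case using step
    by (simp add: run_steps_append body_at_def rest_state_def del: config.simps)
qed simp

lemma body_run_steps: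
  assumes "x \<in> inputs M" "n \<le> H x"
  obtains as where "body x n = run_steps S x (cf x n) as" "rest_state x (stop x n) = fold (exec S x) as (cf x n)"
proof -
  let ?m = "stop x n"
  note st = stop[OF assms]
  have *: "[n..<Suc ?m] = [n..<?m] @ [?m]" using st by simp
  show thesis
    using that[of "concat (map (\<lambda>k. body_steps (dec x k)) [n..<Suc ?m])"] body_run[OF assms st(1)]
    unfolding body_def * by (simp add: run_steps_append body_at_def rest_state_def)
qed

lemma kept_config:
  assumes "x \<in> inputs M" "n \<le> H x" "n \<le> k" "k \<le> stop x n"
  shows "kept (cf x n) (cf x k)"
  using body_run[OF assms] kept_fold[of "cf x n" "cf x n"] body_steps_no_hold by auto

text \<open>The state that opens a later round differs from the last state of the hold before it
  only in its clock. What is assumed of states during holds thus applies to it; round 0 follows no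
  hold.\<close>

lemma reached_round_state:
  assumes "x \<in> inputs M" "0 < t" "t < nrounds x"
  obtains \<tau> where "\<tau> \<in> hold_states M x" "held (round_state x t) = held \<tau>"
proof -
  obtain t' where t': "t = Suc t'" using assms(2) gr0_implies_Suc by blast
  obtain d R \<sigma> where h: "mholds M x ! t' = (\<sigma>, d, R)" "round_state x t = exec_hold S d R \<sigma>"
    using hold_after[OF assms(1)] assms(3) t' by metis
  then have "(\<sigma>, d, R) \<in> set (mholds M x)" using assms(3) t'
    by (metis Suc_less_eq length_mholds nth_mem)
  moreover have "(convey S R ^^ nat \<lfloor>d\<rfloor>) \<sigma> \<in> during_hold S d R \<sigma>" by (auto simp: during_hold_def)
  ultimately have "(convey S R ^^ nat \<lfloor>d\<rfloor>) \<sigma> \<in> hold_states M x" unfolding hold_states_def by blast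
  moreover have "held (round_state x t) = held ((convey S R ^^ nat \<lfloor>d\<rfloor>) \<sigma>)" using h by (simp add: exec_hold_def)
  ultimately show thesis by (rule that)
qed

section \<open>Comparing rounds of two inputs\<close>

definition alike :: "input \<Rightarrow> nat \<Rightarrow> input \<Rightarrow> nat \<Rightarrow> bool" where
  "alike x t y t' \<longleftrightarrow> computed (round_state x t) = computed (round_state y t') \<and>
     raw_source (round_state x t) = raw_source (round_state y t')"

lemma round_state_0 [simp]: "round_state x 0 = initial M"
  by (simp add: round_state_def)

lemma alike_0: "alike x 0 y 0"
  by (simp add: alike_def)

text \<open>Self-description yields the computed cells, the determined layout the places of raw
  words; this is the only use of either. The numbers t and t' may differ, since inputs can reach the
  same string after different numbers of rounds.\<close>

lemma alikeI:
  assumes "x \<in> inputs M" "y \<in> inputs M" "0 < t" "t < nrounds x" "0 < t'" "t' < nrounds y"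
    and "comp_string S (round_state x t) = comp_string S (round_state y t')"
  shows "alike x t y t'"
proof -
  obtain \<tau> where \<tau>: "\<tau> \<in> hold_states M x" "held (round_state x t) = held \<tau>"
    using reached_round_state assms by blast
  obtain \<rho> where \<rho>: "\<rho> \<in> hold_states M y" "held (round_state y t') = held \<rho>"
    using reached_round_state assms by blast
  have cs: "comp_string S \<tau> = comp_string S \<rho>"
    using assms(7) computed_held_cong[OF \<tau>(2)] computed_held_cong[OF \<rho>(2)] by (simp add: comp_string_def)
  have "\<tau> \<in> reached M x" "\<rho> \<in> reached M y" using \<tau> \<rho> by (simp_all add: reached_def)
  moreover have "self_describing M" using ok by (simp add: machine_ok_def)
  ultimately have "computed \<tau> = computed \<rho>" using cs assms(1,2) unfolding self_describing_def by blast
  moreover have "layout_determined M" using ok by (simp add: machine_ok_def)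
  then obtain layout where "\<forall>x\<in>inputs M. \<forall>\<sigma>\<in>hold_states M x.
      (live \<sigma>, raw_source \<sigma>) = layout (comp_string S \<sigma>)" unfolding layout_determined_def by blast
  then have "raw_source \<tau> = raw_source \<rho>" using cs assms(1,2) \<tau>(1) \<rho>(1) by (metis snd_conv)
  ultimately show ?thesis unfolding alike_def
    by (simp add: computed_held_cong[OF \<tau>(2)] computed_held_cong[OF \<rho>(2)]
        raw_source_held_cong[OF \<tau>(2)] raw_source_held_cong[OF \<rho>(2)])
qed

lemma hold_ok_after:
  assumes "x \<in> inputs M" "(\<sigma>, Hold d R) \<in> set (trace M x)"
  shows "hold_ok S d R"
  using trace_step_ok[OF assms] by simp

text \<open>Wholeness is known when a hold begins and survives the conveyors; the initial state has
  no raw cells at all.\<close>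

lemma whole_round_state:
  assumes "x \<in> inputs M" "t < nrounds x"
  shows "whole_raw_words S (round_state x t)"
proof (cases t)
  case 0
  then show ?thesis
    by (simp add: whole_raw_words_def raw_source_def initial_def split: option.splits content.splits)
next
  case (Suc t')
  obtain d R \<sigma> where h: "mholds M x ! t' = (\<sigma>, d, R)" "round_state x t = exec_hold S d R \<sigma>"
    "(\<sigma>, Hold d R) \<in> set (trace M x)"
    using hold_after[OF assms(1)] assms(2) Suc by metis
  then have "(\<sigma>, d, R) \<in> set (mholds M x)" using assms Suc
    by (metis Suc_less_eq length_mholds nth_mem)
  then have "whole_raw_words S \<sigma>" using execution[OF assms(1)] by (auto simp: execution_ok_def)
  then show ?thesis using exec_hold_props(1)[OF S_ok hold_ok_after[OF assms(1) h(3)]] h(2) by simp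
qed

lemma input_word:
  assumes "x \<in> inputs M" "i < nwords M"
  shows "length (x ! i) = wlen S"
  using assms by (auto simp: inputs_def)

text \<open>Raw cells form whole aligned words, so the first cell of a word decides whether the word
  is raw. If so, its value is an entire input word; otherwise it is a function of the computed
  cells.\<close>

lemma fire_reads:
  assumes x: "x \<in> inputs M" "t < nrounds x" and \<mu>: "kept (round_state x t) \<mu>" "fire_ok S x g \<mu>"
    and s: "s \<in> set (reads g)"
  defines "l \<equiv> fire_level S g"
  shows "raw_word S \<mu> l s \<longleftrightarrow> raw_source (round_state x t) (l, s) \<noteq> None" (is ?A)
    "word_value S x \<mu> l s = (case raw_source (round_state x t) (l, s) of Some i \<Rightarrow> x ! i
       | None \<Rightarrow> map (\<lambda>b. the (computed (round_state x t) (l, s + b))) [0..<wlen S])" (is ?B)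
proof -
  let ?\<sigma> = "round_state x t"
  have lat: "0 < latency S 0" using S_ok by (simp add: substrate_ok_def)
  have s': "s \<in> wstarts S l" "\<forall>b<wlen S. (l, s + b) \<in> live \<mu> \<and> since \<mu> (l, s + b) + latency S 0 \<le> now \<mu>"
    and st: "station g \<in> stations S" using \<mu>(2) s unfolding fire_ok_def l_def by blast+
  have l: "l \<le> maxlev S" using st S_ok by (simp add: l_def fire_level_def substrate_ok_def)
  have held: "held \<mu> (l, s + b) = held ?\<sigma> (l, s + b) \<and> held ?\<sigma> (l, s + b) \<noteq> None" if "b < wlen S" for b
  proof -
    have "held \<mu> (l, s + b) \<noteq> None" "since \<mu> (l, s + b) \<noteq> now \<mu>" using s'(2) lat that by (auto simp: live_def)
    \<comment> \<open>Of the three cases of \<open>kept\<close> only the first, unchanged, fits a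
      live cell whose stamp is older than the present by a positive latency.\<close>
    then show ?thesis using \<mu>(1) unfolding kept_def by metis
  qed
  have rw: "raw_word S \<mu> l s = raw_word S ?\<sigma> l s" using held by (simp add: raw_word_def)
  note whole = whole_raw_wordsD[OF S_ok whole_round_state[OF x] l s'(1)]
  have "?A \<and> ?B"
  proof (cases "raw_source ?\<sigma> (l, s)")
    case None
    have nr: "raw_source ?\<sigma> (l, s + b) = None" if b: "b < wlen S" for b
    proof (rule ccontr)
      assume "raw_source ?\<sigma> (l, s + b) \<noteq> None"
      then obtain i where "\<forall>b<wlen S. held ?\<sigma> (l, s + b) = Some (Raw i b)"
        using whole[OF b] by (auto simp: raw_word_def)
      then have "held ?\<sigma> (l, s + 0) = Some (Raw i 0)" using wlen_pos by blast
      then show False using None by (simp add: raw_source_def)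
    qed
    have "cell_value x \<mu> (l, s + b) = the (computed ?\<sigma> (l, s + b))" if "b < wlen S" for b
      using held[OF that] nr[OF that]
      by (auto simp: cell_value_def computed_def raw_source_def split: option.splits content.splits)
    then have ?B using None by (simp add: word_value_def)
    moreover have "\<not> raw_word S ?\<sigma> l s"
    proof
      assume "raw_word S ?\<sigma> l s"
      then obtain i where "held ?\<sigma> (l, s + 0) = Some (Raw i 0)" using wlen_pos unfolding raw_word_def by blast
      then show False using None by (simp add: raw_source_def)
    qed
    ultimately show ?thesis using rw None by simp
  next
    case (Some i)
    then have r: "raw_word S ?\<sigma> l s" using whole[of 0] wlen_pos by simp
    then obtain j where j: "\<forall>b<wlen S. held ?\<sigma> (l, s + b) = Some (Raw j b)" by (auto simp: raw_word_def)
    then have j0: "held ?\<sigma> (l, s + 0) = Some (Raw j 0)" using wlen_pos by blast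
    then have "i = j" using Some by (simp add: raw_source_def)
    have "valid_state S (nwords M) ?\<sigma>"
      using valid_config[OF x(1), of "start x t"] start_le[OF x] by (simp add: round_state_def)
    then have "i < nwords M" using j0 unfolding \<open>i = j\<close> valid_state_def by blast
    then have "length (x ! i) = wlen S" using input_word x by blast
    moreover have "word_value S x \<mu> l s = map ((!) (x ! i)) [0..<wlen S]"
      using held j \<open>i = j\<close> by (simp add: word_value_def cell_value_def)
    ultimately have "word_value S x \<mu> l s = x ! i" by (metis map_nth)
    then show ?thesis using r rw Some by simp
  qed
  then show ?A ?B by blast+
qed

lemma body_at_split:
  "body_at x k = run_steps S x (cf x k) (map Move (moves (dec x k))) @
     (case firing (dec x k) of None \<Rightarrow> []
      | Some g \<Rightarrow> [(fold (exec S x) (map Move (moves (dec x k))) (cf x k), Fire g)])"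
  by (simp add: body_at_def body_steps_def run_steps_append split: option.split)

lemma mid_fire:
  assumes x: "x \<in> inputs M" "t < nrounds x" and k: "start x t \<le> k" "k \<le> stop x (start x t)"
    and g: "firing (dec x k) = Some g"
  defines "\<mu> \<equiv> fold (exec S x) (map Move (moves (dec x k))) (cf x k)"
  shows "kept (round_state x t) \<mu>" "fire_ok S x g \<mu>"
proof -
  note n = start_le[OF x]
  show "kept (round_state x t) \<mu>" unfolding \<mu>_def round_state_def
    by (rule kept_fold) (use kept_config[OF x(1) n k] in auto)
  have "(\<mu>, Fire g) \<in> set (body_at x k)" by (simp add: body_at_split g \<mu>_def)
  moreover have "k \<le> H x" using k stop(2)[OF x(1) n] by simp
  ultimately have "(\<mu>, Fire g) \<in> set (trace M x)" using body_at_trace by blast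
  then show "fire_ok S x g \<mu>" using trace_step_ok[OF x(1)] by fastforce
qed

definition answer :: "input \<Rightarrow> nat \<Rightarrow> cell \<Rightarrow> bool list" where
  "answer x t p = x ! the (raw_source (round_state x t) p)"

text \<open>By latency, the raw words that a fire finds in its current state are those of
  \<open>places\<close>, with the contents they had when the round started.\<close>

lemma raw_reads_body_at:
  assumes x: "x \<in> inputs M" "t < nrounds x" and k: "start x t \<le> k" "k \<le> stop x (start x t)"
  shows "concat (map (raw_reads S x) (body_at x k)) =
    map (\<lambda>p. (p, answer x t p)) (places M (raw_source (round_state x t)) (computed (cf x k)))"
proof (cases "firing (dec x k)")
  case None
  then have "firing (control M (computed (cf x k))) = None" by (simp add: decide_def)
  then show ?thesis
    by (simp add: body_at_split None run_steps_moves_no_read places_def)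
next
  case (Some g)
  then have g: "firing (control M (computed (cf x k))) = Some g" by (simp add: decide_def)
  let ?\<mu> = "fold (exec S x) (map Move (moves (dec x k))) (cf x k)" and ?l = "fire_level S g"
  note fr = fire_reads[OF x mid_fire[OF x k Some]]
  have f: "filter (raw_word S ?\<mu> ?l) (reads g) = filter (\<lambda>s. raw_source (round_state x t) (?l, s) \<noteq> None) (reads g)"
    by (rule filter_cong[OF refl]) (rule fr(1))
  have "word_value S x ?\<mu> ?l s = answer x t (?l, s)"
    if "s \<in> set (reads g)" "raw_source (round_state x t) (?l, s) \<noteq> None" for s
    using fr(2)[OF that(1)] that(2) by (auto simp: answer_def)
  then show ?thesis
    by (simp add: body_at_split Some run_steps_moves_no_read places_def g Let_def f)
qed

text \<open>The control sees computed cells only, so both inputs take the same decision, and the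
  moves keep the computed cells equal. The inputs can part only through the argument of the fire,
  whose raw words have the same sources and, by assumption, the same contents.\<close>

lemma batch_alike:
  assumes x: "x \<in> inputs M" "t < nrounds x" and k: "start x t \<le> k" "k \<le> stop x (start x t)"
    and y: "y \<in> inputs M" "t' < nrounds y" and k': "start y t' \<le> k'" "k' \<le> stop y (start y t')"
    and alike: "alike x t y t'" and comp: "computed (cf x k) = computed (cf y k')"
    and ans: "\<forall>p\<in>set (places M (raw_source (round_state x t)) (computed (cf x k))). answer x t p = answer y t' p"
  shows "computed (cf x (Suc k)) = computed (cf y (Suc k'))"
    "map projected (body_at x k) = map projected (body_at y k')"
proof -
  have dec: "dec x k = dec y k'" using comp by (simp add: decide_def)
  let ?ms = "map Move (moves (dec x k))"
  let ?\<mu> = "fold (exec S x) ?ms (cf x k)" and ?\<nu> = "fold (exec S y) ?ms (cf y k')"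
  note pm = projected_moves[OF comp, of S x "moves (dec x k)" y]
  have arg: "fire_arg S x g ?\<mu> = fire_arg S y g ?\<nu>" if g: "firing (dec x k) = Some g" for g
    unfolding fire_arg_def
  proof (rule map_cong[OF refl])
    fix s assume s: "s \<in> set (reads g)"
    let ?l = "fire_level S g"
    have gc: "firing (control M (computed (cf x k))) = Some g" using g by (simp add: decide_def)
    have g': "firing (dec y k') = Some g" using g dec by simp
    note fx = fire_reads(2)[OF x mid_fire[OF x k g] s]
    note fy = fire_reads(2)[OF y mid_fire[OF y k' g'] s]
    have fy': "word_value S y ?\<nu> ?l s = (case raw_source (round_state y t') (?l, s) of Some i \<Rightarrow> y ! i
       | None \<Rightarrow> map (\<lambda>b. the (computed (round_state y t') (?l, s + b))) [0..<wlen S])"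
      using fy unfolding dec .
    show "word_value S x ?\<mu> ?l s = word_value S y ?\<nu> ?l s"
    proof (cases "raw_source (round_state x t) (?l, s)")
      case None
      then show ?thesis using fx fy' alike by (simp add: alike_def)
    next
      case (Some i)
      then have "(?l, s) \<in> set (places M (raw_source (round_state x t)) (computed (cf x k)))"
        using s gc by (simp add: places_def)
      then have "x ! i = y ! i" using ans Some alike by (auto simp: answer_def alike_def)
      then show ?thesis using fx fy' alike Some by (simp add: alike_def)
    qed
  qed
  have "computed (rest_state x k) = computed (rest_state y k')"
  proof (cases "firing (dec x k)")
    case None
    then show ?thesis using pm(2) dec by (simp add: rest_state_def body_steps_def)
  next
    case (Some g)
    then show ?thesis using computed_exec_fire[OF pm(2) arg[OF Some]] dec
      by (simp add: rest_state_def body_steps_def)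
  qed
  then show "computed (cf x (Suc k)) = computed (cf y (Suc k'))"
    unfolding config_Suc dec by (auto split: ending.split intro: computed_exec_hold)
  show "map projected (body_at x k) = map projected (body_at y k')"
    using pm unfolding body_at_split dec by (cases "firing (dec y k')") simp_all
qed

text \<open>The list that \<open>lockstep\<close> works on, one element per batch of the round, so
  that its length also records when the round ends.\<close>

definition control_states :: "input \<Rightarrow> nat \<Rightarrow> (cell \<Rightarrow> bool option) list" where
  "control_states x t = map (\<lambda>k. computed (cf x k)) [start x t..<Suc (stop x (start x t))]"

definition read_places :: "input \<Rightarrow> nat \<Rightarrow> cell list" where
  "read_places x t = concat (map (places M (raw_source (round_state x t))) (control_states x t))"

definition asked :: "input \<Rightarrow> nat \<Rightarrow> cell list" where
  "asked x t = keep_first (read_places x t)"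

lemma raw_reads_mround:
  assumes "x \<in> inputs M" "t < nrounds x"
  shows "concat (map (raw_reads S x) (mround M x t)) = map (\<lambda>p. (p, answer x t p)) (read_places x t)"
proof -
  let ?n = "start x t"
  have "concat (map (raw_reads S x) (concat (map (body_at x) ks)))
      = map (\<lambda>p. (p, answer x t p)) (concat (map (\<lambda>k. places M (raw_source (round_state x t)) (computed (cf x k))) ks))"
    if "set ks \<subseteq> {?n..stop x ?n}" for ks
    using that by (induction ks) (simp_all add: raw_reads_body_at[OF assms])
  from this[of "[?n..<Suc (stop x ?n)]"] show ?thesis
    unfolding mround_body[OF assms] body_def read_places_def control_states_def
    by (simp add: comp_def atLeastLessThanSuc_atLeastAtMost del: upt_Suc)
qed

lemma querying_mround:
  assumes "x \<in> inputs M" "t < nrounds x"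
  shows "querying S x (mround M x t) \<longleftrightarrow> read_places x t \<noteq> []"
proof -
  have "querying S x (mround M x t) \<longleftrightarrow> concat (map (raw_reads S x) (mround M x t)) \<noteq> []"
    by (auto simp: querying_def)
  then show ?thesis by (simp add: raw_reads_mround[OF assms])
qed

lemma answers_mround:
  assumes "x \<in> inputs M" "t < nrounds x"
  shows "answers S x (mround M x t) = map (answer x t) (asked x t)"
proof -
  have "inj (\<lambda>p. (p, answer x t p))" by (rule injI) simp
  then show ?thesis
    by (simp add: answers_def asked_def raw_reads_mround[OF assms] keep_first_map_inj comp_def)
qed

lemma asked_raw:
  assumes "x \<in> inputs M" "t < nrounds x" "p \<in> set (asked x t)"
  obtains i where "raw_source (round_state x t) p = Some i" "i < nwords M" "answer x t p = x ! i"
    "length (x ! i) = wlen S"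
proof -
  have "raw_source (round_state x t) p \<noteq> None"
    using assms(3) by (auto simp: asked_def read_places_def places_def split: option.splits)
  then obtain i where i: "raw_source (round_state x t) p = Some i" by blast
  then obtain b where "held (round_state x t) p = Some (Raw i b)"
    by (auto simp: raw_source_def split: option.splits content.splits)
  moreover have "valid_state S (nwords M) (round_state x t)"
    using valid_config[OF assms(1), of "start x t"] start_le[OF assms(1,2)] by (simp add: round_state_def)
  ultimately have "i < nwords M" unfolding valid_state_def by blast
  then show thesis using that i input_word[OF assms(1)] by (simp add: answer_def)
qed

lemma control_states_nth:
  assumes "x \<in> inputs M" "t < nrounds x"
  shows "length (control_states x t) = Suc (stop x (start x t) - start x t)"
    "m < length (control_states x t) \<Longrightarrow> control_states x t ! m = computed (cf x (start x t + m))"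
proof -
  have "start x t \<le> stop x (start x t)" using stop(1)[OF assms(1) start_le[OF assms]] .
  then show "length (control_states x t) = Suc (stop x (start x t) - start x t)"
    by (simp add: control_states_def del: upt_Suc)
  then show "m < length (control_states x t) \<Longrightarrow> control_states x t ! m = computed (cf x (start x t + m))"
    by (simp add: control_states_def nth_map del: upt_Suc)
qed

text \<open>Supplies the part of the \<open>lockstep\<close> rule about lengths: equal control
  states agree on whether the round goes on.\<close>

lemma Go_on_iff:
  assumes "x \<in> inputs M" "t < nrounds x" "m < length (control_states x t)"
  shows "ending (dec x (start x t + m)) = Go_on \<longleftrightarrow> Suc m < length (control_states x t)"
proof -
  note st = stop[OF assms(1) start_le[OF assms(1,2)]]
  note len = control_states_nth(1)[OF assms(1,2)]
  show ?thesis
  proof (cases "start x t + m < stop x (start x t)")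
    case True
    then show ?thesis using st(4)[of "start x t + m"] len by simp
  next
    case False
    then have "start x t + m = stop x (start x t)" using assms(3) len st(1) by simp
    then show ?thesis using st(3) len by simp
  qed
qed

text \<open>A single rule serves both rounds because alike rounds have the same raw layout; the
  values are the contents that each input has at these places.\<close>

lemma lockstep_rounds:
  assumes x: "x \<in> inputs M" "t < nrounds x" and y: "y \<in> inputs M" "t' < nrounds y"
    and alike: "alike x t y t'"
  shows "lockstep (control_states x t) (control_states y t') (places M (raw_source (round_state x t)))
    (answer x t) (answer y t')"
proof
  note lx = control_states_nth[OF x] and ly = control_states_nth[OF y]
  show "control_states x t \<noteq> []" "control_states y t' \<noteq> []" using lx(1) ly(1) by auto
  then show "control_states x t ! 0 = control_states y t' ! 0"
    using lx(2)[of 0] ly(2)[of 0] alike by (simp add: alike_def round_state_def)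
  fix m
  let ?k = "start x t + m" and ?k' = "start y t' + m"
  assume m: "m < length (control_states x t)" "m < length (control_states y t')"
    and eq: "control_states x t ! m = control_states y t' ! m"
    and ans: "\<forall>p\<in>set (places M (raw_source (round_state x t)) (control_states x t ! m)). answer x t p = answer y t' p"
  have comp: "computed (cf x ?k) = computed (cf y ?k')" using eq lx(2)[OF m(1)] ly(2)[OF m(2)] by simp
  then have "dec x ?k = dec y ?k'" by (simp add: decide_def)
  then have len: "Suc m < length (control_states x t) \<longleftrightarrow> Suc m < length (control_states y t')"
    using Go_on_iff[OF x m(1)] Go_on_iff[OF y m(2)] by simp
  have k: "start x t \<le> ?k" "?k \<le> stop x (start x t)" "start y t' \<le> ?k'" "?k' \<le> stop y (start y t')"
    using m lx(1) ly(1) stop(1)[OF x(1) start_le[OF x]] stop(1)[OF y(1) start_le[OF y]] by simp_all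
  have "computed (cf x (Suc ?k)) = computed (cf y (Suc ?k'))"
    using batch_alike(1)[OF x k(1,2) y k(3,4) alike comp] ans lx(2)[OF m(1)] by simp
  then show "(Suc m < length (control_states x t)) = (Suc m < length (control_states y t')) \<and>
      (Suc m < length (control_states x t) \<longrightarrow> control_states x t ! Suc m = control_states y t' ! Suc m)"
    using len lx(2)[of "Suc m"] ly(2)[of "Suc m"] by (simp del: config.simps)
qed

lemma next_asked:
  assumes "x \<in> inputs M" "t < nrounds x" "y \<in> inputs M" "t' < nrounds y" "alike x t y t'"
    and "map (answer x t) (take j (asked x t)) = map (answer y t') (take j (asked y t'))"
  shows "take (Suc j) (asked x t) = take (Suc j) (asked y t')"
proof -
  interpret lockstep "control_states x t" "control_states y t'" "places M (raw_source (round_state x t))"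
    "answer x t" "answer y t'" using lockstep_rounds assms by blast
  have "asked y t' = ready" "asked x t = readx"
    using assms(5) by (simp_all add: asked_def read_places_def alike_def)
  then show ?thesis using next_read_same[of j] assms(6) by simp
qed

text \<open>With all answers equal the two rounds agree batch by batch, including how they end. The
  places of raw words are not followed through the round; \<open>alikeI\<close> recovers them after
  the hold from the computed string.\<close>

lemma all_asked:
  assumes x: "x \<in> inputs M" "t < nrounds x" and y: "y \<in> inputs M" "t' < nrounds y"
    and alike: "alike x t y t'"
    and ans: "map (answer x t) (asked x t) = map (answer y t') (asked y t')"
  shows "map projected (mround M x t) = map projected (mround M y t') \<and>
    (Suc t < nrounds x \<longleftrightarrow> Suc t' < nrounds y) \<and> (Suc t < nrounds x \<longrightarrow> alike x (Suc t) y (Suc t'))"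
proof -
  interpret lockstep "control_states x t" "control_states y t'" "places M (raw_source (round_state x t))"
    "answer x t" "answer y t'" using lockstep_rounds assms by blast
  have "asked y t' = ready" "asked x t = readx"
    using alike by (simp_all add: asked_def read_places_def alike_def)
  then have same: "control_states x t = control_states y t'"
    and agree: "\<forall>p\<in>set (concat (map (places M (raw_source (round_state x t))) (control_states x t))).
      answer x t p = answer y t' p"
    using all_reads_same ans by simp_all
  let ?n = "start x t" and ?n' = "start y t'" and ?d = "stop x (start x t) - start x t"
  note lx = control_states_nth[OF x] and ly = control_states_nth[OF y]
  note stx = stop[OF x(1) start_le[OF x]] and sty = stop[OF y(1) start_le[OF y]]
  have d: "stop x ?n = ?n + ?d" "stop y ?n' = ?n' + ?d"
    using lx(1) ly(1) same stx(1) sty(1) by simp_all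
  have comp: "computed (cf x (?n + m)) = computed (cf y (?n' + m))" if "m \<le> ?d" for m
  proof -
    have "m < length (control_states x t)" "m < length (control_states y t')"
      using that lx(1) same by simp_all
    then show ?thesis using lx(2)[of m] ly(2)[of m] same by simp
  qed
  have step: "computed (cf x (Suc (?n + m))) = computed (cf y (Suc (?n' + m))) \<and>
      map projected (body_at x (?n + m)) = map projected (body_at y (?n' + m))" if m: "m \<le> ?d" for m
  proof -
    have lt: "m < length (control_states x t)" using m lx(1) by simp
    have "set (places M (raw_source (round_state x t)) (computed (cf x (?n + m))))
        \<subseteq> set (concat (map (places M (raw_source (round_state x t))) (control_states x t)))"
      using nth_mem[OF lt] lx(2)[OF lt] by auto
    then have a: "\<forall>p\<in>set (places M (raw_source (round_state x t)) (computed (cf x (?n + m)))).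
        answer x t p = answer y t' p" using agree by blast
    have k: "?n \<le> ?n + m" "?n + m \<le> stop x ?n" "?n' \<le> ?n' + m" "?n' + m \<le> stop y ?n'"
      using m d by simp_all
    show ?thesis using batch_alike[OF x k(1,2) y k(3,4) alike comp[OF m] a] by blast
  qed
  \<comment> \<open>The two rounds may start at different batch numbers, so batches are matched by
    their offset.\<close>
  have shift: "map f [a..<Suc (a + e)] = map (\<lambda>m. f (a + m)) [0..<Suc e]" for f :: "nat \<Rightarrow> 'z" and a e
    by (rule nth_equalityI) (simp_all del: upt_Suc)
  have cm: "map projected (concat (map f ks)) = concat (map (\<lambda>k. map projected (f k)) ks)" for f :: "nat \<Rightarrow> events" and ks
    by (simp add: map_concat comp_def)
  have "map projected (mround M x t) = concat (map (\<lambda>m. map projected (body_at x (?n + m))) [0..<Suc ?d])"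
    unfolding mround_body[OF x] body_def by (subst d(1), subst shift) (simp only: cm)
  moreover have "map projected (mround M y t') = concat (map (\<lambda>m. map projected (body_at y (?n' + m))) [0..<Suc ?d])"
    unfolding mround_body[OF y] body_def by (subst d(2), subst shift) (simp only: cm)
  moreover have "map (\<lambda>m. map projected (body_at x (?n + m))) [0..<Suc ?d]
      = map (\<lambda>m. map projected (body_at y (?n' + m))) [0..<Suc ?d]"
  proof (rule map_cong[OF refl])
    fix m assume "m \<in> set [0..<Suc ?d]"
    then have "m \<le> ?d" by (simp add: less_Suc_eq_le del: upt_Suc)
    then show "map projected (body_at x (?n + m)) = map projected (body_at y (?n' + m))" using step by blast
  qed
  ultimately have 1: "map projected (mround M x t) = map projected (mround M y t')" by metis
  have halt: "u < H z \<longleftrightarrow> ending (dec z u) \<noteq> Halt" if "z \<in> inputs M" "u \<le> H z" for z u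
    using halt_time[OF that(1)] that(2) by (metis le_neq_implies_less nat_less_le)
  have "dec x (stop x ?n) = dec y (stop y ?n')" using comp[of ?d] d by (simp add: decide_def)
  then have 2: "Suc t < nrounds x \<longleftrightarrow> Suc t' < nrounds y"
    using Suc_less_nrounds[OF x] Suc_less_nrounds[OF y] halt[OF x(1) stx(2)] halt[OF y(1) sty(2)] by simp
  have "computed (round_state x (Suc t)) = computed (round_state y (Suc t'))"
    using step[of ?d] d by (simp add: round_state_def start_Suc del: config.simps)
  then have "alike x (Suc t) y (Suc t')" if "Suc t < nrounds x"
    using that 2 by (intro alikeI[OF x(1) y(1)] comp_string_computed_cong) auto
  with 1 2 show ?thesis by blast
qed

section \<open>Rounds without queries\<close>

lemma read_places_eq_Nil_iff: "read_places x t = [] \<longleftrightarrow> asked x t = []"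
  by (metis asked_def set_empty set_keep_first)

text \<open>The program is computed, so no raw word is present when round 0 starts, and latency
  excludes words brought in during it. Hence every querying round follows a hold.\<close>

lemma read_places_0: "read_places x 0 = []"
proof -
  have "raw_source (initial M) = (\<lambda>_. None)" by (auto simp: raw_source_def initial_def split: option.splits content.splits)
  then have "places M (raw_source (round_state x 0)) e = []" for e by (simp add: places_def split: option.split)
  then show ?thesis by (simp add: read_places_def)
qed

text \<open>Round a is the first querying round from t on, or \<open>nrounds x\<close> if no such
  round is left.\<close>

definition gap :: "input \<Rightarrow> nat \<Rightarrow> nat \<Rightarrow> bool" where
  "gap x t a \<longleftrightarrow> t \<le> a \<and> a \<le> nrounds x \<and> (\<forall>u. t \<le> u \<and> u < a \<longrightarrow> read_places x u = []) \<and>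
     (a < nrounds x \<longrightarrow> read_places x a \<noteq> [])"

definition segment :: "input \<Rightarrow> nat \<Rightarrow> nat \<Rightarrow> events" where
  "segment x t a = concat (map (mround M x) [t..<a])"

lemma segment_Suc: "t < a \<Longrightarrow> segment x t a = mround M x t @ segment x (Suc t) a"
  by (simp add: segment_def upt_conv_Cons)

lemma segment_refl [simp]: "segment x t t = []"
  by (simp add: segment_def)

text \<open>By \<open>next_asked\<close> with j = 0, alike rounds either both query or both do not.
  Rounds without queries have equal, empty answer lists, so \<open>all_asked\<close> advances both
  executions together until both query or both have ended. The start t may already be past the last
  round, when a querying round was the last.\<close>

lemma gap_alike:
  assumes xy: "x \<in> inputs M" "y \<in> inputs M"
    and "gap x t a" "gap y t' b" "t < nrounds x \<longleftrightarrow> t' < nrounds y" "t < nrounds x \<Longrightarrow> alike x t y t'"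
  shows "map projected (segment x t a) = map projected (segment y t' b) \<and>
    (a < nrounds x \<longleftrightarrow> b < nrounds y) \<and> (a < nrounds x \<longrightarrow> alike x a y b)"
  using assms(3-6)
proof (induction "a - t" arbitrary: t t')
  case 0
  show ?case
  proof (cases "t < nrounds x")
    case False
    with 0 have "a = t" "b = t'" by (auto simp: gap_def)
    then show ?thesis using 0 False by simp
  next
    case True
    then have t: "t' < nrounds y" "alike x t y t'" "a = t" using 0 by (auto simp: gap_def)
    then have "take (Suc 0) (asked x t) = take (Suc 0) (asked y t')"
      using next_asked[OF xy(1) True xy(2) t(1,2), of 0] by simp
    then have "read_places y t' \<noteq> []" using 0(2) True t(3)
      by (auto simp: gap_def read_places_eq_Nil_iff)
    then have "b = t'" using 0(3) unfolding gap_def by (metis le_neq_implies_less order_refl)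
    then show ?thesis using t True by simp
  qed
next
  case (Suc n)
  then have ta: "t < a" "t < nrounds x" "read_places x t = []" by (auto simp: gap_def)
  then have t': "t' < nrounds y" "alike x t y t'" using Suc.prems by auto
  have "take (Suc 0) (asked x t) = take (Suc 0) (asked y t')"
    using next_asked[OF xy(1) ta(2) xy(2) t'(1,2), of 0] by simp
  then have ry: "read_places y t' = []" using ta(3) by (simp add: read_places_eq_Nil_iff)
  then have tb: "t' < b" using Suc.prems(2) t' unfolding gap_def by (metis le_neq_implies_less)
  note aa = all_asked[OF xy(1) ta(2) xy(2) t'(1,2)]
  have "asked x t = []" "asked y t' = []" using ta(3) ry by (simp_all add: read_places_eq_Nil_iff)
  then have step: "map projected (mround M x t) = map projected (mround M y t')"
    "Suc t < nrounds x \<longleftrightarrow> Suc t' < nrounds y" "Suc t < nrounds x \<longrightarrow> alike x (Suc t) y (Suc t')"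
    using aa by simp_all
  have "gap x (Suc t) a" "gap y (Suc t') b" using Suc.prems ta tb by (auto simp: gap_def)
  then have "map projected (segment x (Suc t) a) = map projected (segment y (Suc t') b) \<and>
    (a < nrounds x \<longleftrightarrow> b < nrounds y) \<and> (a < nrounds x \<longrightarrow> alike x a y b)"
    using Suc.hyps step by (intro Suc.hyps(1)) auto
  then show ?case using step(1) segment_Suc[OF ta(1)] segment_Suc[OF tb] by simp
qed

section \<open>The sequence of querying rounds\<close>

definition bound :: "input \<Rightarrow> nat \<Rightarrow> nat" where
  "bound x r = (if r < query_count M x then query_rounds M x ! r else nrounds x)"

lemma query_rounds_eq:
  assumes "x \<in> inputs M"
  shows "query_rounds M x = filter (\<lambda>t. read_places x t \<noteq> []) [0..<nrounds x]"
  unfolding query_rounds_def nrounds_def[symmetric]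
  by (rule filter_cong[OF refl]) (simp add: querying_mround[OF assms])

text \<open>The default \<open>nrounds x\<close> of \<open>bound\<close> closes the last block, so
  that a \<open>gap\<close> follows every querying round, including the last. Positivity comes from
  \<open>read_places_0\<close>.\<close>

lemma bound:
  assumes "x \<in> inputs M"
  shows "r < query_count M x \<Longrightarrow> bound x r < nrounds x \<and> read_places x (bound x r) \<noteq> [] \<and> 0 < bound x r"
    "\<lbrakk>r < r'; r < query_count M x\<rbrakk> \<Longrightarrow> bound x r < bound x r'"
    "gap x 0 (bound x 0)"
    "r < query_count M x \<Longrightarrow> gap x (Suc (bound x r)) (bound x (Suc r))"
proof -
  let ?L = "query_rounds M x" and ?F = "query_count M x"
  have L: "set ?L = {t. t < nrounds x \<and> read_places x t \<noteq> []}" by (auto simp: query_rounds_eq[OF assms])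
  have sorted: "sorted_wrt (<) ?L" unfolding query_rounds_eq[OF assms]
    by (simp add: sorted_wrt_filter)
  have F: "?F = length ?L" by (simp add: query_count_def)
  have in_L: "bound x r < nrounds x \<and> read_places x (bound x r) \<noteq> []" if "r < ?F" for r
    using that nth_mem[of r ?L] L F by (auto simp: bound_def)
  then show "r < ?F \<Longrightarrow> bound x r < nrounds x \<and> read_places x (bound x r) \<noteq> [] \<and> 0 < bound x r"
    using read_places_0 by (metis gr0I)
  have mono: "bound x r < bound x r'" if "r < r'" "r < ?F" for r r'
  proof (cases "r' < ?F")
    case True
    then show ?thesis using sorted_wrt_nth_less[OF sorted] that F by (simp add: bound_def)
  next
    case False
    then show ?thesis using in_L[OF that(2)] by (simp add: bound_def)
  qed
  then show "\<lbrakk>r < r'; r < ?F\<rbrakk> \<Longrightarrow> bound x r < bound x r'" .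
  have le: "bound x r \<le> nrounds x" for r using in_L[of r] by (cases "r < ?F") (auto simp: bound_def)
  have index: "\<exists>r<?F. u = bound x r" if "u < nrounds x" "read_places x u \<noteq> []" for u
  proof -
    have "u \<in> set ?L" using L that by blast
    then obtain r where "r < length ?L" "?L ! r = u" by (metis in_set_conv_nth)
    then show ?thesis using F by (auto simp: bound_def)
  qed
  have mono': "bound x r \<le> bound x r'" if "r \<le> r'" "r < ?F" for r r'
    using mono[of r r'] that by (cases "r = r'") auto
  have end_F: "bound x r = nrounds x" if "\<not> r < ?F" for r using that by (simp add: bound_def)
  show "gap x 0 (bound x 0)"
    unfolding gap_def
  proof (intro conjI allI impI)
    fix u assume u: "0 \<le> u \<and> u < bound x 0"
    show "read_places x u = []"
    proof (rule ccontr)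
      assume "read_places x u \<noteq> []"
      then obtain r where r: "r < ?F" "u = bound x r" using index[of u] u le[of 0] by force
      then have "bound x 0 \<le> u" using mono'[of 0 r] by simp
      then show False using u by simp
    qed
  next
    assume "bound x 0 < nrounds x"
    then show "read_places x (bound x 0) \<noteq> []" using in_L[of 0] end_F[of 0] by fastforce
  qed (use le in simp_all)
  show "gap x (Suc (bound x r)) (bound x (Suc r))" if r: "r < ?F"
    unfolding gap_def
  proof (intro conjI allI impI)
    show "Suc (bound x r) \<le> bound x (Suc r)" using mono[of r "Suc r"] r by simp
    fix u assume u: "Suc (bound x r) \<le> u \<and> u < bound x (Suc r)"
    show "read_places x u = []"
    proof (rule ccontr)
      assume "read_places x u \<noteq> []"
      then obtain r' where r': "r' < ?F" "u = bound x r'" using index[of u] u le[of "Suc r"] by force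
      have "r < r'"
      proof (rule ccontr)
        assume "\<not> r < r'"
        then have "bound x r' \<le> bound x r" using mono'[of r' r] r' by simp
        then show False using u r' by simp
      qed
      then have "bound x (Suc r) \<le> u" using mono'[of "Suc r" r'] r' by simp
      then show False using u by simp
    qed
  next
    assume "bound x (Suc r) < nrounds x"
    then show "read_places x (bound x (Suc r)) \<noteq> []" using in_L[of "Suc r"] end_F[of "Suc r"] by fastforce
  qed (use le in simp_all)
qed

lemma bound_less_iff: "x \<in> inputs M \<Longrightarrow> bound x r < nrounds x \<longleftrightarrow> r < query_count M x"
  using bound(1) by (auto simp: bound_def)

section \<open>Codes of querying rounds\<close>

lemma hd_mround:
  assumes "x \<in> inputs M" "t < nrounds x" "read_places x t \<noteq> []"
  shows "fst (hd (mround M x t)) = round_state x t"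
proof -
  \<comment> \<open>A round that reads a raw word has an event, so \<open>hd\<close> in
    \<open>round_code\<close> is its first event and no default.\<close>
  have "mround M x t \<noteq> []" using raw_reads_mround[OF assms(1,2)] assms(3) by auto
  moreover obtain as where "mround M x t = run_steps S x (round_state x t) as"
    using body_run_steps[OF assms(1) start_le[OF assms(1,2)]] mround_body[OF assms(1,2)]
    by (metis round_state_def)
  ultimately show ?thesis by (cases as) auto
qed

lemma round_code_eq:
  assumes "x \<in> inputs M" "r < query_count M x"
  shows "round_code M x r j = Some (comp_string S (round_state x (bound x r)),
    concat (take j (map (answer x (bound x r)) (asked x (bound x r)))))"
proof -
  have "query_rounds M x ! r = bound x r" using assms(2) by (simp add: bound_def)
  moreover note b = bound(1)[OF assms]
  ultimately show ?thesis using hd_mround[OF assms(1)] answers_mround[OF assms(1)]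
    by (simp add: round_code_def Let_def)
qed

text \<open>Codes can be decoded. Both rounds follow a hold, so the string determines the computed
  cells and the raw places; all answers have the positive length \<open>wlen S\<close>, so their
  concatenation determines their list; and all this determines the next place asked.\<close>

lemma round_code_eqD:
  assumes x: "x \<in> inputs M" "r < query_count M x" and y: "y \<in> inputs M" "r < query_count M y"
    and eq: "round_code M x r j = round_code M y r j"
  shows "alike x (bound x r) y (bound y r)"
    "map (answer x (bound x r)) (take j (asked x (bound x r))) = map (answer y (bound y r)) (take j (asked y (bound y r)))"
    "take (Suc j) (asked x (bound x r)) = take (Suc j) (asked y (bound y r))"
proof -
  note bx = bound(1)[OF x] and by' = bound(1)[OF y]
  note eq' = eq[unfolded round_code_eq[OF x] round_code_eq[OF y]]
  show alike: "alike x (bound x r) y (bound y r)"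
    using eq' bx by' by (intro alikeI[OF x(1) y(1)]) auto
  have len: "\<forall>v\<in>set (take j (map (answer z (bound z r)) (asked z (bound z r)))). length v = wlen S"
    if "z \<in> inputs M" "r < query_count M z" for z
  proof
    fix v assume "v \<in> set (take j (map (answer z (bound z r)) (asked z (bound z r))))"
    then have "v \<in> set (map (answer z (bound z r)) (asked z (bound z r)))" by (rule in_set_takeD)
    then obtain p where p: "p \<in> set (asked z (bound z r))" "v = answer z (bound z r) p"
      unfolding set_map by blast
    then show "length v = wlen S" using asked_raw[OF that(1) _ p(1)] bound(1)[OF that] by metis
  qed
  show ans: "map (answer x (bound x r)) (take j (asked x (bound x r))) = map (answer y (bound y r)) (take j (asked y (bound y r)))"
    using concat_eq_if_lengths[OF _ wlen_pos len[OF x] len[OF y]] eq' by (simp add: take_map)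
  show "take (Suc j) (asked x (bound x r)) = take (Suc j) (asked y (bound y r))"
    using next_asked[OF x(1) _ y(1) _ alike ans] bx by' by blast
qed

end

section \<open>Output\<close>

text \<open>Stated on projected events, so that inputs with equal projections have equal output. A
  word counts only if all of its bits are stored by events of \<open>A\<close>.\<close>

definition stored :: "nat \<Rightarrow> nat \<Rightarrow> ((cell \<Rightarrow> bool option) \<times> step) set \<Rightarrow> (nat \<times> bool list) set" where
  "stored w l A = {(p, v). length v = w \<and>
     (\<forall>b<w. \<exists>\<kappa> s. (\<kappa>, Move (Store s b p)) \<in> A \<and> \<kappa> (l, s + b) = Some (v ! b))}"

lemma stored_mono: "A \<subseteq> B \<Longrightarrow> stored w l A \<subseteq> stored w l B"
  unfolding stored_def by blast

lemma finite_bool_words: "finite {v :: bool list. length v = w}"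
  using finite_lists_length_eq[of "UNIV :: bool set" w] by simp

lemma finite_stored:
  assumes "finite A" "0 < w"
  shows "finite (stored w l A)"
proof -
  let ?pos = "\<lambda>(\<kappa>, a). case a of Move (Store s b p) \<Rightarrow> p | _ \<Rightarrow> 0"
  have "stored w l A \<subseteq> ?pos ` A \<times> {v. length v = w}"
  proof
    fix z assume "z \<in> stored w l A"
    then obtain p v \<kappa> s where z: "z = (p, v)" "length v = w" "(\<kappa>, Move (Store s 0 p)) \<in> A"
      using assms(2) unfolding stored_def by blast
    then have "p \<in> ?pos ` A" by force
    then show "z \<in> ?pos ` A \<times> {v. length v = w}" using z by simp
  qed
  then show ?thesis using assms(1) finite_bool_words by (meson finite_SigmaI finite_imageI finite_subset)
qed

text \<open>The order is a choice that depends on the set alone, so inputs with the same output in a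
  block get the same list on the edge.\<close>

definition listing :: "'b set \<Rightarrow> 'b list" where
  "listing X = (SOME xs. distinct xs \<and> set xs = X)"

lemma listing: "finite X \<Longrightarrow> distinct (listing X) \<and> set (listing X) = X"
  unfolding listing_def by (rule someI_ex) (use finite_distinct_list in blast)

lemma store_step:
  assumes "step_ok S n x (\<sigma>, a)"
  shows "outcells (exec S x a \<sigma>) (p, b) = Some v \<longleftrightarrow> outcells \<sigma> (p, b) = Some v \<or>
    (\<exists>s. a = Move (Store s b p) \<and> computed \<sigma> (port S, s + b) = Some v)"
proof (cases a)
  case (Move c)
  then show ?thesis using assms by (cases c) auto
next
  case (Hold d R)
  have "outcells ((convey S R ^^ u) \<sigma>) = outcells \<sigma>" for u
    by (induction u) (auto simp: convey_def Let_def)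
  then show ?thesis using Hold by (simp add: exec_hold_def)
qed (simp add: exec_fire_def)

lemma store_Some:
  assumes "step_ok S n x (\<sigma>, Move (Store s b p))"
  shows "\<exists>v. computed \<sigma> (port S, s + b) = Some v"
  using assms by (auto simp: comp_word_def computed_def)

lemma outcells_run:
  assumes "\<forall>e\<in>set (run_steps S x \<sigma> as). step_ok S n x e"
  shows "outcells (fold (exec S x) as \<sigma>) (p, b) = Some v \<longleftrightarrow> outcells \<sigma> (p, b) = Some v \<or>
    (\<exists>\<tau> s. (\<tau>, Move (Store s b p)) \<in> set (run_steps S x \<sigma> as) \<and> computed \<tau> (port S, s + b) = Some v)"
  using assms
proof (induction as arbitrary: \<sigma>)
  case (Cons a as)
  then have "step_ok S n x (\<sigma>, a)" by simp
  note st = store_step[OF this, of p b v]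
  have "outcells (fold (exec S x) as (exec S x a \<sigma>)) (p, b) = Some v \<longleftrightarrow> outcells (exec S x a \<sigma>) (p, b) = Some v \<or>
    (\<exists>\<tau> s. (\<tau>, Move (Store s b p)) \<in> set (run_steps S x (exec S x a \<sigma>) as) \<and> computed \<tau> (port S, s + b) = Some v)"
    using Cons.prems by (intro Cons.IH) simp
  then show ?case using st by (simp only: fold.simps run_steps.simps comp_apply list.set) blast
qed simp

text \<open>A written output cell stays written and thereby forbids every later store to it.\<close>

lemma store_once:
  assumes "\<forall>e\<in>set (run_steps S x \<sigma> as). step_ok S n x e" "outcells \<sigma> (p, b) \<noteq> None"
  shows "(\<tau>, Move (Store s b p)) \<notin> set (run_steps S x \<sigma> as)"
  using assms
proof (induction as arbitrary: \<sigma>)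
  case (Cons a as)
  then have ok: "step_ok S n x (\<sigma>, a)" by simp
  then have "outcells (exec S x a \<sigma>) (p, b) \<noteq> None"
    using Cons.prems(2) store_step[OF ok, of p b] by blast
  then have "(\<tau>, Move (Store s b p)) \<notin> set (run_steps S x (exec S x a \<sigma>) as)"
    using Cons.prems(1) by (intro Cons.IH) simp_all
  moreover have "a \<noteq> Move (Store s b p)" using ok Cons.prems(2) by auto
  ultimately show ?case by simp
qed simp

lemma run_steps_eq_append:
  assumes "run_steps S x \<sigma> as = es1 @ es2"
  obtains as1 as2 where "es1 = run_steps S x \<sigma> as1" "es2 = run_steps S x (fold (exec S x) as1 \<sigma>) as2"
proof -
  have len: "length (run_steps S x \<sigma> as) = length as" for \<sigma> as
    by (induction as arbitrary: \<sigma>) auto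
  define k where "k = length es1"
  have "run_steps S x \<sigma> (take k as @ drop k as) = es1 @ es2" using assms by simp
  moreover have "length (run_steps S x \<sigma> (take k as)) = length es1"
    using assms len[of \<sigma> as] by (simp add: len k_def)
  ultimately have "run_steps S x \<sigma> (take k as) = es1 \<and>
      run_steps S x (fold (exec S x) (take k as) \<sigma>) (drop k as) = es2"
    unfolding run_steps_append by (metis append_eq_append_conv)
  then show thesis using that by metis
qed

lemma rounds_cover: "\<lbrakk>e \<in> set es; \<not> is_hold (snd e)\<rbrakk> \<Longrightarrow> \<exists>t<length (rounds es). e \<in> set (rounds es ! t)"
proof (induction es)
  case (Cons f es)
  obtain r rs where r: "rounds es = r # rs" using rounds_not_Nil by (meson neq_Nil_conv)
  have "\<exists>R\<in>set (rounds (f # es)). e \<in> set R"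
  proof (cases "e = f")
    case True
    then show ?thesis using Cons.prems r by simp
  next
    case False
    then obtain t where "t < length (rounds es)" "e \<in> set (rounds es ! t)" using Cons by auto
    then have "\<exists>R\<in>set (rounds es). e \<in> set R" by (metis nth_mem)
    then show ?thesis using r by auto
  qed
  then show ?case by (metis in_set_conv_nth)
qed simp

text \<open>Cuts the execution between the earlier rounds and round t', so that
  \<open>store_once\<close> can be applied to the part after the cut.\<close>

lemma rounds_ordered:
  "t' < length (rounds es) \<Longrightarrow> \<exists>es1 es2. es = es1 @ es2 \<and>
     (\<forall>t<t'. set (rounds es ! t) \<subseteq> set es1) \<and> set (rounds es ! t') \<subseteq> set es2"
proof (induction es arbitrary: t')
  case (Cons e es)
  obtain r rs where r: "rounds es = r # rs" using rounds_not_Nil by (meson neq_Nil_conv)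
  show ?case
  proof (cases t')
    case 0
    have "set (rounds (e # es) ! 0) \<subseteq> set (e # es)"
      using set_rounds[of "rounds (e # es) ! 0" "e # es"] nth_mem[of 0 "rounds (e # es)"] rounds_not_Nil
      by (metis length_greater_0_conv)
    then show ?thesis using 0 by (intro exI[of _ "[]"] exI[of _ "e # es"]) simp
  next
    case (Suc k)
    show ?thesis
    proof (cases "is_hold (snd e)")
      case True
      then have R: "rounds (e # es) = [] # rounds es" by simp
      then have "k < length (rounds es)" using Cons.prems Suc by simp
      then obtain es1 es2 where es: "es = es1 @ es2" "\<forall>t<k. set (rounds es ! t) \<subseteq> set es1"
        "set (rounds es ! k) \<subseteq> set es2" using Cons.IH by blast
      have "set (rounds (e # es) ! t) \<subseteq> set (e # es1)" if "t < t'" for t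
        using es(2) that Suc unfolding R by (cases t) auto
      then show ?thesis using es Suc R by (intro exI[of _ "e # es1"] exI[of _ es2]) simp
    next
      case False
      then have R: "rounds (e # es) = (e # r) # rs" using r by simp
      then have "t' < length (rounds es)" using Cons.prems r by simp
      then obtain es1 es2 where es: "es = es1 @ es2" "\<forall>t<t'. set (rounds es ! t) \<subseteq> set es1"
        "set (rounds es ! t') \<subseteq> set es2" using Cons.IH by blast
      have "set (rounds (e # es) ! t) \<subseteq> set (e # es1)" if "t < t'" for t
        using es(2) that r unfolding R by (cases t) force+
      then show ?thesis using es Suc r unfolding R by (intro exI[of _ "e # es1"] exI[of _ es2]) simp
    qed
  qed
qed simp

context running
begin

lemma trace_run: "\<exists>as. trace M x = run_steps S x (initial M) as \<and> final M x = fold (exec S x) as (initial M)"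
proof -
  have "concat (map (batch x) [0..<n]) = run_steps S x (initial M) (concat (map (\<lambda>k. decision_steps (dec x k)) [0..<n]))
    \<and> cf x n = fold (exec S x) (concat (map (\<lambda>k. decision_steps (dec x k)) [0..<n])) (initial M)" for n
    by (induction n) (simp_all add: run_steps_append batch_def)
  from this[of "Suc (H x)"] show ?thesis unfolding trace_eq events_from_def final_def by blast
qed

definition stores :: "events \<Rightarrow> (nat \<times> bool list) set" where
  "stores es = stored (wlen S) (port S) (projected ` set es)"

lemma stores_iff:
  "(p, v) \<in> stores es \<longleftrightarrow> length v = wlen S \<and>
     (\<forall>b<wlen S. \<exists>\<tau> s. (\<tau>, Move (Store s b p)) \<in> set es \<and> computed \<tau> (port S, s + b) = Some (v ! b))"
proof -
  have "(\<kappa>, a) \<in> projected ` set es \<longleftrightarrow> (\<exists>\<tau>. (\<tau>, a) \<in> set es \<and> computed \<tau> = \<kappa>)" for \<kappa> a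
    by force
  then show ?thesis unfolding stores_def stored_def by simp blast
qed

lemma finite_stores: "finite (stores es)"
  unfolding stores_def by (rule finite_stored) (use wlen_pos in auto)

lemma stores_cong: "map projected es = map projected fs \<Longrightarrow> stores es = stores fs"
  unfolding stores_def by (metis set_map)

lemma outcells_final:
  assumes "x \<in> inputs M"
  shows "outcells (final M x) (p, b) = Some v \<longleftrightarrow>
    (\<exists>\<tau> s. (\<tau>, Move (Store s b p)) \<in> set (trace M x) \<and> computed \<tau> (port S, s + b) = Some v)"
proof -
  obtain as where as: "trace M x = run_steps S x (initial M) as" "final M x = fold (exec S x) as (initial M)"
    using trace_run by blast
  have "\<forall>e\<in>set (run_steps S x (initial M) as). step_ok S (nwords M) x e"
    using trace_step_ok[OF assms] as by metis
  from outcells_run[OF this] show ?thesis unfolding as by (simp add: initial_def)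
qed

lemma graph_machine_output:
  assumes "x \<in> inputs M"
  shows "Map.graph (machine_output M x) = stores (trace M x)"
proof -
  have "machine_output M x p = Some v \<longleftrightarrow> (p, v) \<in> stores (trace M x)" for p v
  proof -
    have "machine_output M x p = Some v \<longleftrightarrow> length v = wlen S \<and>
        (\<forall>b<wlen S. outcells (final M x) (p, b) = Some (v ! b))"
      unfolding machine_output_def
      by (auto intro!: nth_equalityI)
    then show ?thesis unfolding stores_iff outcells_final[OF assms] .
  qed
  then show ?thesis by (auto simp: Map.graph_def)
qed

lemma stores_disjoint_rounds:
  assumes "x \<in> inputs M" "t < t'" "t' < nrounds x"
    "(\<tau>, Move (Store s b p)) \<in> set (mround M x t)" "(\<tau>', Move (Store s' b p)) \<in> set (mround M x t')"
  shows False
proof -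
  obtain es1 es2 where es: "trace M x = es1 @ es2" "\<forall>t<t'. set (rounds (trace M x) ! t) \<subseteq> set es1"
    "set (rounds (trace M x) ! t') \<subseteq> set es2"
    using rounds_ordered[OF assms(3)[unfolded nrounds_def]] by blast
  then have e: "(\<tau>, Move (Store s b p)) \<in> set es1" "(\<tau>', Move (Store s' b p)) \<in> set es2"
    using assms by (auto simp: mround_def)
  obtain as where "trace M x = run_steps S x (initial M) as" using trace_run by blast
  then obtain as1 as2 where as: "es1 = run_steps S x (initial M) as1"
    "es2 = run_steps S x (fold (exec S x) as1 (initial M)) as2"
    using run_steps_eq_append es(1) by metis
  have ok1: "\<forall>e\<in>set es1. step_ok S (nwords M) x e" and ok2: "\<forall>e\<in>set es2. step_ok S (nwords M) x e"
    using trace_step_ok[OF assms(1)] es(1) by simp_all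
  obtain v where "computed \<tau> (port S, s + b) = Some v" using store_Some ok1 e(1) by blast
  then have "outcells (fold (exec S x) as1 (initial M)) (p, b) = Some v"
    using outcells_run[OF ok1[unfolded as(1)]] e(1) as(1) by blast
  then show False using store_once[OF ok2[unfolded as(2)]] e(2) as(2) by simp
qed

text \<open>The bits of an output word cross within one round, so all are stored in the round of bit
  0. Output cells are written once, so the bits stored there are those of the word.\<close>

lemma stores_trace:
  assumes x: "x \<in> inputs M"
  shows "stores (trace M x) = (\<Union>t<nrounds x. stores (mround M x t))"
proof
  have sub: "set (mround M x t) \<subseteq> set (trace M x)" if "t < nrounds x" for t
    using set_rounds[OF mround_in[OF that]] .
  have "stores (mround M x t) \<subseteq> stores (trace M x)" if "t < nrounds x" for t
    unfolding stores_def using that by (intro stored_mono image_mono sub)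
  then show "(\<Union>t<nrounds x. stores (mround M x t)) \<subseteq> stores (trace M x)" by blast
  show "stores (trace M x) \<subseteq> (\<Union>t<nrounds x. stores (mround M x t))"
  proof
    fix z assume z: "z \<in> stores (trace M x)"
    obtain p v where pv: "z = (p, v)" by fastforce
    note st = z[unfolded pv stores_iff]
    then obtain \<tau> s where "(\<tau>, Move (Store s 0 p)) \<in> set (trace M x)" using wlen_pos by blast
    then obtain t where t: "t < nrounds x" and e: "(\<tau>, Move (Store s 0 p)) \<in> set (mround M x t)"
      using rounds_cover[of "(\<tau>, Move (Store s 0 p))" "trace M x"] by (auto simp: nrounds_def mround_def)
    have "whole_moves S (mround M x t)"
      using execution[OF x] mround_in[OF t] by (auto simp: execution_ok_def)
    then have whole: "\<forall>b<wlen S. Move (Store s b p) \<in> snd ` set (mround M x t)"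
      using e unfolding whole_moves_def Let_def by (metis image_eqI snd_conv)
    have "\<exists>\<tau> s. (\<tau>, Move (Store s b p)) \<in> set (mround M x t) \<and> computed \<tau> (port S, s + b) = Some (v ! b)"
      if b: "b < wlen S" for b
    proof -
      obtain \<tau>' where e': "(\<tau>', Move (Store s b p)) \<in> set (mround M x t)" using whole b by auto
      then have tr: "(\<tau>', Move (Store s b p)) \<in> set (trace M x)" using sub t by blast
      then obtain u where u: "computed \<tau>' (port S, s + b) = Some u"
        using store_Some trace_step_ok[OF x] by blast
      then have "outcells (final M x) (p, b) = Some u" using tr outcells_final[OF x] by blast
      moreover have "outcells (final M x) (p, b) = Some (v ! b)" using st b outcells_final[OF x] by blast
      ultimately show ?thesis using e' u by auto
    qed
    then show "z \<in> (\<Union>t<nrounds x. stores (mround M x t))" using t st pv by (auto simp: stores_iff)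
  qed
qed

lemma set_segment: "set (segment x t a) = (\<Union>u\<in>{t..<a}. set (mround M x u))"
  by (simp add: segment_def)

text \<open>A word completed within the segment is completed in some round u of the execution; its
  bit 0 is stored in no other round, which places u inside the segment.\<close>

lemma stores_segment:
  assumes "x \<in> inputs M" "a \<le> nrounds x"
  shows "stores (segment x t a) = (\<Union>u\<in>{t..<a}. stores (mround M x u))"
proof
  have "stores (mround M x u) \<subseteq> stores (segment x t a)" if "u \<in> {t..<a}" for u
    unfolding stores_def using that by (intro stored_mono image_mono) (auto simp: set_segment)
  then show "(\<Union>u\<in>{t..<a}. stores (mround M x u)) \<subseteq> stores (segment x t a)" by blast
  show "stores (segment x t a) \<subseteq> (\<Union>u\<in>{t..<a}. stores (mround M x u))"
  proof
    fix z assume z: "z \<in> stores (segment x t a)"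
    obtain p v where pv: "z = (p, v)" by fastforce
    have "set (segment x t a) \<subseteq> set (trace M x)"
      unfolding set_segment
    proof (rule UN_least)
      fix u assume "u \<in> {t..<a}"
      then have "u < nrounds x" using assms(2) by simp
      then show "set (mround M x u) \<subseteq> set (trace M x)" by (rule set_rounds[OF mround_in])
    qed
    then have "stores (segment x t a) \<subseteq> stores (trace M x)" unfolding stores_def by (intro stored_mono image_mono)
    then obtain u where u: "u < nrounds x" "z \<in> stores (mround M x u)" using z stores_trace[OF assms(1)] by blast
    obtain \<tau> s where e: "(\<tau>, Move (Store s 0 p)) \<in> set (mround M x u)"
      using u(2) wlen_pos unfolding pv stores_iff by blast
    obtain \<tau>' s' where "(\<tau>', Move (Store s' 0 p)) \<in> set (segment x t a)"
      using z wlen_pos unfolding pv stores_iff by blast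
    then obtain u' where u': "u' \<in> {t..<a}" "(\<tau>', Move (Store s' 0 p)) \<in> set (mround M x u')"
      by (auto simp: set_segment)
    have "u = u'"
    proof (rule ccontr)
      assume "u \<noteq> u'"
      then consider "u < u'" | "u' < u" by linarith
      then show False
        using stores_disjoint_rounds[OF assms(1) _ _ e u'(2)] stores_disjoint_rounds[OF assms(1) _ u(1) u'(2) e]
          u' assms(2) by cases auto
    qed
    then show "z \<in> (\<Union>u\<in>{t..<a}. stores (mround M x u))" using u u' by blast
  qed
qed

lemma stores_disjoint:
  assumes "x \<in> inputs M" "t < nrounds x" "t' < nrounds x" "t \<noteq> t'"
  shows "stores (mround M x t) \<inter> stores (mround M x t') = {}"
proof (rule ccontr)
  assume "stores (mround M x t) \<inter> stores (mround M x t') \<noteq> {}"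
  then obtain p v where "(p, v) \<in> stores (mround M x t)" "(p, v) \<in> stores (mround M x t')" by auto
  then obtain \<tau> s \<tau>' s' where e: "(\<tau>, Move (Store s 0 p)) \<in> set (mround M x t)"
    "(\<tau>', Move (Store s' 0 p)) \<in> set (mround M x t')" using wlen_pos unfolding stores_iff by metis
  from assms(4) consider "t < t'" | "t' < t" by linarith
  then show False
    using stores_disjoint_rounds[OF assms(1) _ assms(3) e] stores_disjoint_rounds[OF assms(1) _ assms(2) e(2,1)] by cases auto
qed

section \<open>Output by blocks\<close>

definition block_start :: "input \<Rightarrow> nat \<Rightarrow> nat" where
  "block_start x r = (case r of 0 \<Rightarrow> 0 | Suc r' \<Rightarrow> bound x r')"

text \<open>Block r reaches from querying round number r - 1, which it includes, up to but excluding
  number r; block 0 starts with the execution and the last block ends with it. The output of a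
  querying round depends on its answers, so it waits for level 2qr, at which the last of them
  arrives.\<close>

definition block_output :: "input \<Rightarrow> nat \<Rightarrow> (nat \<times> bool list) set" where
  "block_output x r = stores (segment x (block_start x r) (bound x r))"

lemma bound_le: "x \<in> inputs M \<Longrightarrow> bound x r \<le> nrounds x"
  using bound(1)[of x r] by (cases "r < query_count M x") (auto simp: bound_def)

lemma block_output_eq:
  "x \<in> inputs M \<Longrightarrow> block_output x r = (\<Union>u\<in>{block_start x r..<bound x r}. stores (mround M x u))"
  unfolding block_output_def by (rule stores_segment) (simp_all add: bound_le)

lemma bound_mono:
  assumes "x \<in> inputs M" "r \<le> r'" "r \<le> query_count M x"
  shows "bound x r \<le> bound x r'"
proof (cases "r < query_count M x \<and> r \<noteq> r'")
  case True
  then show ?thesis using bound(2)[OF assms(1), of r r'] assms(2) by simp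
next
  case False
  then show ?thesis using assms by (auto simp: bound_def)
qed

lemma block_output_disjoint:
  assumes "x \<in> inputs M" "r < r'" "r' \<le> query_count M x"
  shows "block_output x r \<inter> block_output x r' = {}"
proof -
  obtain r'' where r'': "r' = Suc r''" using assms(2) by (cases r') auto
  then have le: "bound x r \<le> block_start x r'" using bound_mono[OF assms(1), of r r''] assms by (simp add: block_start_def)
  have "stores (mround M x u) \<inter> stores (mround M x u') = {}"
    if "u \<in> {block_start x r..<bound x r}" "u' \<in> {block_start x r'..<bound x r'}" for u u'
    using that le bound_le[OF assms(1), of r] bound_le[OF assms(1), of r'] by (intro stores_disjoint[OF assms(1)]) auto
  then show ?thesis unfolding block_output_eq[OF assms(1)] by blast
qed

text \<open>The blocks tile the rounds of the execution, the last one ending at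
  \<open>nrounds x\<close>.\<close>

lemma block_output_Union:
  assumes "x \<in> inputs M"
  shows "(\<Union>r\<le>query_count M x. block_output x r) = Map.graph (machine_output M x)"
proof -
  have "(\<Union>r\<le>n. block_output x r) = (\<Union>u<bound x n. stores (mround M x u))" if "n \<le> query_count M x" for n
    using that
  proof (induction n)
    case 0
    then show ?case by (simp add: block_output_eq[OF assms] block_start_def atLeast0LessThan)
  next
    case (Suc n)
    have "{..<bound x (Suc n)} = {..<bound x n} \<union> {bound x n..<bound x (Suc n)}"
      using bound_mono[OF assms, of n "Suc n"] Suc.prems by (simp add: ivl_disj_un)
    then show ?case using Suc by (simp add: atMost_Suc block_output_eq[OF assms] block_start_def Un_commute)
  qed
  from this[of "query_count M x"] show ?thesis
    unfolding graph_machine_output[OF assms] stores_trace[OF assms] by (simp add: bound_def)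
qed

section \<open>Lengths of codes\<close>

lemma asked_word:
  assumes x: "x \<in> inputs M" "t < nrounds x" and p: "(l, s) \<in> set (asked x t)"
  shows "l \<le> maxlev S" "s \<in> wstarts S l" "raw_word S (round_state x t) l s"
proof -
  note st = stop[OF x(1) start_le[OF x]]
  from p obtain e where e: "e \<in> set (control_states x t)"
    "(l, s) \<in> set (places M (raw_source (round_state x t)) e)" by (auto simp: asked_def read_places_def)
  from e(1) obtain k where k: "start x t \<le> k" "k \<le> stop x (start x t)" "e = computed (cf x k)"
    unfolding control_states_def set_map set_upt by auto
  from e(2) obtain g where g: "firing (dec x k) = Some g" "l = fire_level S g" "s \<in> set (reads g)"
    and raw: "raw_source (round_state x t) (l, s) \<noteq> None"
    by (cases "firing (dec x k)") (auto simp: places_def k(3) decide_def)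
  have ok: "fire_ok S x g (fold (exec S x) (map Move (moves (dec x k))) (cf x k))"
    using mid_fire(2)[OF x k(1,2) g(1)] .
  then show l: "l \<le> maxlev S" using S_ok g(2) by (auto simp: fire_ok_def fire_level_def substrate_ok_def)
  show s: "s \<in> wstarts S l" using ok g(2,3) by (simp add: fire_ok_def)
  show "raw_word S (round_state x t) l s"
    using whole_raw_wordsD[OF S_ok whole_round_state[OF x] l s, of 0] raw wlen_pos by simp
qed

lemma length_comp_string:
  assumes "finite (live \<sigma>)"
  shows "length (comp_string S \<sigma>) \<le> card {c. computed \<sigma> c \<noteq> None}"
proof -
  let ?C = "\<lambda>l. {k. k < ncells S l \<and> computed \<sigma> (l, k) \<noteq> None}"
  have "length (List.map_filter f xs) = length (filter (\<lambda>k. f k \<noteq> None) xs)" for f :: "nat \<Rightarrow> bool option" and xs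
    by (simp add: List.map_filter_def)
  moreover have "length (filter (\<lambda>k. computed \<sigma> (l, k) \<noteq> None) [0..<ncells S l]) = card (?C l)" for l
    by (simp add: length_filter_conv_card) (metis (no_types, lifting) add_0 nth_upt)
  ultimately have "length (comp_string S \<sigma>) = (\<Sum>l\<leftarrow>[0..<Suc (maxlev S)]. card (?C l))"
    by (simp add: comp_string_def length_concat comp_def del: upt_Suc)
  also have "\<dots> = (\<Sum>l\<in>{..maxlev S}. card (?C l))"
    by (simp add: interv_sum_list_conv_sum_set_nat atLeast0AtMost atLeastLessThanSuc_atLeastAtMost del: upt_Suc)
  also have "\<dots> = card (SIGMA l:{..maxlev S}. ?C l)" by simp
  also have "\<dots> \<le> card {c. computed \<sigma> c \<noteq> None}"
  proof (rule card_mono)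
    have "{c. computed \<sigma> c \<noteq> None} \<subseteq> live \<sigma>" by (auto simp: live_def computed_def split: option.splits)
    then show "finite {c. computed \<sigma> c \<noteq> None}" using assms finite_subset by blast
  qed auto
  finally show ?thesis .
qed

lemma finite_live_round_state:
  assumes "x \<in> inputs M" "t < nrounds x"
  shows "finite (live (round_state x t))"
  using valid_config[OF assms(1), of "start x t"] start_le[OF assms] finite_valid_cells finite_subset
  unfolding valid_state_def round_state_def by (metis le_SucI)

text \<open>The computed string takes one bit per computed cell, and distinct asked words occupy
  disjoint sets of raw cells, all live when the round opens. The hold before the round started with
  at least as many live cells.\<close>

lemma code_length_round_code:
  assumes x: "x \<in> inputs M" and r: "r < query_count M x"
  shows "code_length (round_code M x r j) \<le> live_count M (bound x r - 1) x"
proof -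
  let ?t = "bound x r"
  note b = bound(1)[OF x r]
  let ?\<sigma> = "round_state x ?t"
  have t: "?t < nrounds x" using b by blast
  note fin = finite_live_round_state[OF x t]
  let ?cells = "\<lambda>p. (\<lambda>b. (fst p, snd p + b)) ` {..<wlen S}"
  let ?R = "\<Union>p\<in>set (asked x ?t). ?cells p" and ?C = "{c. computed ?\<sigma> c \<noteq> None}"
  have raw: "\<exists>i b. held ?\<sigma> c = Some (Raw i b)" if c: "c \<in> ?R" for c
  proof -
    obtain p b where p: "p \<in> set (asked x ?t)" "c = (fst p, snd p + b)" "b < wlen S" using c by blast
    then show ?thesis using asked_word(3)[OF x t, of "fst p" "snd p"] unfolding raw_word_def by auto
  qed
  have sub: "?C \<subseteq> live ?\<sigma>" "?R \<subseteq> live ?\<sigma>"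
    using raw by (force simp: live_def computed_def split: option.splits)+
  have disj: "?C \<inter> ?R = {}" using raw by (fastforce simp: computed_def)
  have "card ?R = (\<Sum>p\<in>set (asked x ?t). card (?cells p))"
  proof (rule card_UN_disjoint)
    show "\<forall>p\<in>set (asked x ?t). \<forall>p'\<in>set (asked x ?t). p \<noteq> p' \<longrightarrow> ?cells p \<inter> ?cells p' = {}"
    proof (intro ballI impI)
      fix p p' assume p: "p \<in> set (asked x ?t)" "p' \<in> set (asked x ?t)" "p \<noteq> p'"
      obtain l s l' s' where [simp]: "p = (l, s)" "p' = (l', s')" by fastforce
      show "?cells p \<inter> ?cells p' = {}"
      proof (cases "l = l'")
        case True
        then have "s + wlen S \<le> s' \<or> s' + wlen S \<le> s"
          using words_disjoint[OF S_ok, of l s s'] asked_word[OF x t, of l s] asked_word[OF x t, of l' s'] p by auto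
        then show ?thesis by auto
      qed auto
    qed
  qed auto
  also have "\<dots> = (\<Sum>p\<in>set (asked x ?t). wlen S)"
    by (intro sum.cong refl) (simp add: card_image inj_on_def)
  also have "\<dots> = length (asked x ?t) * wlen S"
    using distinct_card[of "asked x ?t"] by (simp add: asked_def)
  finally have cR: "card ?R = length (asked x ?t) * wlen S" .
  have len: "length (answer x ?t p) = wlen S" if "p \<in> set (asked x ?t)" for p
    using asked_raw[OF x t that] by metis
  have "length (concat (map (answer x ?t) ps)) = length ps * wlen S" if "set ps \<subseteq> set (asked x ?t)" for ps
    using that len by (induction ps) auto
  then have "length (concat (map (answer x ?t) (take j (asked x ?t)))) = length (take j (asked x ?t)) * wlen S"
    by (meson set_take_subset)
  also have "\<dots> \<le> card ?R" unfolding cR by (intro mult_right_mono) auto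
  finally have "length (concat (take j (map (answer x ?t) (asked x ?t)))) \<le> card ?R" by (simp add: take_map)
  moreover have "length (comp_string S ?\<sigma>) \<le> card ?C" using length_comp_string[OF fin] .
  moreover have "card ?C + card ?R \<le> card (live ?\<sigma>)"
    using card_Un_disjoint[OF finite_subset[OF sub(1) fin] finite_subset[OF sub(2) fin] disj]
      card_mono[OF fin Un_least[OF sub]] by simp
  ultimately have 1: "code_length (round_code M x r j) \<le> card (live ?\<sigma>)" by (simp add: round_code_eq[OF x r])
  \<comment> \<open>Round t' + 1 directly follows hold t', hence the index
    \<open>bound x r - 1\<close>.\<close>
  obtain t' where t': "?t = Suc t'" using b gr0_implies_Suc by blast
  obtain d R \<sigma> where h: "mholds M x ! t' = (\<sigma>, d, R)" "?\<sigma> = exec_hold S d R \<sigma>"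
    "(\<sigma>, Hold d R) \<in> set (trace M x)" using hold_after[OF x] t t' by metis
  have "finite (live \<sigma>)" using valid_trace[OF x h(3)] finite_valid_cells finite_subset
    unfolding valid_state_def by (metis fst_conv)
  then have "card (live ?\<sigma>) \<le> card (live \<sigma>)"
    using exec_hold_props(2)[OF S_ok hold_ok_after[OF x h(3)]] h(2) by simp
  then show ?thesis using 1 h(1) t t' by (simp add: live_count_def length_mholds)
qed

end

section \<open>Counting codes\<close>

text \<open>Source of the constant 2q: a fire reads at most two words, and a round has at most q
  fires.\<close>

lemma length_raw_reads:
  assumes "\<forall>e\<in>set es. step_ok S n x e"
  shows "length (concat (map (raw_reads S x) es)) \<le> 2 * length (filter (is_fire \<circ> snd) es)"
  using assms
proof (induction es)
  case (Cons e es)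
  have "length (raw_reads S x e) \<le> (if is_fire (snd e) then 2 else 0)"
  proof (cases "snd e")
    case (Fire g)
    then have "length (reads g) \<le> 2" using Cons.prems by (cases e) (auto simp: fire_ok_def)
    moreover have "length (filter P (reads g)) \<le> length (reads g)" for P by simp
    ultimately have "length (filter P (reads g)) \<le> 2" for P by (meson le_trans)
    then show ?thesis using Fire by (cases e) (simp add: Let_def)
  qed (cases e; simp)+
  then show ?case using Cons by (auto split: if_splits)
qed simp

lemma sum_blocks:
  fixes h :: "nat \<Rightarrow> 'b :: comm_semiring_1"
  shows "(\<Sum>i\<in>{1..m * n}. h ((i - 1) div m)) = of_nat m * (\<Sum>r<n. h r)"
proof (induction n)
  case (Suc n)
  have un: "{1..m * Suc n} = {1..m * n} \<union> {Suc (m * n)..m * n + m}" by auto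
  have "(i - 1) div m = n" if "i \<in> {Suc (m * n)..m * n + m}" for i
  proof (rule div_nat_eqI)
    show "m * n \<le> i - 1" "i - 1 < m * Suc n" using that by auto
  qed
  then have "(\<Sum>i\<in>{Suc (m * n)..m * n + m}. h ((i - 1) div m)) = of_nat m * h n" by simp
  moreover have "(\<Sum>i\<in>{1..m * Suc n}. h ((i - 1) div m)) =
      (\<Sum>i\<in>{1..m * n}. h ((i - 1) div m)) + (\<Sum>i\<in>{Suc (m * n)..m * n + m}. h ((i - 1) div m))"
    unfolding un by (rule sum.union_disjoint) auto
  ultimately show ?case using Suc by (simp add: distrib_left add.commute)
qed simp

lemma card_bool_words_le: "card {u :: bool list. length u \<le> m} < 2 ^ Suc m"
proof -
  have "card {u :: bool list. set u \<subseteq> UNIV \<and> length u \<le> m} = (\<Sum>i\<le>m. card (UNIV :: bool set) ^ i)"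
    by (rule card_lists_length_le) simp
  moreover have "(\<Sum>i\<le>m. (2::nat) ^ i) < 2 ^ Suc m" by (induction m) auto
  ultimately show ?thesis by simp
qed

text \<open>A pair of strings is its concatenation, one of fewer than 2 ^ (m + 1) strings, together
  with one of m + 1 cuts. Replacing m + 1 by m + 2 absorbs the empty node.\<close>

lemma codes_of_length:
  "finite {c. code_length c \<le> m}" "card {c. code_length c \<le> m} \<le> (m + 2) * 2 ^ Suc m"
proof -
  let ?U = "{u :: bool list. length u \<le> m}"
  let ?f = "\<lambda>(u, k). Some (take k u, drop k u)"
  have fin: "finite ?U" using finite_lists_length_le[of "UNIV :: bool set" m] by simp
  have sub: "{c. code_length c \<le> m} \<subseteq> insert None (?f ` (?U \<times> {..m}))"
  proof
    fix c assume "c \<in> {c. code_length c \<le> m}"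
    then have c: "code_length c \<le> m" by simp
    show "c \<in> insert None (?f ` (?U \<times> {..m}))"
    proof (cases c)
      case (Some sa)
      then obtain s a where sa: "c = Some (s, a)" by (cases sa) auto
      then have "c = ?f (s @ a, length s)" "(s @ a, length s) \<in> ?U \<times> {..m}" using c by auto
      then show ?thesis by blast
    qed simp
  qed
  then show "finite {c. code_length c \<le> m}" using finite_subset[OF sub] fin by simp
  have "card {c. code_length c \<le> m} \<le> card (insert None (?f ` (?U \<times> {..m})))"
    using sub fin by (intro card_mono) simp_all
  also have "\<dots> \<le> Suc (card (?f ` (?U \<times> {..m})))" by (rule card_insert_le_m1) simp_all
  also have "\<dots> \<le> Suc (card (?U \<times> {..m}))" using card_image_le[of "?U \<times> {..m}" ?f] fin by simp
  also have "\<dots> = Suc (card ?U * Suc m)" by (simp add: card_cartesian_product)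
  also have "\<dots> \<le> Suc (2 ^ Suc m * Suc m)"
    using card_bool_words_le[of m] by (intro Suc_le_mono[THEN iffD2] mult_le_mono1) simp
  also have "\<dots> \<le> (m + 2) * 2 ^ Suc m" by (simp add: algebra_simps)
  finally show "card {c. code_length c \<le> m} \<le> (m + 2) * 2 ^ Suc m" .
qed

lemma live_cost_nonneg: "0 \<le> live_cost m"
proof -
  have "0 \<le> log 2 (real m + 2)" by simp
  then have "0 \<le> \<lceil>log 2 (real m + 2)\<rceil>" by linarith
  then show ?thesis by (simp add: live_cost_def)
qed

lemma live_cost_mono:
  assumes "m \<le> n"
  shows "live_cost m \<le> live_cost n"
proof -
  have "log 2 (real m + 2) \<le> log 2 (real n + 2)" using assms by simp
  then have "\<lceil>log 2 (real m + 2)\<rceil> \<le> \<lceil>log 2 (real n + 2)\<rceil>" by (rule ceiling_mono)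
  then show ?thesis using assms by (simp add: live_cost_def)
qed

lemma log_card_codes:
  assumes "A \<noteq> {}" "\<forall>c\<in>A. code_length c \<le> m"
  shows "log 2 (real (card A)) \<le> live_cost m"
proof -
  have sub: "A \<subseteq> {c. code_length c \<le> m}" using assms(2) by blast
  then have "finite A" using codes_of_length(1) finite_subset by blast
  then have pos: "0 < card A" using assms(1) by (simp add: card_gt_0_iff)
  have "card A \<le> (m + 2) * 2 ^ Suc m"
    using card_mono[OF codes_of_length(1) sub] codes_of_length(2)[of m] by linarith
  then have "real (card A) \<le> real ((m + 2) * 2 ^ Suc m)" by (rule of_nat_mono)
  then have "log 2 (real (card A)) \<le> log 2 (real ((m + 2) * 2 ^ Suc m))" using pos by simp
  also have "real ((m + 2) * 2 ^ Suc m) = (real m + 2) * 2 ^ Suc m" by (simp add: algebra_simps)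
  also have "log 2 ((real m + 2) * 2 ^ Suc m) = log 2 (real m + 2) + log 2 (2 ^ Suc m)"
    by (rule log_mult_pos) simp_all
  also have "log 2 (2 ^ Suc m) = real (Suc m)" by (rule log_pow_cancel) simp_all
  finally have "log 2 (real (card A)) \<le> log 2 (real m + 2) + real (Suc m)" .
  moreover have "log 2 (real m + 2) \<le> real_of_int \<lceil>log 2 (real m + 2)\<rceil>" by (rule le_of_int_ceiling)
  ultimately show ?thesis unfolding live_cost_def of_nat_Suc by linarith
qed

lemma finite_inputs: "finite (inputs M)"
proof -
  have "inputs M \<subseteq> {xs. set xs \<subseteq> {v. length v = wlen (sub M)} \<and> length xs = nwords M}"
    by (auto simp: inputs_def)
  then show ?thesis using finite_lists_length_eq[OF finite_bool_words] finite_subset by blast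
qed

lemma inputs_nonempty: "inputs M \<noteq> {}"
proof -
  have "replicate (nwords M) (replicate (wlen (sub M)) False) \<in> inputs M" by (auto simp: inputs_def)
  then show ?thesis by blast
qed

lemma graph_eq_iff: "Map.graph f = Map.graph g \<longleftrightarrow> f = g"
proof
  assume eq: "Map.graph f = Map.graph g"
  show "f = g"
  proof
    fix p
    have "f p = Some v \<longleftrightarrow> (p, v) \<in> Map.graph f" "g p = Some v \<longleftrightarrow> (p, v) \<in> Map.graph g" for v
      by (simp_all add: Map.graph_def)
    then have "\<forall>v. f p = Some v \<longleftrightarrow> g p = Some v" using eq by blast
    then show "f p = g p" by (metis option.exhaust)
  qed
qed simp

lemma sum_live_at:
  assumes "valid_state S n \<sigma>"
  shows "(\<Sum>l\<le>maxlev S. live_at \<sigma> l) = card (live \<sigma>)"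
proof -
  have fin: "finite (live \<sigma>)" using assms finite_valid_cells finite_subset unfolding valid_state_def by blast
  have sig: "live \<sigma> = (SIGMA l:{..maxlev S}. {k. (l, k) \<in> live \<sigma>})"
    using assms by (fastforce simp: valid_state_def valid_cells_def)
  have "finite {k. (l, k) \<in> live \<sigma>}" for l
    using finite_vimageI[OF fin, of "Pair l"] by (simp add: vimage_def inj_on_def)
  then have "card (SIGMA l:{..maxlev S}. {k. (l, k) \<in> live \<sigma>}) = (\<Sum>l\<le>maxlev S. live_at \<sigma> l)"
    unfolding live_at_def by (intro card_SigmaI) auto
  then show ?thesis by (simp only: sig[symmetric])
qed

section \<open>The program\<close>

locale synchronous_running = running +
  fixes \<Delta> :: real and q :: nat
  assumes \<Delta>: "0 < \<Delta>" and sync: "synchronous M \<Delta> q"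
begin

abbreviation "F \<equiv> query_count M"

lemma length_asked:
  assumes "x \<in> inputs M" "t < nrounds x"
  shows "length (asked x t) \<le> 2 * q"
proof -
  have "length (asked x t) \<le> length (read_places x t)" by (simp add: asked_def length_keep_first_le)
  also have "\<dots> = length (concat (map (raw_reads S x) (mround M x t)))" by (simp add: raw_reads_mround[OF assms])
  also have "\<dots> \<le> 2 * length (filter (is_fire \<circ> snd) (mround M x t))"
    using trace_step_ok[OF assms(1)] set_rounds[OF mround_in[OF assms(2)]] by (intro length_raw_reads) blast
  also have "\<dots> \<le> 2 * q" using sync assms(1) mround_in[OF assms(2)] by (simp add: synchronous_def)
  finally show ?thesis .
qed

text \<open>A querying round asks at least one word and at most 2q.\<close>

lemma q_pos: "\<lbrakk>x \<in> inputs M; r < F x\<rbrakk> \<Longrightarrow> 0 < q"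
  using bound(1) length_asked read_places_eq_Nil_iff by (metis gr0I le_zero_eq length_0_conv mult_0_right)

section \<open>Node, query and output of every input at every level\<close>

definition node :: "input \<Rightarrow> nat \<Rightarrow> code" where
  "node x i = (if i = 0 then Some ([], [])
     else if i \<le> 2 * q * F x then round_code M x ((i - 1) div (2 * q)) ((i - 1) mod (2 * q)) else None)"

text \<open>Once a round has asked its last word, no query is made until its 2q levels are used up;
  so the r-th querying rounds of all inputs share the same levels.\<close>

definition ask :: "input \<Rightarrow> nat \<Rightarrow> nat \<Rightarrow> nat option" where
  "ask x r j = (if j < length (asked x (bound x r))
     then Some (the (raw_source (round_state x (bound x r)) (asked x (bound x r) ! j))) else None)"

definition question :: "input \<Rightarrow> nat \<Rightarrow> nat option" where
  "question x i = (if i \<noteq> 0 \<and> i \<le> 2 * q * F x then ask x ((i - 1) div (2 * q)) ((i - 1) mod (2 * q)) else None)"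

text \<open>Block 0 ends at level 0. If q is 0 there is no other block, and division by 0 yields block 0.\<close>

definition emission :: "input \<Rightarrow> nat \<Rightarrow> (nat \<times> bool list) list" where
  "emission x i = (if 2 * q dvd i \<and> i \<le> 2 * q * F x then listing (block_output x (i div (2 * q))) else [])"

lemma block_index:
  assumes "x \<in> inputs M" "i \<noteq> 0" "i \<le> 2 * q * F x"
  shows "0 < q" "(i - 1) div (2 * q) < F x" "(i - 1) mod (2 * q) < 2 * q"
proof -
  show "0 < q" using assms by (cases q) auto
  then show "(i - 1) mod (2 * q) < 2 * q" by simp
  have "i - 1 < F x * (2 * q)" using assms(2,3) by (simp add: mult.commute)
  then show "(i - 1) div (2 * q) < F x" by (rule less_mult_imp_div_less)
qed

lemma node_None: "node x i = None \<longleftrightarrow> i \<noteq> 0 \<and> \<not> i \<le> 2 * q * F x"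
  by (simp add: node_def round_code_def Let_def)

text \<open>The label answers the question of the node, so it extends the known answers by one, or
  by none if the round asks nothing further.\<close>

lemma ask_same:
  assumes x: "x \<in> inputs M" "r < F x" and y: "y \<in> inputs M" "r < F y"
    and eq: "round_code M x r j = round_code M y r j"
  shows "ask x r j = ask y r j"
    "map_option ((!) x) (ask x r j) = map_option ((!) y) (ask y r j) \<Longrightarrow>
      map (answer x (bound x r)) (take (Suc j) (asked x (bound x r))) =
      map (answer y (bound y r)) (take (Suc j) (asked y (bound y r)))"
proof -
  let ?X = "asked x (bound x r)" and ?Y = "asked y (bound y r)"
  note e = round_code_eqD[OF x y eq]
  have rs: "raw_source (round_state x (bound x r)) = raw_source (round_state y (bound y r))"
    using e(1) by (simp add: alike_def)
  have "length (take (Suc j) ?X) = length (take (Suc j) ?Y)" using e(3) by simp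
  then have len: "j < length ?X \<longleftrightarrow> j < length ?Y" by (auto simp: min_def split: if_splits)
  have nth: "?X ! j = ?Y ! j" if "j < length ?X"
    using e(3) that len by (simp add: take_Suc_conv_app_nth)
  show "ask x r j = ask y r j" using len nth rs by (simp add: ask_def)
  show "map (answer x (bound x r)) (take (Suc j) ?X) = map (answer y (bound y r)) (take (Suc j) ?Y)"
    if lab: "map_option ((!) x) (ask x r j) = map_option ((!) y) (ask y r j)"
  proof (cases "j < length ?X")
    case True
    then have "answer x (bound x r) (?X ! j) = answer y (bound y r) (?Y ! j)"
      using lab len by (simp add: ask_def answer_def)
    then show ?thesis using True len e(2) by (simp add: take_Suc_conv_app_nth)
  next
    case False
    then show ?thesis using len e(2) by simp
  qed
qed

text \<open>Converse of the first two parts of \<open>round_code_eqD\<close>.\<close>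

lemma code_same:
  assumes x: "x \<in> inputs M" "r < F x" and y: "y \<in> inputs M" "r < F y"
    and "alike x (bound x r) y (bound y r)"
    and "map (answer x (bound x r)) (take j (asked x (bound x r))) =
      map (answer y (bound y r)) (take j (asked y (bound y r)))"
  shows "round_code M x r j = round_code M y r j"
  using assms comp_string_computed_cong[of "round_state x (bound x r)" "round_state y (bound y r)" S]
  by (simp add: round_code_eq[OF x] round_code_eq[OF y] take_map alike_def)

text \<open>Serves twice: from the start of the execution to the first querying round, and from the
  round after a querying round to the next querying one. The case that none is left is
  included.\<close>

lemma next_block_same:
  assumes x: "x \<in> inputs M" and y: "y \<in> inputs M"
    and gap: "gap x s (bound x r)" "gap y s' (bound y r)" "s < nrounds x \<longleftrightarrow> s' < nrounds y"
      "s < nrounds x \<Longrightarrow> alike x s y s'"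
  shows "map projected (segment x s (bound x r)) = map projected (segment y s' (bound y r))"
    "r < F x \<longleftrightarrow> r < F y" "r < F x \<Longrightarrow> round_code M x r 0 = round_code M y r 0"
proof -
  note g = gap_alike[OF x y gap]
  show "map projected (segment x s (bound x r)) = map projected (segment y s' (bound y r))" using g by blast
  show iff: "r < F x \<longleftrightarrow> r < F y" using g bound_less_iff x y by blast
  show "round_code M x r 0 = round_code M y r 0" if "r < F x"
    using g bound_less_iff[OF x] that iff by (intro code_same x y) auto
qed

lemma node_question:
  assumes x: "x \<in> inputs M" and y: "y \<in> inputs M" and eq: "node x i = node y i"
  shows "question x i = question y i"
proof (cases "i \<noteq> 0 \<and> i \<le> 2 * q * F x")
  case True
  then have i: "i \<noteq> 0" "i \<le> 2 * q * F x" by auto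
  then have "i \<le> 2 * q * F y" using eq node_None by metis
  then show ?thesis using eq i ask_same(1)[OF x block_index(2)[OF x i] y block_index(2)[OF y i(1)]]
    by (simp add: node_def question_def)
next
  case False
  then have "\<not> (i \<noteq> 0 \<and> i \<le> 2 * q * F y)" using eq node_None by metis
  then show ?thesis using False by (simp only: question_def if_False)
qed

text \<open>Inside a block the label adds one answer to the code. At its last level all answers are
  known; they fix the querying round and everything up to the next one, hence the output of the
  block and the next code. After the last block everything is empty.\<close>

lemma node_edge:
  assumes x: "x \<in> inputs M" and y: "y \<in> inputs M" and eq: "node x i = node y i"
    and lab: "map_option ((!) x) (question x i) = map_option ((!) y) (question y i)"
  shows "node x (Suc i) = node y (Suc i) \<and> emission x i = emission y i"
proof (cases "i = 0")
  case True
  have "0 < nrounds x \<longleftrightarrow> 0 < nrounds y" using nrounds_pos by simp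
  note nb' = next_block_same[OF x y bound(3)[OF x] bound(3)[OF y] this alike_0]
  have "block_output x 0 = block_output y 0"
    using stores_cong[OF nb'(1)] by (simp add: block_output_def block_start_def)
  then have "emission x i = emission y i" using True by (simp add: emission_def)
  \<comment> \<open>For q = 0 the left side is false; then no round queries, so the right side is
    false as well.\<close>
  moreover have "Suc 0 \<le> 2 * q * F z \<longleftrightarrow> 0 < F z" if "z \<in> inputs M" for z
    using q_pos[OF that] by (auto simp: Suc_le_eq)
  then have "node x (Suc i) = node y (Suc i)" using True nb'(2,3) x y by (simp add: node_def)
  ultimately show ?thesis by blast
next
  case False
  show ?thesis
  proof (cases "i \<le> 2 * q * F x")
    case le: True
    then have le': "i \<le> 2 * q * F y" using eq False node_None by metis
    note bx = block_index[OF x False le] and by' = block_index[OF y False le']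
    define r j where "r = (i - 1) div (2 * q)" and "j = (i - 1) mod (2 * q)"
    have r: "r < F x" "r < F y" and j: "j < 2 * q" and q: "0 < q" using bx by' by (auto simp: r_def j_def)
    have code: "round_code M x r j = round_code M y r j" using eq False le le' by (simp add: node_def r_def j_def)
    have "question z i = ask z r j" if "i \<le> 2 * q * F z" for z
      using that False by (simp add: question_def r_def j_def)
    then have ans: "map (answer x (bound x r)) (take (Suc j) (asked x (bound x r))) =
        map (answer y (bound y r)) (take (Suc j) (asked y (bound y r)))"
      using ask_same(2)[OF x r(1) y r(2) code] lab le le' by simp
    have alike: "alike x (bound x r) y (bound y r)" using round_code_eqD(1)[OF x r(1) y r(2) code] .
    obtain k where k: "i = Suc k" using False by (cases i) auto
    have jk: "k mod (2 * q) = j" and rk: "k div (2 * q) = r" by (simp_all add: j_def r_def k)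
    have mod: "i mod (2 * q) = (if Suc j = 2 * q then 0 else Suc j)"
      unfolding k mod_Suc jk ..
    have div: "i div (2 * q) = (if Suc j = 2 * q then Suc r else r)"
      unfolding k div_Suc mod_Suc jk rk by auto
    show ?thesis
    proof (cases "Suc j = 2 * q")
      case True
      \<comment> \<open>No round asks more than 2q words, so the first 2q are all of them.\<close>
      have all: "take (2 * q) (asked z (bound z r)) = asked z (bound z r)" if "z \<in> inputs M" "r < F z" for z
        using length_asked[OF that(1)] bound(1)[OF that] by simp
      have full: "map (answer x (bound x r)) (asked x (bound x r)) = map (answer y (bound y r)) (asked y (bound y r))"
        using ans all[OF x r(1)] all[OF y r(2)] unfolding True by simp
      have bnd: "bound x r < nrounds x" "bound y r < nrounds y" using bound(1) x y r by blast+
      note aa = all_asked[OF x bnd(1) y bnd(2) alike full]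
      have nxt: "Suc (bound x r) < nrounds x \<longleftrightarrow> Suc (bound y r) < nrounds y"
        "Suc (bound x r) < nrounds x \<Longrightarrow> alike x (Suc (bound x r)) y (Suc (bound y r))" using aa by simp_all
      note nb = next_block_same[OF x y bound(4)[OF x r(1)] bound(4)[OF y r(2)] nxt]
      have "map projected (segment x (bound x r) (bound x (Suc r))) = map projected (segment y (bound y r) (bound y (Suc r)))"
        using segment_Suc[of "bound x r" "bound x (Suc r)" x] segment_Suc[of "bound y r" "bound y (Suc r)" y]
          bound(2)[OF x _ r(1), of "Suc r"] bound(2)[OF y _ r(2), of "Suc r"] aa nb(1) by simp
      from stores_cong[OF this] have "block_output x (Suc r) = block_output y (Suc r)"
        by (simp add: block_output_def block_start_def)
      moreover have dv: "2 * q dvd i" using mod True by (simp add: dvd_eq_mod_eq_0)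
      ultimately have out: "emission x i = emission y i" using le le' div True by (simp add: emission_def)
      have "2 * q * (i div (2 * q)) = i" using dv by (rule dvd_mult_div_cancel)
      moreover have "i div (2 * q) = Suc r" using div True by simp
      ultimately have ir: "i = 2 * q * Suc r" by metis
      have last: "Suc i \<le> 2 * q * F z \<longleftrightarrow> Suc r < F z" for z
        unfolding ir Suc_le_eq mult_less_cancel1 using q by auto
      then have "node x (Suc i) = node y (Suc i)" using nb(2,3) div mod True by (simp add: node_def)
      then show ?thesis using out by blast
    next
      case not_last: False
      then have "\<not> 2 * q dvd i" using mod by (simp add: dvd_eq_mod_eq_0)
      \<comment> \<open>Being no multiple of 2q, level i is not the last of any block, so level i +
        1 belongs to the same block.\<close>
      moreover from this have "i \<noteq> 2 * q * F x" "i \<noteq> 2 * q * F y" by auto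
      ultimately have "node x (Suc i) = round_code M x r (Suc j)" "node y (Suc i) = round_code M y r (Suc j)"
        "emission x i = emission y i"
        using le le' mod div not_last by (simp_all add: node_def emission_def)
      then show ?thesis using code_same[OF x r(1) y r(2) alike ans] by simp
    qed
  next
    case gt: False
    then have "\<not> i \<le> 2 * q * F y" using eq False node_None by metis
    then show ?thesis using gt False by (simp add: node_def emission_def)
  qed
qed

lemma question_range: "\<lbrakk>x \<in> inputs M; question x i = Some k\<rbrakk> \<Longrightarrow> k < nwords M"
proof -
  assume x: "x \<in> inputs M" and k: "question x i = Some k"
  then have i: "i \<noteq> 0" "i \<le> 2 * q * F x" by (auto simp: question_def split: if_splits)
  define r j where "r = (i - 1) div (2 * q)" and "j = (i - 1) mod (2 * q)"
  have r: "r < F x" using block_index[OF x i] by (simp add: r_def)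
  have "ask x r j = Some k" using k i by (simp add: question_def r_def j_def)
  then have "j < length (asked x (bound x r))"
    "k = the (raw_source (round_state x (bound x r)) (asked x (bound x r) ! j))"
    by (auto simp: ask_def split: if_splits)
  then have mem: "asked x (bound x r) ! j \<in> set (asked x (bound x r))"
    and k': "k = the (raw_source (round_state x (bound x r)) (asked x (bound x r) ! j))" by simp_all
  have t: "bound x r < nrounds x" using bound(1)[OF x r] by blast
  obtain k2 where "raw_source (round_state x (bound x r)) (asked x (bound x r) ! j) = Some k2" "k2 < nwords M"
    using asked_raw[OF x t mem] by blast
  then show "k < nwords M" using k' by simp
qed

text \<open>Block r is emitted at level 2qr only, and different blocks have disjoint output, so
  nothing is emitted twice. The strict bound on d leaves an edge out of level 2qF(x) for the last
  block.\<close>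

lemma set_emission:
  assumes "x \<in> inputs M" and d: "2 * q * F x < d"
  shows "distinct (concat (map (emission x) [0..<d])) \<and>
    set (concat (map (emission x) [0..<d])) = Map.graph (machine_output M x)"
proof -
  let ?on = "\<lambda>i. 2 * q dvd i \<and> i \<le> 2 * q * F x"
  have listed: "distinct (listing (block_output x r)) \<and> set (listing (block_output x r)) = block_output x r" for r
    using finite_stores by (intro listing) (simp add: block_output_def)
  have on: "set (emission x i) = block_output x (i div (2 * q))" if "?on i" for i
    using listed that by (simp add: emission_def)
  have off: "set (emission x i) = {}" if "\<not> ?on i" for i
    using that by (auto simp: emission_def)
  have dist1: "distinct (emission x i)" for i
    using listed by (simp add: emission_def)
  have block: "set (emission x (2 * q * r)) = block_output x r" if r: "r \<le> F x" for r
  proof -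
    \<comment> \<open>If q = 0 then r = 0, and division by 0 gives the block index 0 that is
      wanted.\<close>
    have div: "2 * q * r div (2 * q) = r"
    proof (cases "r = 0")
      case False
      then have "0 < q" using q_pos[OF assms(1), of 0] r by simp
      then show ?thesis by simp
    qed simp
    have "set (emission x (2 * q * r)) = block_output x (2 * q * r div (2 * q))"
      by (rule on) (use r in simp)
    then show ?thesis by (simp only: div)
  qed
  have "set (emission x i) \<inter> set (emission x i') = {}" if lt: "i < i'" for i i'
  proof (cases "?on i \<and> ?on i'")
    case True
    then obtain r r' where r: "i = 2 * q * r" "i' = 2 * q * r'" unfolding dvd_def by blast
    have rr: "r < r'" and q: "0 < q" using lt unfolding r by simp_all
    have "r' \<le> F x" using True q unfolding r by simp
    then show ?thesis unfolding r using block[of r] block[of r'] rr block_output_disjoint[OF assms(1) rr] by simp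
  next
    case False
    then show ?thesis using off[of i] off[of i'] by fastforce
  qed
  note disj = this
  have dist: "distinct (concat (map (emission x) [0..<n]))" for n
  proof (induction n)
    case (Suc n)
    have "set (concat (map (emission x) [0..<n])) \<inter> set (emission x n) = {}"
      unfolding set_concat set_map set_upt using disj[of _ n] by fastforce
    then show ?case using Suc dist1[of n] by simp
  qed simp
  have "(\<Union>i<d. set (emission x i)) = (\<Union>r\<le>F x. block_output x r)"
  proof
    show "(\<Union>i<d. set (emission x i)) \<subseteq> (\<Union>r\<le>F x. block_output x r)"
    proof (rule UN_least)
      fix i
      show "set (emission x i) \<subseteq> (\<Union>r\<le>F x. block_output x r)"
      proof (cases "?on i")
        case True
        then have "i div (2 * q) \<le> F x" by (cases "q = 0") (auto simp: dvd_def)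
        then show ?thesis unfolding on[OF True] by blast
      next
        case False
        then show ?thesis using off[of i] by simp
      qed
    qed
    show "(\<Union>r\<le>F x. block_output x r) \<subseteq> (\<Union>i<d. set (emission x i))"
    proof (rule UN_least)
      fix r assume "r \<in> {..F x}"
      then have r: "r \<le> F x" by simp
      then have "2 * q * r \<le> 2 * q * F x" by simp
      then have "2 * q * r < d" using d by linarith
      then show "block_output x r \<subseteq> (\<Union>i<d. set (emission x i))" unfolding block[OF r, symmetric] by blast
    qed
  qed
  moreover have "set (concat (map (emission x) [0..<d])) = (\<Union>i<d. set (emission x i))"
    by (simp add: atLeast0LessThan)
  ultimately show ?thesis using dist[of d] block_output_Union[OF assms(1)] by metis
qed

section \<open>Lengths, action and cumulative memory\<close>

lemma query_hold_eq: "r < F x \<Longrightarrow> query_hold M r x = bound x r - 1"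
  by (simp add: query_hold_def bound_def)

lemma query_hold_less:
  assumes "x \<in> inputs M" "r < F x"
  shows "query_hold M r x < length (mholds M x)"
  using bound(1)[OF assms] assms(2) length_mholds[of x] by (auto simp: query_hold_eq)

text \<open>Each querying round has a hold of its own, so no hold is charged for two blocks.
  Positive bounds keep the truncated subtraction of 1 injective.\<close>

lemma inj_query_hold:
  assumes "x \<in> inputs M"
  shows "inj_on (\<lambda>r. query_hold M r x) {..<F x}"
proof (rule linorder_inj_onI)
  fix r r' assume r: "r < r'" "r \<in> {..<F x}" "r' \<in> {..<F x}"
  then have "bound x r < bound x r'" "0 < bound x r" using bound(1,2)[OF assms] by simp_all
  then show "query_hold M r x \<noteq> query_hold M r' x" using r by (simp add: query_hold_eq)
qed (simp_all add: linear)

lemma code_length_node: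
  assumes x: "x \<in> inputs M" and i: "i \<noteq> 0"
  shows "code_length (node x i) \<le> query_live M ((i - 1) div (2 * q)) x"
proof (cases "i \<le> 2 * q * F x")
  case True
  define r where "r = (i - 1) div (2 * q)"
  have r: "r < F x" using block_index(2)[OF x i True] by (simp add: r_def)
  have "node x i = round_code M x r ((i - 1) mod (2 * q))" using True i by (simp add: node_def r_def)
  moreover have "query_live M r x = live_count M (bound x r - 1) x"
    using r by (simp add: query_live_def query_hold_eq)
  ultimately have "code_length (node x i) \<le> query_live M r x" using code_length_round_code[OF x r] by simp
  then show ?thesis unfolding r_def .
qed (simp add: node_def i)

text \<open>Each of the 2q nodes of a block is charged to the hold before its querying round. The
  root and the empty nodes have length 0, and the holds not charged only add to the right
  side.\<close>

lemma sum_code_length: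
  assumes x: "x \<in> inputs M"
  shows "(\<Sum>i\<le>d. code_length (node x i)) \<le> 2 * q * (\<Sum>t<length (mholds M x). live_count M t x)"
proof -
  have "(\<Sum>i\<le>d. code_length (node x i)) = (\<Sum>i\<in>{..d} \<inter> {1..2 * q * F x}. code_length (node x i))"
    by (rule sum.mono_neutral_right) (auto simp: node_def Suc_le_eq)
  also have "\<dots> \<le> (\<Sum>i\<in>{1..2 * q * F x}. code_length (node x i))"
    by (rule sum_mono2) auto
  also have "\<dots> \<le> (\<Sum>i\<in>{1..2 * q * F x}. query_live M ((i - 1) div (2 * q)) x)"
    by (intro sum_mono code_length_node[OF x]) auto
  also have "\<dots> = 2 * q * (\<Sum>r<F x. query_live M r x)"
    using sum_blocks[of "\<lambda>r. query_live M r x" "2 * q" "F x"] by simp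
  also have "(\<Sum>r<F x. query_live M r x) = (\<Sum>r<F x. live_count M (query_hold M r x) x)"
    by (intro sum.cong refl) (simp add: query_live_def)
  also have "\<dots> = (\<Sum>t\<in>(\<lambda>r. query_hold M r x) ` {..<F x}. live_count M t x)"
    using inj_query_hold[OF x] by (simp add: sum.reindex)
  also have "\<dots> \<le> (\<Sum>t<length (mholds M x). live_count M t x)"
    using query_hold_less[OF x] by (intro sum_mono2) auto
  finally show ?thesis by simp
qed

text \<open>For a single hold, the sum over the working levels counts the whole live set, and the
  hold lasts at least \<Delta>.\<close>

lemma live_action:
  assumes x: "x \<in> inputs M"
  shows "\<Delta> * real (\<Sum>t<length (mholds M x). live_count M t x) \<le> action M x"
proof -
  let ?h = "mholds M x"
  let ?dur = "\<lambda>t. fst (snd (?h ! t))"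
  have at: "action_at M x l = (\<Sum>t<length ?h. real (live_at (fst (?h ! t)) l) * ?dur t)" for l
    unfolding action_at_def sum_list_sum_nth length_map atLeast0LessThan
    by (intro sum.cong refl) (simp add: case_prod_unfold)
  have "action M x = (\<Sum>t<length ?h. \<Sum>l\<le>maxlev S. real (live_at (fst (?h ! t)) l) * ?dur t)"
    unfolding action_def at by (rule sum.swap)
  also have "\<dots> \<ge> (\<Sum>t<length ?h. \<Delta> * real (live_count M t x))"
  proof (rule sum_mono)
    fix t assume "t \<in> {..<length ?h}"
    then have t: "t < length ?h" by simp
    then have "Suc t < nrounds x" by (simp add: length_mholds)
    then obtain d R \<sigma> where h: "?h ! t = (\<sigma>, d, R)" "(\<sigma>, Hold d R) \<in> set (trace M x)"
      using hold_after[OF x] by metis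
    then have "(\<sigma>, d, R) \<in> set ?h" using t by (metis nth_mem)
    then have d: "\<Delta> \<le> d" using sync x by (auto simp: synchronous_def)
    have "(\<Sum>l\<le>maxlev S. real (live_at \<sigma> l) * d) = real (\<Sum>l\<le>maxlev S. live_at \<sigma> l) * d"
      by (simp add: sum_distrib_right)
    also have "(\<Sum>l\<le>maxlev S. live_at \<sigma> l) = card (live \<sigma>)"
      using sum_live_at valid_trace[OF x h(2)] by simp
    also have "\<Delta> * real (card (live \<sigma>)) \<le> real (card (live \<sigma>)) * d"
      using mult_right_mono[OF d, of "real (card (live \<sigma>))"] by (simp add: mult.commute)
    finally show "\<Delta> * real (live_count M t x) \<le> (\<Sum>l\<le>maxlev S. real (live_at (fst (?h ! t)) l) * ?dur t)"
      using h(1) t by (simp add: live_count_def)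
  qed
  also have "(\<Sum>t<length ?h. \<Delta> * real (live_count M t x)) = \<Delta> * real (\<Sum>t<length ?h. live_count M t x)"
    by (simp add: sum_distrib_left)
  finally show ?thesis .
qed

text \<open>If the r-th querying round follows the same hold on all inputs that have one,
  \<open>query_live M r\<close> is bounded by the live sets of that hold. An input with the most
  querying rounds names a hold for each r, and its holds are distinct, so the sum over r is part of
  the sum over all holds.\<close>

lemma live_costs_aligned:
  assumes aligned: "\<forall>r. \<forall>x\<in>inputs M. \<forall>y\<in>inputs M. r < F x \<and> r < F y \<longrightarrow> query_hold M r x = query_hold M r y"
  shows "(\<Sum>r<Max (F ` inputs M). live_cost (Max (query_live M r ` inputs M)))
    \<le> (\<Sum>t<Max ((\<lambda>x. length (mholds M x)) ` inputs M). live_cost (Max (live_count M t ` inputs M)))"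
proof -
  let ?I = "inputs M"
  note fin = finite_inputs[of M] and ne = inputs_nonempty[of M]
  have "Max (F ` ?I) \<in> F ` ?I" using fin ne by (intro Max_in) auto
  then obtain z where z: "z \<in> ?I" "Max (F ` ?I) = F z" by auto
  let ?t = "\<lambda>r. query_hold M r z"
  have "(\<Sum>r<F z. live_cost (Max (query_live M r ` ?I))) \<le> (\<Sum>r<F z. live_cost (Max (live_count M (?t r) ` ?I)))"
  proof (intro sum_mono live_cost_mono)
    fix r assume r: "r \<in> {..<F z}"
    have "query_live M r x \<le> Max (live_count M (?t r) ` ?I)" if x: "x \<in> ?I" for x
    proof (cases "r < F x")
      case True
      then have "query_live M r x = live_count M (?t r) x"
        using aligned x z(1) r by (metis lessThan_iff query_live_def)
      then show ?thesis using fin x by simp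
    qed (simp add: query_live_def)
    then show "Max (query_live M r ` ?I) \<le> Max (live_count M (?t r) ` ?I)" using fin ne by simp
  qed
  also have "\<dots> = (\<Sum>t\<in>?t ` {..<F z}. live_cost (Max (live_count M t ` ?I)))"
    using inj_query_hold[OF z(1)] by (simp add: sum.reindex)
  also have "\<dots> \<le> (\<Sum>t<Max ((\<lambda>x. length (mholds M x)) ` ?I). live_cost (Max (live_count M t ` ?I)))"
  proof (rule sum_mono2)
    have "length (mholds M z) \<le> Max ((\<lambda>x. length (mholds M x)) ` ?I)" using fin z(1) by simp
    then show "?t ` {..<F z} \<subseteq> {..<Max ((\<lambda>x. length (mholds M x)) ` ?I)}"
      using query_hold_less[OF z(1)] by (auto intro: less_le_trans)
  qed (simp_all add: live_cost_nonneg)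
  finally show ?thesis using z(2) by simp
qed

text \<open>One level more than root and blocks take up, so that the output of the last block has an
  edge to leave on, even if nothing is ever queried.\<close>

definition top_level :: nat where
  "top_level = Suc (2 * q * Max (F ` inputs M))"

lemma F_le_Max: "x \<in> inputs M \<Longrightarrow> F x \<le> Max (F ` inputs M)"
  using finite_inputs by simp

lemma blocks_below_top: "x \<in> inputs M \<Longrightarrow> 2 * q * F x < top_level"
  using F_le_Max by (simp add: top_level_def less_Suc_eq_le)

lemma program_exists:
  obtains P where "leveled_bp (nwords M) (wlen S) P" "depth P = top_level" "source P = Some ([], [])"
    "\<And>i. nodes P i = (\<lambda>x. node x i) ` inputs M \<union> (if i = 0 then {} else {None})"
    "\<And>x i. \<lbrakk>x \<in> inputs M; i \<le> top_level\<rbrakk> \<Longrightarrow> visit P x i = node x i"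
    "\<And>x i. \<lbrakk>x \<in> inputs M; i < top_level\<rbrakk> \<Longrightarrow> emitted_at P x i = emission x i"
    "\<And>i c. i < top_level \<Longrightarrow> emit P i None c = []"
proof (rule branching_program_of_runs[of "inputs M" node "([], [])" top_level question emission "nwords M" "wlen S"])
  show "emission x i = []" if "node x i = None" for x i
    using that by (simp add: node_None emission_def)
  show "node x (Suc i) = node y (Suc i) \<and> emission x i = emission y i"
    if "x \<in> inputs M" "y \<in> inputs M" "node x i = node y i"
      "map_option ((!) x) (question x i) = map_option ((!) y) (question y i)" for x y i
    using node_edge that by blast
  show "question x i = question y i" if "x \<in> inputs M" "y \<in> inputs M" "node x i = node y i" for x y i
    using node_question that by blast
  show "k < nwords M" if "x \<in> inputs M" "question x i = Some k" for x i k
    using question_range that by blast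
qed (use finite_inputs inputs_nonempty that in \<open>simp_all add: node_def\<close>)

text \<open>The first and the last level have a single node and contribute nothing. In block r of
  the levels between, an input without an r-th querying round is at \<open>None\<close>, of length
  0, so \<open>query_live M r\<close> bounds the length for every input.\<close>

lemma cumulative_memory_le:
  assumes P: "depth P = top_level"
    "\<And>i. nodes P i = (\<lambda>x. node x i) ` inputs M \<union> (if i = 0 then {} else {None})"
  shows "cumulative_memory P \<le> 2 * real q * (\<Sum>r<Max (F ` inputs M). live_cost (Max (query_live M r ` inputs M)))"
proof -
  let ?m = "Max (F ` inputs M)"
  note fin = finite_inputs[of M] and ne = inputs_nonempty[of M]
  have "(\<lambda>x. node x 0) ` inputs M = {Some ([], [])}" using ne by (auto simp: node_def)
  then have zero: "card (nodes P 0) = 1" by (simp add: P)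
  have "node x top_level = None" if "x \<in> inputs M" for x
    using blocks_below_top[OF that] by (simp add: node_None)
  then have "nodes P top_level = {None}" by (auto simp: P top_level_def)
  then have top: "card (nodes P top_level) = 1" by simp
  have "cumulative_memory P = (\<Sum>i\<le>top_level. log 2 (real (card (nodes P i))))"
    by (simp add: cumulative_memory_def P(1))
  also have "\<dots> = (\<Sum>i\<in>{1..2 * q * ?m}. log 2 (real (card (nodes P i))))"
  proof (rule sum.mono_neutral_right)
    show "\<forall>i\<in>{..top_level} - {1..2 * q * ?m}. log 2 (real (card (nodes P i))) = 0"
    proof
      fix i assume i: "i \<in> {..top_level} - {1..2 * q * ?m}"
      then have "i = 0 \<or> i = top_level" by (auto simp: top_level_def Suc_le_eq)
      then have "card (nodes P i) = 1" using zero top by blast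
      then show "log 2 (real (card (nodes P i))) = 0" by simp
    qed
  qed (auto simp: top_level_def)
  also have "\<dots> \<le> (\<Sum>i\<in>{1..2 * q * ?m}. live_cost (Max (query_live M ((i - 1) div (2 * q)) ` inputs M)))"
  proof (rule sum_mono)
    fix i assume "i \<in> {1..2 * q * ?m}"
    then have i: "i \<noteq> 0" by simp
    let ?l = "Max (query_live M ((i - 1) div (2 * q)) ` inputs M)"
    have "code_length (node x i) \<le> ?l" if "x \<in> inputs M" for x
    proof -
      have "query_live M ((i - 1) div (2 * q)) x \<le> ?l" using fin that by simp
      then show ?thesis using code_length_node[OF that i] by linarith
    qed
    then have "\<forall>c\<in>nodes P i. code_length c \<le> ?l" by (auto simp: P)
    then show "log 2 (real (card (nodes P i))) \<le> live_cost ?l"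
      using i by (intro log_card_codes) (auto simp: P)
  qed
  also have "\<dots> = 2 * real q * (\<Sum>r<?m. live_cost (Max (query_live M r ` inputs M)))"
    using sum_blocks[of "\<lambda>r. live_cost (Max (query_live M r ` inputs M))" "2 * q" ?m] by simp
  finally show ?thesis .
qed

text \<open>For a proper input z the coin space is uniform on a finite nonempty subset of
  \<open>inputs M\<close>, so predicates matter on these inputs only.\<close>

lemma prob_coin_space_cong:
  assumes z: "z \<in> proper M ` inputs M" and PQ: "\<And>x. x \<in> inputs M \<Longrightarrow> P x \<longleftrightarrow> Q x"
  shows "measure_pmf.prob (coin_space M z) {x. P x} = measure_pmf.prob (coin_space M z) {x. Q x}"
proof -
  have "set_pmf (coin_space M z) = {x \<in> inputs M. proper M x = z}"
    unfolding coin_space_def using z finite_inputs by (intro set_pmf_of_set) auto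
  then have "{x. P x} \<inter> set_pmf (coin_space M z) = {x. Q x} \<inter> set_pmf (coin_space M z)" using PQ by auto
  then show ?thesis by (metis measure_Int_set_pmf)
qed

end

theorem lemma2:
  fixes M :: machine and f :: "input \<Rightarrow> nat \<Rightarrow> bool list option" and \<Delta> :: real and q :: nat
  assumes "machine_ok M"
    and "0 < \<Delta>"
    and "synchronous M \<Delta> q"
  shows "\<exists>P :: code bp.
    leveled_bp (nwords M) (wlen (sub M)) P \<and>
    encodes M q P \<and>
    (\<forall>z\<in>proper M ` inputs M. bp_success M P f z = machine_success M f z) \<and>
    (coins M = {} \<and> machine_computes M f \<longrightarrow> bp_computes M P f) \<and>
    (\<forall>x\<in>inputs M.
       (\<forall>i<depth P. emitted_at P x i \<noteq> [] \<longrightarrow> i \<le> 2 * q * query_count M x) \<and>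
       (\<forall>i\<le>depth P. 2 * q * query_count M x < i \<longrightarrow> visit P x i = None) \<and>
       (\<Sum>i\<le>depth P. code_length (visit P x i))
          \<le> 2 * q * (\<Sum>t<length (mholds M x). live_count M t x) \<and>
       2 * real q * real (\<Sum>t<length (mholds M x). live_count M t x)
          \<le> 2 * real q * action M x / \<Delta>) \<and>
    cumulative_memory P
       \<le> 2 * real q * (\<Sum>r<Max (query_count M ` inputs M).
                         live_cost (Max (query_live M r ` inputs M))) \<and>
    ((\<forall>r. \<forall>x\<in>inputs M. \<forall>y\<in>inputs M. r < query_count M x \<and> r < query_count M y \<longrightarrow>
         query_hold M r x = query_hold M r y) \<longrightarrow>
     cumulative_memory P
       \<le> 2 * real q * (\<Sum>t<Max ((\<lambda>x. length (mholds M x)) ` inputs M).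
                         live_cost (Max (live_count M t ` inputs M))))"
proof -
  interpret synchronous_running M \<Delta> q
    using assms by unfold_locales
  obtain P where P: "leveled_bp (nwords M) (wlen (sub M)) P" "depth P = top_level" "source P = Some ([], [])"
    "\<And>i. nodes P i = (\<lambda>x. node x i) ` inputs M \<union> (if i = 0 then {} else {None})"
    "\<And>x i. \<lbrakk>x \<in> inputs M; i \<le> top_level\<rbrakk> \<Longrightarrow> visit P x i = node x i"
    "\<And>x i. \<lbrakk>x \<in> inputs M; i < top_level\<rbrakk> \<Longrightarrow> emitted_at P x i = emission x i"
    "\<And>i c. i < top_level \<Longrightarrow> emit P i None c = []"
    using that by (rule program_exists)
  \<comment> \<open>An equivalence for arbitrary y: with coins, the program has to succeed on
    exactly those inputs on which the machine does.\<close>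
  have emits: "emits_exactly P x y \<longleftrightarrow> machine_output M x = y" if x: "x \<in> inputs M" for x y
  proof -
    have "map (emitted_at P x) [0..<top_level] = map (emission x) [0..<top_level]"
      by (rule map_cong[OF refl]) (simp add: P(6)[OF x])
    then have "emitted P x = concat (map (emission x) [0..<top_level])" unfolding emitted_def P(2) by (rule arg_cong)
    then show ?thesis
      using set_emission[OF x blocks_below_top[OF x]] by (simp add: emits_exactly_def graph_eq_iff)
  qed
  have "encodes M q P"
    unfolding encodes_def P(2)
  proof (intro conjI ballI allI impI)
    show "source P = Some ([], [])" by (rule P(3))
    show "None \<in> nodes P i" if "i \<in> {1..top_level}" for i using that by (simp add: P(4))
    show "emit P i None c = []" if "i < top_level" for i c using that by (rule P(7))
    show "\<exists>x\<in>inputs M. visit P x i = v" if i: "i \<in> {1..top_level}" and v: "v \<in> nodes P i" "v \<noteq> None" for i v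
    proof -
      obtain x where "x \<in> inputs M" "v = node x i" using v i by (auto simp: P(4))
      then show ?thesis using P(5) i by auto
    qed
    show "2 * q * query_count M x \<le> top_level" if "x \<in> inputs M" for x
      using blocks_below_top[OF that] by simp
    show "visit P x i = round_code M x ((i - 1) div (2 * q)) ((i - 1) mod (2 * q))"
      if "x \<in> inputs M" "i \<in> {1..2 * q * query_count M x}" for x i
      using that blocks_below_top[OF that(1)] P(5)[OF that(1), of i] by (simp add: node_def)
  qed
  moreover have "bp_success M P f z = machine_success M f z" if "z \<in> proper M ` inputs M" for z
    unfolding bp_success_def machine_success_def
  proof (rule prob_coin_space_cong[OF that])
    fix x assume "x \<in> inputs M"
    then show "emits_exactly P x (f z) \<longleftrightarrow> machine_output M x = f z" by (rule emits)
  qed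
  moreover have "bp_computes M P f" if "coins M = {} \<and> machine_computes M f"
    using that emits by (simp add: bp_computes_def machine_computes_def)
  moreover have "\<forall>i<depth P. emitted_at P x i \<noteq> [] \<longrightarrow> i \<le> 2 * q * query_count M x"
    "\<forall>i\<le>depth P. 2 * q * query_count M x < i \<longrightarrow> visit P x i = None"
    "(\<Sum>i\<le>depth P. code_length (visit P x i)) \<le> 2 * q * (\<Sum>t<length (mholds M x). live_count M t x)"
    "2 * real q * real (\<Sum>t<length (mholds M x). live_count M t x) \<le> 2 * real q * action M x / \<Delta>"
    if x: "x \<in> inputs M" for x
  proof -
    show "\<forall>i<depth P. emitted_at P x i \<noteq> [] \<longrightarrow> i \<le> 2 * q * query_count M x"
      using P(2) P(6)[OF x] by (auto simp: emission_def)
    show "\<forall>i\<le>depth P. 2 * q * query_count M x < i \<longrightarrow> visit P x i = None"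
      using P(2) P(5)[OF x] by (auto simp: node_None)
    have "(\<Sum>i\<le>depth P. code_length (visit P x i)) = (\<Sum>i\<le>top_level. code_length (node x i))"
      unfolding P(2) by (intro sum.cong refl) (simp add: P(5)[OF x])
    then show "(\<Sum>i\<le>depth P. code_length (visit P x i)) \<le> 2 * q * (\<Sum>t<length (mholds M x). live_count M t x)"
      using sum_code_length[OF x] by simp
    have "real (\<Sum>t<length (mholds M x). live_count M t x) \<le> action M x / \<Delta>"
      using live_action[OF x] assms(2) by (simp add: pos_le_divide_eq mult.commute)
    then have "2 * real q * real (\<Sum>t<length (mholds M x). live_count M t x) \<le> 2 * real q * (action M x / \<Delta>)"
      by (rule mult_left_mono) simp
    then show "2 * real q * real (\<Sum>t<length (mholds M x). live_count M t x) \<le> 2 * real q * action M x / \<Delta>"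
      by simp
  qed
  moreover note mem = cumulative_memory_le[OF P(2,4)]
  moreover have "cumulative_memory P \<le> 2 * real q * (\<Sum>t<Max ((\<lambda>x. length (mholds M x)) ` inputs M).
      live_cost (Max (live_count M t ` inputs M)))"
    if "\<forall>r. \<forall>x\<in>inputs M. \<forall>y\<in>inputs M. r < query_count M x \<and> r < query_count M y \<longrightarrow>
      query_hold M r x = query_hold M r y"
    using mem mult_left_mono[OF live_costs_aligned[OF that], of "2 * real q"] by linarith
  ultimately show ?thesis using P(1) by (intro exI[of _ P] conjI ballI impI)
qed

end
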